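(* For any $\varepsilon>0$, there exist constants $\delta>0$ and $\mu_0>1$ such that for any $\mu\ge\mu_0$ the solution $u$ of the linear Cauchy problem $$u_{tt}-\Delta u+\frac{\mu}{1+t}u_t=0 \ \text{ in } (0,\infty)\times\mathbf{R}^n,\qquad (u,u_t)(0,x)=(u_0,u_1)(x),$$ with compactly supported data $(u_0,u_1)\in H^1(\mathbf{R}^n)\times L^2(\mathbf{R}^n)$, satisfies $$\int_{\mathbf{R}^n}e^{2\psi}u^2\,dx\le C_{\mu,\varepsilon}(1+t)^{-n+\varepsilon},$$ $$\int_{\mathbf{R}^n}e^{2\psi}\bigl(u_t^2+|\nabla u|^2\bigr)\,dx\le C_{\mu,\varepsilon}(1+t)^{-n-2+\varepsilon}$$ for $t\ge 0$, where $$\psi(t,x)=\frac{a|x|^2}{(1+t)^2},\qquad a=\frac{\mu}{2(2+\delta)},$$ and $C_{\mu,\varepsilon}$ is a positive constant depending on $\mu$, $\varepsilon$ and $\|(u_0,u_1)\|_{H^1\times L^2}$.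
   Context: Here $n\ge 1$ is the space dimension, $H^1(\mathbf{R}^n)$ is the usual Sobolev space, and $\nabla$ and $\Delta$ act in the space variable $x\in\mathbf{R}^n$. The solution is the one in the energy class $u\in C([0,\infty);H^1(\mathbf{R}^n))\cap C^1([0,\infty);L^2(\mathbf{R}^n))$.
   Formalization: The constant may also depend on a compact set containing the supports of the data; with dependence only on μ, ε and the norm the first bound fails at t=0, since translating u_0 keeps its norm but makes the weighted integral arbitrarily large. *)

theory Defs
  imports "HOL-Analysis.Analysis"
begin

section \<open>Test functions\<close>

fun C_k :: "nat \<Rightarrow> ('a::euclidean_space \<Rightarrow> real) \<Rightarrow> bool" where
  "C_k 0 f \<longleftrightarrow> continuous_on UNIV f"
| "C_k (Suc k) f \<longleftrightarrow>
     (\<forall>x. f differentiable (at x)) \<and> (\<forall>v. C_k k (\<lambda>x. frechet_derivative f (at x) v))"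

definition test_functions :: "'a::euclidean_space set \<Rightarrow> ('a \<Rightarrow> real) set" where
  "test_functions U =
     {\<phi>. (\<forall>k. C_k k \<phi>) \<and> compact (closure {x. \<phi> x \<noteq> 0}) \<and> closure {x. \<phi> x \<noteq> 0} \<subseteq> U}"

section \<open>The spaces \<open>L\<^sup>2\<close> and \<open>H\<^sup>1\<close>\<close>

text \<open>
  Elements of \<open>L\<^sup>2\<close> and \<open>H\<^sup>1\<close> are represented by Borel functions. All notions below are
  invariant under changes on null sets.
\<close>

definition L2_space :: "('a::euclidean_space \<Rightarrow> 'b::euclidean_space) set" where
  "L2_space = {f \<in> borel_measurable lborel. integrable lborel (\<lambda>x. (norm (f x))\<^sup>2)}"

definition L2_norm :: "('a::euclidean_space \<Rightarrow> 'b::euclidean_space) \<Rightarrow> real" where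
  "L2_norm f = sqrt (\<integral>x. (norm (f x))\<^sup>2 \<partial>lborel)"

definition locally_integrable :: "('a::euclidean_space \<Rightarrow> 'b::euclidean_space) \<Rightarrow> bool" where
  "locally_integrable f \<longleftrightarrow> (\<forall>K. compact K \<longrightarrow> set_integrable lborel K f)"

definition has_weak_gradient :: "('a::euclidean_space \<Rightarrow> real) \<Rightarrow> ('a \<Rightarrow> 'a) \<Rightarrow> bool" where
  "has_weak_gradient f g \<longleftrightarrow>
     locally_integrable f \<and> locally_integrable g \<and>
     (\<forall>\<phi>\<in>test_functions UNIV. \<forall>b\<in>Basis.
        (\<integral>x. f x * frechet_derivative \<phi> (at x) b \<partial>lborel) = - (\<integral>x. (g x \<bullet> b) * \<phi> x \<partial>lborel))"

text \<open>The weak gradient is unique up to null sets; this picks a representative.\<close>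

definition weak_gradient :: "('a::euclidean_space \<Rightarrow> real) \<Rightarrow> 'a \<Rightarrow> 'a" where
  "weak_gradient f = (SOME g. has_weak_gradient f g)"

definition H1_space :: "('a::euclidean_space \<Rightarrow> real) set" where
  "H1_space = {f \<in> L2_space. \<exists>g\<in>L2_space. has_weak_gradient f g}"

definition H1_norm :: "('a::euclidean_space \<Rightarrow> real) \<Rightarrow> real" where
  "H1_norm f = sqrt ((L2_norm f)\<^sup>2 + (L2_norm (weak_gradient f))\<^sup>2)"

definition data_norm :: "('a::euclidean_space \<Rightarrow> real) \<Rightarrow> ('a \<Rightarrow> real) \<Rightarrow> real" where
  "data_norm u0 u1 = sqrt ((H1_norm u0)\<^sup>2 + (L2_norm u1)\<^sup>2)"

definition supported_in :: "'a::euclidean_space set \<Rightarrow> ('a \<Rightarrow> real) \<Rightarrow> bool" where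
  "supported_in K f \<longleftrightarrow> (AE x in lborel. x \<notin> K \<longrightarrow> f x = 0)"

section \<open>Energy solutions\<close>

text \<open>
  \<open>u t\<close> and \<open>v t\<close> stand for \<open>u(t, \<cdot>)\<close> and \<open>u\<^sub>t(t, \<cdot>)\<close>; only times \<open>t \<ge> 0\<close> matter, and the limits
  at \<open>0\<close> are one-sided.
\<close>

definition energy_class ::
    "(real \<Rightarrow> 'a::euclidean_space \<Rightarrow> real) \<Rightarrow> (real \<Rightarrow> 'a \<Rightarrow> real) \<Rightarrow> bool" where
  "energy_class u v \<longleftrightarrow>
     (\<forall>t\<ge>0. u t \<in> H1_space \<and> v t \<in> L2_space \<and>
        ((\<lambda>s. H1_norm (\<lambda>x. u s x - u t x)) \<longlongrightarrow> 0) (at t within {0..}) \<and>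
        ((\<lambda>s. L2_norm (\<lambda>x. (u s x - u t x) / (s - t) - v t x)) \<longlongrightarrow> 0) (at t within {0..}) \<and>
        ((\<lambda>s. L2_norm (\<lambda>x. v s x - v t x)) \<longlongrightarrow> 0) (at t within {0..}))"

text \<open>
  The equation \<open>u\<^sub>t\<^sub>t - \<Delta>u + \<mu>/(1+t) u\<^sub>t = 0\<close> in the sense of distributions on \<open>(0,\<infinity>) \<times> \<real>\<^sup>n\<close>,
  with one derivative of each second order term moved to the test function. In terms of the
  Frechet derivative \<open>D\<phi>\<close>, \<open>\<phi>\<^sub>t = D\<phi>(1,0)\<close> and \<open>\<nabla>\<phi> \<bullet> \<nabla>u = D\<phi>(0,\<nabla>u)\<close>. The integral is iterated
  because representatives chosen separately for each \<open>t\<close> need not be jointly measurable.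
\<close>

definition solves_damped_wave ::
    "real \<Rightarrow> (real \<Rightarrow> 'a::euclidean_space \<Rightarrow> real) \<Rightarrow> (real \<Rightarrow> 'a \<Rightarrow> real) \<Rightarrow> bool" where
  "solves_damped_wave \<mu> u v \<longleftrightarrow>
     (\<forall>\<phi>\<in>test_functions ({0<..} \<times> UNIV).
        (LINT t:{0<..}|lborel. (\<integral>x.
             - v t x * frechet_derivative \<phi> (at (t, x)) (1, 0)
             + frechet_derivative \<phi> (at (t, x)) (0, weak_gradient (u t) x)
             + \<mu> / (1 + t) * v t x * \<phi> (t, x) \<partial>lborel)) = 0)"

definition energy_solution ::
    "real \<Rightarrow> ('a::euclidean_space \<Rightarrow> real) \<Rightarrow> ('a \<Rightarrow> real) \<Rightarrow>
     (real \<Rightarrow> 'a \<Rightarrow> real) \<Rightarrow> (real \<Rightarrow> 'a \<Rightarrow> real) \<Rightarrow> bool" where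
  "energy_solution \<mu> u0 u1 u v \<longleftrightarrow>
     energy_class u v \<and> solves_damped_wave \<mu> u v \<and>
     (AE x in lborel. u 0 x = u0 x) \<and> (AE x in lborel. v 0 x = u1 x)"

definition weight :: "real \<Rightarrow> real \<Rightarrow> 'a::euclidean_space \<Rightarrow> real" where
  "weight a t x = a * (norm x)\<^sup>2 / (1 + t)\<^sup>2"

end

theory Submission
  imports Defs "HOL-Computational_Algebra.Polynomial"
begin

text \<open>
  Mollifying in \<open>x\<close> only commutes with the equation, as its coefficients depend on \<open>t\<close> alone, and
  turns an energy solution into a pointwise one; all estimates are done there, with constants depending
  on the data norms only, and passed to the limit with Fatou's lemma.

  With \<open>\<tau> = 1 + t\<close>, the choice of \<open>\<psi>\<close> gives \<open>- 2 \<psi> / \<tau> = \<psi>\<^sub>t\<close>, \<open>\<mu> / \<tau> * (- \<psi>\<^sub>t) = (2 + \<delta>) \<bar>\<nabla>\<psi>\<bar>\<^sup>2\<close> and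
  \<open>\<Delta>\<psi> = n / (2 + \<delta>) * \<mu> / \<tau>\<^sup>2\<close>. For \<open>k\<close> slightly below \<open>n + 1\<close> a single functional,
  \<open>\<integral> e\<^bsup>2\<psi>\<^esup> (\<tau>\<^bsup>k + 1\<^esup> (u\<^sub>t\<^sup>2 + \<bar>\<nabla>u\<bar>\<^sup>2) / 2 + \<nu> \<tau>\<^sup>k (u u\<^sub>t + \<mu> / (2 \<tau>) u\<^sup>2))\<close>, is nonincreasing: \<open>\<Delta>\<psi>\<close> provides the
  decay rate of \<open>u\<^sup>2\<close>, a large \<open>\<nu>\<close> absorbs \<open>\<bar>\<nabla>u\<bar>\<^sup>2\<close>, and then a large \<open>\<mu>\<close> absorbs \<open>u\<^sub>t\<^sup>2\<close>. The weight is
  bounded on the support at time \<open>0\<close>, which is compact and spreads with speed \<open>1\<close>.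
\<close>

section \<open>Smooth functions and the standard bump\<close>

text \<open>An energy solution has no second derivatives, and its slices are chosen separately for
  each t, so neither the multiplier computation nor a mollification in t is directly available.
  Convolution in x meets both obstacles: its value at a point is a bounded functional on L^2, so
  regularity in time becomes pointwise, and testing with products of a function of t and a mollifier
  leaves an ordinary differential equation in t for each x. The \<delta> in \<open>a\<close> is the
  room that makes one functional suffice. For \<delta> = 0 the quadratic form in
  \<bar>\<nabla>u\<bar> and \<bar>u \<nabla>\<psi>\<bar> left by the multiplier u degenerates to a
  square; \<delta> > 0 leaves the fraction \<delta>' = \<delta> / (5 + \<delta>) of both terms. That
  fraction of \<nu> \<bar>\<nabla>u\<bar>^2 has to pay for the growth of the power of 1 + t, which
  fixes \<nu>. On the other side \<delta> weakens \<Delta>\<psi>: n / (2 + \<delta>) must exceed (k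
  - 1) / 2, so k stays below n + 1 and \<delta> is of size \<epsilon> / n. The growing weight does
  no harm in the fluxes, because finite speed of propagation is proved beforehand, for the mollified
  solution and from the same balance law.\<close>

abbreviation partial :: "('a::euclidean_space \<Rightarrow> real) \<Rightarrow> 'a \<Rightarrow> 'a \<Rightarrow> real" where
  "partial f b \<equiv> \<lambda>x. frechet_derivative f (at x) b"

text \<open>\<open>frechet_derivative\<close> is a choice operator, so \<open>C_k\<close> cannot be
  checked by computing with it. Uniqueness of the derivative lets an explicit formula
  \<open>D\<close> stand in for it.\<close>

lemma C_k_intro:
  assumes "\<And>x. (f has_derivative D x) (at x)" "\<And>v. C_k k (\<lambda>x. D x v)"
  shows "C_k (Suc k) f"
proof -
  have "frechet_derivative f (at x) = D x" for x
    using assms(1) frechet_derivative_at by metis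
  then show ?thesis
    using assms by (auto simp: differentiable_def)
qed

lemma C_k_has_derivative:
  "C_k (Suc k) f \<Longrightarrow> (f has_derivative frechet_derivative f (at x)) (at x)"
  by (simp add: frechet_derivative_works)

lemma C_k_frechet: "C_k (Suc k) f \<Longrightarrow> C_k k (\<lambda>x. frechet_derivative f (at x) v)"
  by simp

lemma C_k_Suc_D: "C_k (Suc k) f \<Longrightarrow> C_k k f"
proof (induction k arbitrary: f)
  case 0
  then show ?case
    by (auto intro!: differentiable_imp_continuous_on simp: differentiable_on_def
        intro: differentiable_at_withinI)
next
  case (Suc k)
  then show ?case
    by (meson C_k.simps(2))
qed

lemma C_k_imp_continuous: "C_k k f \<Longrightarrow> continuous_on UNIV f"
  by (induction k) (auto dest: C_k_Suc_D simp del: C_k.simps(2))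

lemma C_k_const: "C_k k (\<lambda>x. c)"
proof (induction k arbitrary: c)
  case (Suc k)
  show ?case
    by (rule C_k_intro[where D="\<lambda>x v. 0"]) (auto intro!: Suc)
qed simp

lemma C_k_add:
  "C_k k f \<Longrightarrow> C_k k g \<Longrightarrow> C_k k (\<lambda>x. f x + g x)"
proof (induction k arbitrary: f g)
  case 0
  then show ?case by (auto intro: continuous_on_add)
next
  case (Suc k)
  show ?case
    by (rule C_k_intro[OF has_derivative_add[OF Suc.prems[THEN C_k_has_derivative]]])
      (intro Suc.IH C_k_frechet Suc.prems)
qed

lemma C_k_mult:
  "C_k k f \<Longrightarrow> C_k k g \<Longrightarrow> C_k k (\<lambda>x. f x * g x)"
proof (induction k arbitrary: f g)
  case 0
  then show ?case by (auto intro: continuous_on_mult)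
next
  case (Suc k)
  show ?case
    by (rule C_k_intro[OF has_derivative_mult[OF Suc.prems[THEN C_k_has_derivative]]])
      (intro C_k_add Suc.IH C_k_frechet Suc.prems C_k_Suc_D[OF Suc.prems(1)] C_k_Suc_D[OF Suc.prems(2)])
qed

text \<open>Serves the scaling of the bump, the reflection y -> x - y inside convolutions, and the
  two projections of space-time.\<close>

lemma C_k_affine:
  assumes "bounded_linear L"
  shows "C_k k f \<Longrightarrow> C_k k (\<lambda>x. f (c + L x))"
proof (induction k arbitrary: f)
  case 0
  have "continuous_on UNIV (\<lambda>x. c + L x)"
    by (intro continuous_on_add continuous_on_const linear_continuous_on assms)
  then have "continuous_on UNIV (\<lambda>x. f (c + L x))"
    by (rule continuous_on_compose2[rotated]) (use 0 in auto)
  then show ?case by simp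
next
  case (Suc k)
  have *: "((\<lambda>x. c + L x) has_derivative L) (at x)" for x
    by (auto intro!: derivative_eq_intros bounded_linear.has_derivative[OF assms])
  show ?case
    by (rule C_k_intro[OF has_derivative_compose[OF * C_k_has_derivative[OF Suc.prems]]])
      (rule Suc.IH[OF C_k_frechet[OF Suc.prems]])
qed

text \<open>Differentiating \<open>H j (q x)\<close> produces \<open>H (Suc j) (q x)\<close>, so the
  outer function comes with the whole sequence of its derivatives and the induction on
  \<open>k\<close> is general in \<open>j\<close>.\<close>

lemma C_k_compose_real:
  fixes q :: "'a::euclidean_space \<Rightarrow> real" and H :: "nat \<Rightarrow> real \<Rightarrow> real"
  assumes H: "\<And>j s. (H j has_real_derivative H (Suc j) s) (at s)"
    and q: "\<And>k. C_k k q"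
  shows "C_k k (\<lambda>x. H j (q x))"
proof (induction k arbitrary: j)
  case 0
  have "continuous_on UNIV (H j)"
    by (rule DERIV_continuous_on[where D="H (Suc j)"]) (use H in simp)
  with q[of 0] show ?case
    by (auto intro: continuous_on_compose2)
next
  case (Suc k)
  have *: "((\<lambda>x. H j (q x)) has_derivative (\<lambda>v. frechet_derivative q (at x) v * H (Suc j) (q x))) (at x)" for x
    using has_derivative_compose[OF C_k_has_derivative[OF q] H[of j, unfolded has_field_derivative_def]]
    by (simp add: mult.commute)
  show ?case
    by (rule C_k_intro[OF *]) (intro C_k_mult Suc C_k_frechet q)
qed

lemma C_k_linear:
  assumes "bounded_linear (L :: 'a::euclidean_space \<Rightarrow> real)"
  shows "C_k k L"
proof (cases k)
  case 0
  with assms show ?thesis by (simp add: linear_continuous_on)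
next
  case (Suc j)
  then show ?thesis
    by (simp only:, intro C_k_intro[of L "\<lambda>x. L"] bounded_linear_imp_has_derivative[OF assms] C_k_const)
qed

lemma C_k_inner_self: "C_k k (\<lambda>x::'a::euclidean_space. x \<bullet> x)"
proof (cases k)
  case (Suc j)
  have *: "((\<lambda>x::'a. x \<bullet> x) has_derivative (\<lambda>v. 2 * (x \<bullet> v))) (at x)" for x
    by (auto intro!: derivative_eq_intros simp: inner_commute)
  have "bounded_linear (\<lambda>x::'a. 2 * (x \<bullet> v))" for v
    by (intro bounded_linear_const_mult bounded_linear_inner_left)
  then show ?thesis
    unfolding Suc by (intro C_k_intro[OF *] C_k_linear)
qed (simp add: continuous_on_inner)

section \<open>The flat function and the smooth bump\<close>

text \<open>The classical exp(-1/s), continued by zero, with polynomial factors in 1/s: these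
  factors make the family closed under differentiation, as \<open>C_k_compose_real\<close>
  requires.\<close>

definition flat :: "real poly \<Rightarrow> real \<Rightarrow> real" where
  "flat p s = (if s > 0 then poly p (1 / s) * exp (- (1 / s)) else 0)"

text \<open>With X = 1/s one has X' = - X^2. This gives the factor \<open>[:0, 0, 1:]\<close>, a
  plus sign when the derivative falls on exp(-X), and a minus sign when it falls on the
  polynomial.\<close>

definition flat_deriv :: "real poly \<Rightarrow> real poly" where
  "flat_deriv p = [:0, 0, 1:] * (p - pderiv p)"

lemma poly_times_exp_tendsto_0: "((\<lambda>u. poly p u * exp (- u)) \<longlongrightarrow> (0::real)) at_top"
proof -
  have "((\<lambda>u. \<Sum>i\<le>degree p. coeff p i * (u ^ i / exp u)) \<longlongrightarrow> (\<Sum>i\<le>degree p. coeff p i * 0)) at_top"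
    by (intro tendsto_intros tendsto_power_div_exp_0)
  then show ?thesis
    by (simp add: poly_altdef sum_distrib_right exp_minus divide_inverse mult.assoc)
qed

lemma flat_has_derivative: "(flat p has_real_derivative flat (flat_deriv p) s) (at s)"
proof -
  consider "s > 0" | "s < 0" | "s = 0" by linarith
  then show ?thesis
  proof cases
    case 1
    have "((\<lambda>s. poly p (1 / s) * exp (- (1 / s))) has_real_derivative flat (flat_deriv p) s) (at s)"
    proof -
      have i: "((\<lambda>s. 1 / s) has_real_derivative - (1 / s\<^sup>2)) (at s)"
        using 1 by (auto intro!: derivative_eq_intros simp: power2_eq_square)
      have "((\<lambda>s. exp (- (1 / s))) has_real_derivative exp (- (1 / s)) * (1 / s\<^sup>2)) (at s)"
        using DERIV_chain2[OF DERIV_exp DERIV_minus[OF i]] by simp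
      from DERIV_mult[OF DERIV_chain2[OF poly_DERIV i, of p] this] show ?thesis
        by (rule DERIV_cong) (use 1 in \<open>simp add: flat_def flat_deriv_def power2_eq_square algebra_simps\<close>)
    qed
    moreover have "eventually (\<lambda>s. flat p s = poly p (1 / s) * exp (- (1 / s))) (nhds s)"
      using eventually_nhds_in_open[of "{0<..}" s] 1 by (auto simp: flat_def elim!: eventually_mono)
    ultimately show ?thesis
      by (subst DERIV_cong_ev[OF refl _ refl]) auto
  next
    case 2
    have "eventually (\<lambda>s. flat p s = 0) (nhds s)"
      using eventually_nhds_in_open[of "{..<0}" s] 2 by (auto simp: flat_def elim!: eventually_mono)
    then show ?thesis
      using 2 by (subst DERIV_cong_ev[OF refl _ refl]) (auto simp: flat_def)
  next
    case 3
    have "((\<lambda>h. flat p h / h) \<longlongrightarrow> 0) (at 0)"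
    proof (rule filterlim_split_at)
      show "((\<lambda>h. flat p h / h) \<longlongrightarrow> 0) (at_left 0)"
        by (rule tendsto_eventually, rule eventually_at_leftI[of "-1"]) (auto simp: flat_def)
      \<comment> \<open>For h > 0 the division by h is one more factor 1/h, so the difference
        quotient is again a polynomial in 1/h times exp(-1/h).\<close>
      have "((\<lambda>h. poly ([:0,1:] * p) (inverse h) * exp (- inverse h)) \<longlongrightarrow> 0) (at_right 0)"
        by (rule filterlim_compose[OF poly_times_exp_tendsto_0 filterlim_inverse_at_top_right])
      then show "((\<lambda>h. flat p h / h) \<longlongrightarrow> 0) (at_right 0)"
        by (rule Lim_transform_eventually)
          (rule eventually_at_rightI[of 0 1], auto simp: flat_def divide_inverse)
    qed
    then show ?thesis
      using 3 by (simp add: DERIV_def flat_def)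
  qed
qed

lemma test_functionsI:
  assumes "\<And>k. C_k k f" "compact S" "S \<subseteq> U" "\<And>x. x \<notin> S \<Longrightarrow> f x = 0"
  shows "f \<in> test_functions U"
proof -
  have "closure {x. f x \<noteq> 0} \<subseteq> S"
    using assms(2,4) by (intro closure_minimal) (auto intro: compact_imp_closed)
  then show ?thesis
    using assms compact_Int_closed[OF \<open>compact S\<close> closed_closure, of "{x. f x \<noteq> 0}"]
    by (auto simp: test_functions_def inf.absorb2)
qed

text \<open>The squared norm keeps the argument polynomial and hence smooth at the origin. The bump
  is positive exactly on the open unit ball.\<close>

definition bump :: "'a::euclidean_space \<Rightarrow> real" where
  "bump x = flat 1 (1 - x \<bullet> x)"

lemma C_k_bump: "C_k k bump"
proof -
  define H where "H j = flat ((flat_deriv ^^ j) 1)" for j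
  have "C_k k (\<lambda>x. H 0 (1 + (-1) * (x \<bullet> x)))"
    by (rule C_k_compose_real)
      (simp add: H_def flat_has_derivative, intro C_k_add C_k_const C_k_mult C_k_inner_self)
  then show ?thesis
    by (simp add: H_def bump_def[abs_def])
qed

section \<open>Differentiation under the integral sign\<close>

lemma lborel_distr_reflect: "distr lborel borel (\<lambda>x. c - x) = (lborel :: 'a::euclidean_space measure)"
  using lborel_affine[of "-1" c] by (simp add: density_1)

lemma lborel_integral_reflect:
  fixes f :: "'a::euclidean_space \<Rightarrow> real"
  assumes [measurable]: "f \<in> borel_measurable borel"
  shows "(\<integral>x. f (c - x) \<partial>lborel) = (\<integral>x. f x \<partial>lborel)"
  by (subst (2) lborel_distr_reflect[of c, symmetric]) (simp add: integral_distr)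

lemma lborel_integrable_reflect:
  fixes f :: "'a::euclidean_space \<Rightarrow> real"
  assumes [measurable]: "f \<in> borel_measurable borel"
  shows "integrable lborel (\<lambda>x. f (c - x)) \<longleftrightarrow> integrable lborel f"
  by (subst (2) lborel_distr_reflect[of c, symmetric]) (simp add: integrable_distr_eq)

lemma lborel_integral_translate:
  fixes f :: "'a::euclidean_space \<Rightarrow> real"
  assumes [measurable]: "f \<in> borel_measurable borel"
  shows "(\<integral>x. f (x + c) \<partial>lborel) = (\<integral>x. f x \<partial>lborel)"
  by (subst (2) lborel_distr_plus[of c, symmetric]) (simp add: integral_distr add.commute)

lemma integrable_bounded_support:
  fixes f :: "'a::euclidean_space \<Rightarrow> real"
  assumes [measurable]: "f \<in> borel_measurable borel"
    and "\<And>x. \<bar>f x\<bar> \<le> B" "\<And>x. r < norm x \<Longrightarrow> f x = 0"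
  shows "integrable lborel f"
proof (rule Bochner_Integration.integrable_bound)
  show "integrable lborel (\<lambda>x::'a. B * indicator (cball 0 r) x)"
    by (auto intro!: integrable_mult_right integrable_real_indicator emeasure_lborel_cball_finite)
  show "AE x in lborel. norm (f x) \<le> norm (B * indicator (cball 0 r) x)"
    using assms(2,3) by (auto simp: indicator_def not_le) (use abs_ge_self order_trans in blast)
qed simp

text \<open>The mean value inequality on the convex set \<open>S\<close> bounds every difference
  quotient by \<open>g\<close>, and dominated convergence applies along each sequence. Derivatives
  are taken within \<open>S\<close> so that one-sided derivatives at time 0 are covered.\<close>

lemma has_real_derivative_integral:
  fixes F :: "real \<Rightarrow> 'a \<Rightarrow> real"
  assumes "convex S" "t0 \<in> S"
    and d: "\<And>t x. t \<in> S \<Longrightarrow> ((\<lambda>t. F t x) has_real_derivative F' t x) (at t within S)"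
    and bd: "\<And>t x. t \<in> S \<Longrightarrow> \<bar>F' t x\<bar> \<le> g x"
    and g: "integrable M g"
    and F: "\<And>t. t \<in> S \<Longrightarrow> integrable M (F t)"
  shows "((\<lambda>t. \<integral>x. F t x \<partial>M) has_real_derivative (\<integral>x. F' t0 x \<partial>M)) (at t0 within S)"
  unfolding has_field_derivative_iff tendsto_at_iff_sequentially
proof (intro allI impI)
  fix X :: "nat \<Rightarrow> real"
  assume "\<forall>i. X i \<in> S - {t0}" and X: "X \<longlonglongrightarrow> t0"
  then have XS: "X i \<in> S" "X i \<noteq> t0" for i by auto
  define q where "q i x = (F (X i) x - F t0 x) / (X i - t0)" for i x
  have q_lim: "(\<lambda>i. q i x) \<longlonglongrightarrow> F' t0 x" for x
    using d[OF \<open>t0 \<in> S\<close>, of x] XS X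
    unfolding has_field_derivative_iff tendsto_at_iff_sequentially q_def by (auto simp: o_def)
  have q_meas [measurable]: "q i \<in> borel_measurable M" for i
    using F[OF XS(1)] F[OF \<open>t0 \<in> S\<close>] unfolding q_def[abs_def] by measurable
  have q_bd: "\<bar>q i x\<bar> \<le> g x" for i x
  proof -
    have "norm (F (X i) x - F t0 x) \<le> g x * norm (X i - t0)"
      by (rule field_differentiable_bound[OF \<open>convex S\<close>, of "\<lambda>t. F t x" "\<lambda>t. F' t x"])
        (use d bd XS \<open>t0 \<in> S\<close> in auto)
    then show ?thesis
      using XS(2)[of i] by (simp add: q_def field_simps)
  qed
  have "(\<lambda>i. \<integral>x. q i x \<partial>M) \<longlonglongrightarrow> (\<integral>x. F' t0 x \<partial>M)"
    by (rule integral_dominated_convergence[where w=g])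
      (use q_lim q_bd g in \<open>auto intro: borel_measurable_LIMSEQ_real[where u=q]\<close>)
  also have "(\<lambda>i. \<integral>x. q i x \<partial>M) = (\<lambda>y. ((\<integral>x. F y x \<partial>M) - (\<integral>x. F t0 x \<partial>M)) / (y - t0)) \<circ> X"
    using F XS \<open>t0 \<in> S\<close> by (auto simp: q_def o_def)
  finally show "((\<lambda>y. ((\<integral>x. F y x \<partial>M) - (\<integral>x. F t0 x \<partial>M)) / (y - t0)) \<circ> X)
      \<longlonglongrightarrow> (\<integral>x. F' t0 x \<partial>M)" .
qed

section \<open>Directional derivatives\<close>

text \<open>Differentiability along lines is what mollification delivers directly and all that the
  divergence of a flux involves; products and chains then reduce to calculus in one
  variable.\<close>

definition has_partial :: "'a::real_normed_vector \<Rightarrow> ('a \<Rightarrow> real) \<Rightarrow> ('a \<Rightarrow> real) \<Rightarrow> bool" where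
  "has_partial e f g \<longleftrightarrow> (\<forall>x. ((\<lambda>s. f (x + s *\<^sub>R e)) has_real_derivative g x) (at 0))"

lemma has_partial_at:
  assumes "has_partial e f g"
  shows "((\<lambda>s. f (x + s *\<^sub>R e)) has_real_derivative g (x + s *\<^sub>R e)) (at s)"
proof -
  have "((\<lambda>r. f (x + (r + s) *\<^sub>R e)) has_real_derivative g (x + s *\<^sub>R e)) (at 0)"
    using assms[unfolded has_partial_def, rule_format, of "x + s *\<^sub>R e"]
    by (simp add: scaleR_add_left add.commute add.left_commute)
  then show ?thesis
    using DERIV_shift[of "\<lambda>s. f (x + s *\<^sub>R e)" _ 0 s] by simp
qed

lemma has_partial_zero_outside:
  fixes e :: "'a::euclidean_space"
  assumes "has_partial e f g" "\<And>x. r < norm x \<Longrightarrow> f x = 0" "r < norm x"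
  shows "g x = 0"
proof -
  have "continuous_on UNIV (\<lambda>s::real. x + s *\<^sub>R e)"
    by (intro continuous_intros)
  then have "open ((\<lambda>s::real. x + s *\<^sub>R e) -` {x. r < norm x})"
    by (intro open_vimage open_Collect_less continuous_intros)
  then have "eventually (\<lambda>s::real. r < norm (x + s *\<^sub>R e)) (nhds 0)"
    using eventually_nhds_in_open[of _ 0] \<open>r < norm x\<close> by fastforce
  then have "eventually (\<lambda>s. f (x + s *\<^sub>R e) = 0) (nhds 0)"
    by (rule eventually_mono) (rule assms(2))
  then have "((\<lambda>s. f (x + s *\<^sub>R e)) has_real_derivative 0) (at 0)"
    by (subst DERIV_cong_ev[OF refl _ refl]) auto
  moreover have "((\<lambda>s. f (x + s *\<^sub>R e)) has_real_derivative g x) (at 0)"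
    using assms(1) by (auto simp: has_partial_def)
  ultimately show ?thesis
    by (rule DERIV_unique[rotated])
qed

lemma less_norm_translate:
  fixes e :: "'a::real_normed_vector"
  assumes "s \<in> {-1..1}" "r + norm e < norm x"
  shows "r < norm (x + s *\<^sub>R e)"
proof -
  have "norm x \<le> norm (x + s *\<^sub>R e) + norm (s *\<^sub>R e)"
    using norm_triangle_ineq4[of "x + s *\<^sub>R e" "s *\<^sub>R e"] by simp
  moreover have "norm (s *\<^sub>R e) \<le> norm e"
    using assms(1) by (auto simp: mult_left_le_one_le)
  ultimately show ?thesis using assms(2) by linarith
qed

text \<open>The divergence theorem without boundary terms, by translation invariance: the integral
  of \<open>f (x + s *\<^sub>R e)\<close> does not depend on s, and its derivative at s = 0 is the
  integral of \<open>g\<close>.\<close>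

lemma integral_has_partial_eq_0:
  fixes f :: "'a::euclidean_space \<Rightarrow> real"
  assumes p: "has_partial e f g"
    and [measurable]: "f \<in> borel_measurable borel"
    and f: "\<And>x. \<bar>f x\<bar> \<le> B" and g: "\<And>x. \<bar>g x\<bar> \<le> B"
    and supp: "\<And>x. r < norm x \<Longrightarrow> f x = 0"
  shows "(\<integral>x. g x \<partial>lborel) = 0"
proof -
  have B: "0 \<le> B" using f[of 0] by linarith
  \<comment> \<open>For s in [-1, 1] all translates vanish outside one ball of radius
    \<open>r + norm e\<close>; this supplies the integrable majorant.\<close>
  have "((\<lambda>s. \<integral>x. f (x + s *\<^sub>R e) \<partial>lborel) has_real_derivative (\<integral>x. g (x + 0 *\<^sub>R e) \<partial>lborel)) (at 0 within {-1..1})"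
  proof (rule has_real_derivative_integral[where F'="\<lambda>s x. g (x + s *\<^sub>R e)"
        and g="\<lambda>x. B * indicator (cball 0 (r + norm e)) x"])
    fix s :: real and x :: 'a
    assume s: "s \<in> {-1..1}"
    show "((\<lambda>s. f (x + s *\<^sub>R e)) has_real_derivative g (x + s *\<^sub>R e)) (at s within {-1..1})"
      by (rule has_field_derivative_at_within[OF has_partial_at[OF p]])
    show "\<bar>g (x + s *\<^sub>R e)\<bar> \<le> B * indicator (cball 0 (r + norm e)) x"
      using g B has_partial_zero_outside[OF p supp less_norm_translate[OF s]] by (auto simp: indicator_def not_le)
    show "integrable lborel (\<lambda>x. f (x + s *\<^sub>R e))"
    proof (rule integrable_bounded_support)
      show "f (y + s *\<^sub>R e) = 0" if "r + norm e < norm y" for y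
        by (rule supp[OF less_norm_translate[OF s that]])
    qed (use f in auto)
  next
    show "integrable lborel (\<lambda>x::'a. B * indicator (cball 0 (r + norm e)) x)"
      by (auto intro!: integrable_mult_right integrable_real_indicator emeasure_lborel_cball_finite)
  qed auto
  then have "((\<lambda>s::real. \<integral>x. f x \<partial>lborel) has_real_derivative (\<integral>x. g x \<partial>lborel)) (at 0)"
    by (simp add: lborel_integral_translate at_within_Icc_at)
  then show ?thesis
    using DERIV_const DERIV_unique by blast
qed

lemma has_partial_add:
  "has_partial e f f' \<Longrightarrow> has_partial e g g' \<Longrightarrow> has_partial e (\<lambda>x. f x + g x) (\<lambda>x. f' x + g' x)"
  unfolding has_partial_def by (auto intro!: DERIV_add)

lemma has_partial_mult:
  assumes "has_partial e f f'" "has_partial e g g'"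
  shows "has_partial e (\<lambda>x. f x * g x) (\<lambda>x. f' x * g x + f x * g' x)"
proof -
  have "((\<lambda>s. f (x + s *\<^sub>R e) * g (x + s *\<^sub>R e)) has_real_derivative f' x * g x + f x * g' x) (at 0)" for x
    using assms by (auto simp: has_partial_def intro!: derivative_eq_intros)
  then show ?thesis by (simp add: has_partial_def)
qed

lemma has_partial_const: "has_partial e (\<lambda>x. c) (\<lambda>x. 0)"
  by (simp add: has_partial_def)

lemma has_partial_cmult: "has_partial e f f' \<Longrightarrow> has_partial e (\<lambda>x. c * f x) (\<lambda>x. c * f' x)"
  using has_partial_mult[OF has_partial_const] by fastforce

lemma has_partial_chain:
  assumes "\<And>x. (h has_real_derivative h' (f x)) (at (f x))" "has_partial e f g"
  shows "has_partial e (\<lambda>x. h (f x)) (\<lambda>x. h' (f x) * g x)"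
proof -
  have "((\<lambda>s. h (f (x + s *\<^sub>R e))) has_real_derivative h' (f x) * g x) (at 0)" for x
    using DERIV_chain2[of h "h' (f x)" "\<lambda>s. f (x + s *\<^sub>R e)" 0 "g x"] assms
    by (simp add: has_partial_def)
  then show ?thesis by (simp add: has_partial_def)
qed

lemma has_derivative_imp_partial:
  assumes "\<And>x. (f has_derivative D x) (at x)"
  shows "has_partial e f (\<lambda>x. D x e)"
  unfolding has_partial_def
proof
  fix x
  have "((\<lambda>s. x + s *\<^sub>R e) has_derivative (\<lambda>s. s *\<^sub>R e)) (at 0)"
    by (auto intro!: derivative_eq_intros)
  then have "((\<lambda>s. f (x + s *\<^sub>R e)) has_derivative (\<lambda>s. D x (s *\<^sub>R e))) (at 0)"
    by (rule has_derivative_compose) (use assms in simp)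
  moreover have "D x (s *\<^sub>R e) = D x e * s" for s
    using linear_cmul[OF has_derivative_linear[OF assms]] by simp
  ultimately show "((\<lambda>s. f (x + s *\<^sub>R e)) has_real_derivative D x e) (at 0)"
    by (simp add: has_field_derivative_def mult_commute_abs)
qed

section \<open>Convolution on \<open>L\<^sup>2\<close>\<close>

lemma L2_real_iff:
  "(f :: 'a::euclidean_space \<Rightarrow> real) \<in> L2_space \<longleftrightarrow>
    f \<in> borel_measurable borel \<and> integrable lborel (\<lambda>x. (f x)\<^sup>2)"
  by (simp add: L2_space_def)

lemma L2_space_measurable: "f \<in> L2_space \<Longrightarrow> f \<in> borel_measurable borel"
  by (simp add: L2_space_def)

lemma L2_norm_real: "L2_norm (f :: 'a::euclidean_space \<Rightarrow> real) = sqrt (\<integral>x. (f x)\<^sup>2 \<partial>lborel)"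
  by (simp add: L2_norm_def)

lemma L2_norm_nonneg [simp]: "0 \<le> L2_norm f"
  by (simp add: L2_norm_def)

lemma L2_norm_power2: "(L2_norm f)\<^sup>2 = (\<integral>x. (norm (f x))\<^sup>2 \<partial>lborel)"
  by (simp add: L2_norm_def)

lemma L2_mult_integrable:
  fixes f g :: "'a::euclidean_space \<Rightarrow> real"
  assumes "f \<in> L2_space" "g \<in> L2_space"
  shows "integrable lborel (\<lambda>x. f x * g x)"
proof (rule Bochner_Integration.integrable_bound)
  show "integrable lborel (\<lambda>x. (f x)\<^sup>2 + (g x)\<^sup>2)"
    using assms by (auto simp: L2_real_iff)
  have "2 * \<bar>f x * g x\<bar> \<le> (f x)\<^sup>2 + (g x)\<^sup>2" for x
    using sum_squares_bound[of "\<bar>f x\<bar>" "\<bar>g x\<bar>"] by (simp add: abs_mult)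
  then have "\<bar>f x * g x\<bar> \<le> (f x)\<^sup>2 + (g x)\<^sup>2" for x
    by (smt (verit))
  then show "AE x in lborel. norm (f x * g x) \<le> norm ((f x)\<^sup>2 + (g x)\<^sup>2)"
    by auto
qed (use assms in \<open>auto simp: L2_real_iff\<close>)

lemma L2_diff:
  fixes f g :: "'a::euclidean_space \<Rightarrow> 'b::euclidean_space"
  assumes "f \<in> L2_space" "g \<in> L2_space"
  shows "(\<lambda>x. f x - g x) \<in> L2_space"
proof -
  have [measurable]: "f \<in> borel_measurable borel" "g \<in> borel_measurable borel"
    using assms by (auto dest: L2_space_measurable)
  have "(norm (f x - g x))\<^sup>2 \<le> 2 * (norm (f x))\<^sup>2 + 2 * (norm (g x))\<^sup>2" for x
  proof -
    have "(norm (f x - g x))\<^sup>2 \<le> (norm (f x) + norm (g x))\<^sup>2"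
      by (intro power_mono norm_triangle_ineq4) simp
    also have "\<dots> \<le> 2 * (norm (f x))\<^sup>2 + 2 * (norm (g x))\<^sup>2"
      using sum_squares_bound[of "norm (f x)" "norm (g x)"] by (simp add: power2_sum)
    finally show ?thesis .
  qed
  moreover have "integrable lborel (\<lambda>x. 2 * (norm (f x))\<^sup>2 + 2 * (norm (g x))\<^sup>2)"
    using assms by (auto simp: L2_space_def)
  ultimately have "integrable lborel (\<lambda>x. (norm (f x - g x))\<^sup>2)"
    by (elim Bochner_Integration.integrable_bound) auto
  then show ?thesis by (simp add: L2_space_def)
qed

lemma L2_cmult:
  fixes f :: "'a::euclidean_space \<Rightarrow> real"
  assumes "f \<in> L2_space"
  shows "(\<lambda>x. c * f x) \<in> L2_space"
  using assms by (auto simp: L2_real_iff power_mult_distrib)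

lemma L2_Cauchy_Schwarz:
  fixes f g :: "'a::euclidean_space \<Rightarrow> real"
  assumes "f \<in> L2_space" "g \<in> L2_space"
  shows "\<bar>\<integral>x. f x * g x \<partial>lborel\<bar> \<le> L2_norm f * L2_norm g"
proof -
  define A B P where "A = (\<integral>x. (f x)\<^sup>2 \<partial>lborel)" and "B = (\<integral>x. (g x)\<^sup>2 \<partial>lborel)"
    and "P = (\<integral>x. f x * g x \<partial>lborel)"
  have q: "0 \<le> c\<^sup>2 * A - 2 * c * P + B" for c
  proof -
    have "0 \<le> (\<integral>x. (c * f x - g x)\<^sup>2 \<partial>lborel)" by simp
    also have "(\<lambda>x. (c * f x - g x)\<^sup>2) = (\<lambda>x. c\<^sup>2 * (f x)\<^sup>2 - 2 * c * (f x * g x) + (g x)\<^sup>2)"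
      by (auto simp: power2_diff power_mult_distrib algebra_simps)
    also have "(\<integral>x. c\<^sup>2 * (f x)\<^sup>2 - 2 * c * (f x * g x) + (g x)\<^sup>2 \<partial>lborel) = c\<^sup>2 * A - 2 * c * P + B"
      using assms L2_mult_integrable[OF assms] by (simp add: A_def B_def P_def L2_real_iff)
    finally show ?thesis .
  qed
  have A: "0 \<le> A" and B: "0 \<le> B" by (simp_all add: A_def B_def)
  have "P\<^sup>2 \<le> A * B"
  proof (cases "A = 0")
    case True
    have "P = 0"
    proof (rule ccontr)
      assume "P \<noteq> 0"
      \<comment> \<open>For A = 0 the quadratic is affine in c, and at this c it takes the value
        -1.\<close>
      then show False using q[of "(B + 1) / (2 * P)"] True B by simp
    qed
    then show ?thesis using True by simp
  next
    case False
    with A have "A > 0" by simp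
    have "0 \<le> B - P\<^sup>2 / A"
      using q[of "P / A"] \<open>A > 0\<close> by (simp add: power2_eq_square field_simps)
    then show ?thesis using \<open>A > 0\<close> by (simp add: field_simps)
  qed
  then have "\<bar>P\<bar> \<le> sqrt (A * B)"
    using real_sqrt_le_mono by fastforce
  then show ?thesis
    by (simp add: A_def B_def P_def L2_norm_real real_sqrt_mult)
qed

lemma L2_norm_triangle:
  fixes f g :: "'a::euclidean_space \<Rightarrow> real"
  assumes "f \<in> L2_space" "g \<in> L2_space"
  shows "L2_norm (\<lambda>x. f x + g x) \<le> L2_norm f + L2_norm g"
proof (rule power2_le_imp_le)
  have "(L2_norm (\<lambda>x. f x + g x))\<^sup>2 = (\<integral>x. (f x)\<^sup>2 + (g x)\<^sup>2 + 2 * (f x * g x) \<partial>lborel)"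
    by (simp add: L2_norm_power2 power2_sum mult.assoc)
  also have "\<dots> = (L2_norm f)\<^sup>2 + (L2_norm g)\<^sup>2 + 2 * (\<integral>x. f x * g x \<partial>lborel)"
    using assms L2_mult_integrable[OF assms] by (simp add: L2_norm_power2 L2_real_iff)
  also have "\<dots> \<le> (L2_norm f + L2_norm g)\<^sup>2"
    using L2_Cauchy_Schwarz[OF assms] by (simp add: power2_sum)
  finally show "(L2_norm (\<lambda>x. f x + g x))\<^sup>2 \<le> (L2_norm f + L2_norm g)\<^sup>2" .
qed simp

lemma L2_norm_minus_commute:
  "L2_norm (\<lambda>x. f x - g x) = L2_norm (\<lambda>x. g x - f x)"
  by (simp add: L2_norm_def norm_minus_commute)

lemma L2_norm_triangle_reverse:
  fixes f g :: "'a::euclidean_space \<Rightarrow> real"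
  assumes "f \<in> L2_space" "g \<in> L2_space"
  shows "\<bar>L2_norm f - L2_norm g\<bar> \<le> L2_norm (\<lambda>x. f x - g x)"
  using L2_norm_triangle[OF L2_diff[OF assms] assms(2)]
    L2_norm_triangle[OF L2_diff[OF assms(2,1)] assms(1)] L2_norm_minus_commute[of f g]
  by simp

lemma L2_space_component:
  fixes G :: "'a::euclidean_space \<Rightarrow> 'a"
  assumes G: "G \<in> L2_space" and e: "e \<in> Basis"
  shows "(\<lambda>x. G x \<bullet> e) \<in> L2_space" "L2_norm (\<lambda>x. G x \<bullet> e) \<le> L2_norm G"
proof -
  have [measurable]: "G \<in> borel_measurable borel"
    and i: "integrable lborel (\<lambda>x. (norm (G x))\<^sup>2)"
    using G by (auto simp: L2_space_def)
  have le: "(G x \<bullet> e)\<^sup>2 \<le> (norm (G x))\<^sup>2" for x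
    using Basis_le_norm[OF e, of "G x"] by (metis abs_norm_cancel abs_le_square_iff)
  have i': "integrable lborel (\<lambda>x. (G x \<bullet> e)\<^sup>2)"
    by (rule Bochner_Integration.integrable_bound[OF i]) (use le in auto)
  then show "(\<lambda>x. G x \<bullet> e) \<in> L2_space"
    by (simp add: L2_real_iff)
  show "L2_norm (\<lambda>x. G x \<bullet> e) \<le> L2_norm G"
    unfolding L2_norm_def using i i' le by (auto intro!: integral_mono)
qed

lemma locally_integrable_measurable:
  fixes f :: "'a::euclidean_space \<Rightarrow> 'b::euclidean_space"
  assumes "locally_integrable f"
  shows "f \<in> borel_measurable borel"
proof -
  have "(\<lambda>x. indicator (cball 0 (real n)) x *\<^sub>R f x) \<in> borel_measurable borel" for n
    using assms[unfolded locally_integrable_def, rule_format, of "cball 0 (real n)"]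
    by (auto simp: set_integrable_def dest: borel_measurable_integrable)
  moreover have "(\<lambda>n. indicator (cball 0 (real n)) x *\<^sub>R f x) \<longlonglongrightarrow> f x" for x
  proof (rule tendsto_eventually)
    have "eventually (\<lambda>n. norm x \<le> real n) sequentially"
      by real_asymp
    then show "eventually (\<lambda>n. indicator (cball 0 (real n)) x *\<^sub>R f x = f x) sequentially"
      by (rule eventually_mono) (simp add: indicator_def)
  qed
  ultimately show ?thesis
    by (rule borel_measurable_LIMSEQ_metric)
qed

lemma L2_locally_integrable:
  fixes f :: "'a::euclidean_space \<Rightarrow> 'b::euclidean_space"
  assumes "f \<in> L2_space"
  shows "locally_integrable f"
  unfolding locally_integrable_def set_integrable_def
proof (intro allI impI)
  fix K :: "'a set"
  assume K: "compact K"
  have [measurable]: "f \<in> borel_measurable borel" "K \<in> sets borel"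
    using assms K by (auto simp: L2_space_def borel_compact)
  show "integrable lborel (\<lambda>x. indicator K x *\<^sub>R f x)"
  proof (rule Bochner_Integration.integrable_bound)
    show "integrable lborel (\<lambda>x. (norm (f x))\<^sup>2 + indicator K x)"
      using assms emeasure_compact_finite[OF K]
      by (auto simp: L2_space_def intro!: integrable_real_indicator)
    have "norm (f x) \<le> (norm (f x))\<^sup>2 + 1" for x
      using sum_squares_bound[of "norm (f x)" 1] norm_ge_zero[of "f x"] by (simp, linarith)
    then show "AE x in lborel. norm (indicator K x *\<^sub>R f x) \<le> norm ((norm (f x))\<^sup>2 + indicator K x :: real)"
      by (auto simp: indicator_def)
  qed simp
qed

section \<open>Kernels and convolutions\<close>

text \<open>Wide enough to contain mollifiers together with their directional derivatives, which
  change sign, and also the test functions with their derivatives.\<close>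

definition kernel :: "real \<Rightarrow> ('a::euclidean_space \<Rightarrow> real) \<Rightarrow> bool" where
  "kernel r \<kappa> \<longleftrightarrow> continuous_on UNIV \<kappa> \<and> (\<forall>x. r < norm x \<longrightarrow> \<kappa> x = 0)"

definition conv :: "('a::euclidean_space \<Rightarrow> real) \<Rightarrow> ('a \<Rightarrow> real) \<Rightarrow> 'a \<Rightarrow> real" where
  "conv \<kappa> f x = (\<integral>y. \<kappa> (x - y) * f y \<partial>lborel)"

lemma kernel_bounded:
  assumes "kernel r \<kappa>"
  obtains M where "0 \<le> M" "\<And>x. \<bar>\<kappa> x\<bar> \<le> M"
proof -
  have "compact (\<kappa> ` cball 0 r)"
    using assms by (intro compact_continuous_image) (auto simp: kernel_def intro: continuous_on_subset)
  then obtain M where M: "\<And>x. x \<in> cball 0 r \<Longrightarrow> \<bar>\<kappa> x\<bar> \<le> M"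
    by (fastforce simp: bounded_iff dest!: compact_imp_bounded)
  have "\<bar>\<kappa> x\<bar> \<le> max 0 M" for x
    using M[of x] assms by (cases "r < norm x") (auto simp: kernel_def)
  then show ?thesis by (intro that[of "max 0 M"]) auto
qed

lemma kernel_measurable: "kernel r \<kappa> \<Longrightarrow> \<kappa> \<in> borel_measurable borel"
  by (auto simp: kernel_def intro: borel_measurable_continuous_onI)

lemma kernel_L2:
  assumes "kernel r \<kappa>"
  shows "\<kappa> \<in> L2_space" "(\<lambda>y. \<kappa> (x - y)) \<in> L2_space" "L2_norm (\<lambda>y. \<kappa> (x - y)) = L2_norm \<kappa>"
proof -
  note [measurable] = kernel_measurable[OF assms]
  obtain M where "0 \<le> M" "\<And>x. \<bar>\<kappa> x\<bar> \<le> M"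
    using kernel_bounded[OF assms] by blast
  then have "integrable lborel (\<lambda>x. (\<kappa> x)\<^sup>2)"
    by (intro integrable_bounded_support[where B="M\<^sup>2" and r=r])
      (use assms in \<open>auto simp: kernel_def abs_le_square_iff[symmetric]\<close>)
  then show "\<kappa> \<in> L2_space" "(\<lambda>y. \<kappa> (x - y)) \<in> L2_space"
    by (simp_all add: L2_real_iff lborel_integrable_reflect[of "\<lambda>x. (\<kappa> x)\<^sup>2"])
  show "L2_norm (\<lambda>y. \<kappa> (x - y)) = L2_norm \<kappa>"
    by (simp add: L2_norm_real lborel_integral_reflect[of "\<lambda>x. (\<kappa> x)\<^sup>2"])
qed

text \<open>Cauchy-Schwarz. The bound is uniform in x, and it turns the L^2-valued continuity and
  differentiability in time of an energy solution into pointwise statements about its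
  convolutions.\<close>

lemma abs_conv_le:
  assumes "kernel r \<kappa>" "f \<in> L2_space"
  shows "\<bar>conv \<kappa> f x\<bar> \<le> L2_norm \<kappa> * L2_norm f"
  using L2_Cauchy_Schwarz[OF kernel_L2(2)[OF assms(1)] assms(2)] kernel_L2(3)[OF assms(1)]
  by (simp add: conv_def)

lemma indicator_integrable:
  fixes f :: "'a::euclidean_space \<Rightarrow> real"
  assumes "locally_integrable f" "compact K"
  shows "integrable lborel (\<lambda>y. indicator K y * \<bar>f y\<bar>)"
proof -
  have "integrable lborel (\<lambda>y. indicator K y *\<^sub>R f y)"
    using assms by (auto simp: locally_integrable_def set_integrable_def)
  from integrable_norm[OF this] show ?thesis
    by (simp add: abs_mult)
qed

lemma conv_integrable:
  assumes "kernel r \<kappa>" "locally_integrable f"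
  shows "integrable lborel (\<lambda>y. \<kappa> (x - y) * f y)"
proof -
  note [measurable] = kernel_measurable[OF assms(1)] locally_integrable_measurable[OF assms(2)]
  obtain M where M: "0 \<le> M" "\<And>x. \<bar>\<kappa> x\<bar> \<le> M"
    using kernel_bounded[OF assms(1)] by blast
  show ?thesis
  proof (rule Bochner_Integration.integrable_bound)
    show "integrable lborel (\<lambda>y. M * (indicator (cball x r) y * \<bar>f y\<bar>))"
      by (intro integrable_mult_right indicator_integrable assms(2)) auto
    show "AE y in lborel. norm (\<kappa> (x - y) * f y) \<le> norm (M * (indicator (cball x r) y * \<bar>f y\<bar>))"
      using M assms(1) by (auto simp: kernel_def abs_mult indicator_def dist_norm not_le intro!: mult_right_mono)
  qed simp
qed

lemma conv_diff:
  assumes "kernel r \<kappa>" "locally_integrable f" "locally_integrable g"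
  shows "conv \<kappa> (\<lambda>x. f x - g x) x = conv \<kappa> f x - conv \<kappa> g x"
  using conv_integrable[OF assms(1,2)] conv_integrable[OF assms(1,3)]
  by (simp add: conv_def right_diff_distrib)

lemma conv_cmult: "conv \<kappa> (\<lambda>x. c * f x) x = c * conv \<kappa> f x"
proof -
  have "(\<lambda>y. \<kappa> (x - y) * (c * f y)) = (\<lambda>y. c * (\<kappa> (x - y) * f y))"
    by (auto simp: algebra_simps)
  then show ?thesis
    by (simp add: conv_def)
qed

lemma conv_continuous:
  assumes "kernel r \<kappa>" "locally_integrable f"
  shows "continuous_on UNIV (conv \<kappa> f)"
  unfolding continuous_on_sequentially comp_def conv_def
proof (intro ballI allI impI, elim conjE)
  note [measurable] = kernel_measurable[OF assms(1)] locally_integrable_measurable[OF assms(2)]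
  obtain M where M: "0 \<le> M" "\<And>x. \<bar>\<kappa> x\<bar> \<le> M"
    using kernel_bounded[OF assms(1)] by blast
  fix X :: "nat \<Rightarrow> 'a" and x assume X: "X \<longlonglongrightarrow> x"
  then obtain R where R: "\<And>n. norm (X n) \<le> R"
    using convergent_imp_bounded[OF X] by (auto simp: bounded_iff)
  show "(\<lambda>n. \<integral>y. \<kappa> (X n - y) * f y \<partial>lborel) \<longlonglongrightarrow> (\<integral>y. \<kappa> (x - y) * f y \<partial>lborel)"
  proof (rule integral_dominated_convergence[where w="\<lambda>y. M * (indicator (cball 0 (R + r)) y * \<bar>f y\<bar>)"])
    show "integrable lborel (\<lambda>y. M * (indicator (cball 0 (R + r)) y * \<bar>f y\<bar>))"
      by (intro integrable_mult_right indicator_integrable assms(2)) auto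
    have "isCont \<kappa> z" for z
      using assms(1) by (simp add: kernel_def continuous_on_eq_continuous_at)
    then have "(\<lambda>n. \<kappa> (X n - y)) \<longlonglongrightarrow> \<kappa> (x - y)" for y
      by (rule isCont_tendsto_compose) (intro tendsto_intros X)
    then show "AE y in lborel. (\<lambda>n. \<kappa> (X n - y) * f y) \<longlonglongrightarrow> \<kappa> (x - y) * f y"
      by (intro AE_I2 tendsto_intros)
    fix n
    have "\<kappa> (X n - y) = 0" if "R + r < norm y" for y
    proof -
      have "norm y \<le> norm (X n) + norm (X n - y)"
        using norm_triangle_ineq4[of "X n" "X n - y"] by simp
      then have "r < norm (X n - y)" using that R[of n] by linarith
      then show ?thesis using assms(1) by (simp add: kernel_def)
    qed
    then show "AE y in lborel. norm (\<kappa> (X n - y) * f y) \<le> M * (indicator (cball 0 (R + r)) y * \<bar>f y\<bar>)"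
      using M by (auto simp: abs_mult indicator_def not_le intro!: mult_right_mono)
  qed auto
qed

lemma conv_has_partial:
  assumes "kernel r \<kappa>" "kernel r \<kappa>'" "has_partial e \<kappa> \<kappa>'" "locally_integrable f"
  shows "has_partial e (conv \<kappa> f) (conv \<kappa>' f)"
  unfolding has_partial_def conv_def
proof
  fix x
  note [measurable] = kernel_measurable[OF assms(1)] locally_integrable_measurable[OF assms(4)]
  obtain M where M: "0 \<le> M" "\<And>x. \<bar>\<kappa>' x\<bar> \<le> M"
    using kernel_bounded[OF assms(2)] by blast
  have "((\<lambda>s. \<integral>y. \<kappa> (x + s *\<^sub>R e - y) * f y \<partial>lborel) has_real_derivative
      (\<integral>y. \<kappa>' (x + 0 *\<^sub>R e - y) * f y \<partial>lborel)) (at 0 within {-1..1})"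
  proof (rule has_real_derivative_integral[where F'="\<lambda>s y. \<kappa>' (x + s *\<^sub>R e - y) * f y"
        and g="\<lambda>y. M * (indicator (cball x (r + norm e)) y * \<bar>f y\<bar>)"])
    fix s :: real and y
    assume s: "s \<in> {-1..1}"
    have "((\<lambda>s. \<kappa> (x - y + s *\<^sub>R e)) has_real_derivative \<kappa>' (x - y + s *\<^sub>R e)) (at s within {-1..1})"
      by (rule has_field_derivative_at_within[OF has_partial_at[OF assms(3)]])
    from DERIV_cmult_right[OF this, of "f y"]
    show "((\<lambda>s. \<kappa> (x + s *\<^sub>R e - y) * f y) has_real_derivative \<kappa>' (x + s *\<^sub>R e - y) * f y) (at s within {-1..1})"
      by (simp add: algebra_simps)
    have "\<kappa>' (x + s *\<^sub>R e - y) = 0" if "r + norm e < norm (x - y)"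
      using less_norm_translate[OF s that] assms(2) by (simp add: kernel_def algebra_simps)
    then show "\<bar>\<kappa>' (x + s *\<^sub>R e - y) * f y\<bar> \<le> M * (indicator (cball x (r + norm e)) y * \<bar>f y\<bar>)"
      using M by (auto simp: abs_mult indicator_def dist_norm not_le intro!: mult_right_mono)
    show "integrable lborel (\<lambda>y. \<kappa> (x + s *\<^sub>R e - y) * f y)"
      by (rule conv_integrable[OF assms(1,4)])
  next
    show "integrable lborel (\<lambda>y. M * (indicator (cball x (r + norm e)) y * \<bar>f y\<bar>))"
      by (intro integrable_mult_right indicator_integrable assms(4)) auto
  qed auto
  then show "((\<lambda>s. \<integral>y. \<kappa> (x + s *\<^sub>R e - y) * f y \<partial>lborel) has_real_derivative
      (\<integral>y. \<kappa>' (x - y) * f y \<partial>lborel)) (at 0)"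
    by (simp add: at_within_Icc_at)
qed

lemma conv_zero_outside:
  fixes \<kappa> :: "'a::euclidean_space \<Rightarrow> real"
  assumes "kernel r \<kappa>" "AE y in lborel. R < norm y \<longrightarrow> f y = 0" "R + r < norm x"
  shows "conv \<kappa> f x = 0"
proof -
  have "AE y in lborel. \<kappa> (x - y) * f y = 0"
    using assms(2)
  proof eventually_elim
    case (elim y)
    show ?case
    proof (cases "R < norm y")
      case False
      then have "r < norm (x - y)"
        using norm_triangle_ineq2[of x y] assms(3) by linarith
      then show ?thesis using assms(1) by (simp add: kernel_def)
    qed (use elim in simp)
  qed
  then show ?thesis
    unfolding conv_def by (intro integral_eq_zero_AE)
qed

section \<open>Mollification\<close>

definition mollifier :: "real \<Rightarrow> ('a::euclidean_space \<Rightarrow> real) \<Rightarrow> bool" where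
  "mollifier e \<rho> \<longleftrightarrow> kernel e \<rho> \<and> (\<forall>k. C_k k \<rho>) \<and> (\<forall>x. 0 \<le> \<rho> x) \<and> (\<integral>x. \<rho> x \<partial>lborel) = 1"

lemma mollifierD:
  assumes "mollifier e \<rho>"
  shows "kernel e \<rho>" "\<And>k. C_k k \<rho>" "\<And>x. 0 \<le> \<rho> x" "(\<integral>x. \<rho> x \<partial>lborel) = 1" "integrable lborel \<rho>"
  using assms not_integrable_integral_eq by (fastforce simp: mollifier_def)+

lemma continuous_AE_zero:
  fixes f :: "'a::euclidean_space \<Rightarrow> real"
  assumes "continuous_on UNIV f" "AE x in lborel. f x = 0"
  shows "f x = 0"
proof -
  have "open {x. f x \<noteq> 0}"
    by (intro open_Collect_neq assms(1) continuous_on_const)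
  moreover have "negligible {x. f x \<noteq> 0}"
  proof -
    have "AE x in lebesgue. f x = 0"
      using assms(2) by (rule AE_completion)
    then have "{x \<in> space lebesgue. \<not> f x = 0} \<in> null_sets lebesgue"
      by (simp add: completion.AE_iff_null_sets Collect_neg_eq completion.complete2)
    then show ?thesis
      by (simp add: negligible_iff_null_sets)
  qed
  ultimately have "{x. f x \<noteq> 0} = {}"
    using open_not_negligible by blast
  then show ?thesis by auto
qed

lemma bump_nonneg: "0 \<le> bump x"
  by (simp add: bump_def flat_def)

lemma bump_eq_0:
  assumes "1 \<le> norm x"
  shows "bump x = 0"
proof -
  have "1 \<le> (norm x)\<^sup>2"
    using assms by (rule one_le_power)
  then show ?thesis
    by (simp add: bump_def flat_def dot_square_norm)
qed

lemma mollifier_exists: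
  assumes "0 < e"
  shows "\<exists>\<rho>::'a::euclidean_space \<Rightarrow> real. mollifier e \<rho>"
proof -
  define b where "b x = bump (x /\<^sub>R e)" for x :: 'a
  have b0: "0 \<le> b x" for x
    by (simp add: b_def bump_nonneg)
  have Cb: "C_k k b" for k
    using C_k_affine[OF bounded_linear_scaleR_right C_k_bump, of k 0 "inverse e"] by (simp add: b_def[abs_def])
  have kb: "kernel e b"
    using C_k_imp_continuous[OF Cb] assms
    by (auto simp: kernel_def b_def intro!: bump_eq_0 simp: field_simps)
  have ib: "integrable lborel b"
  proof -
    obtain M where "\<And>x. \<bar>b x\<bar> \<le> M"
      using kernel_bounded[OF kb] by blast
    then show ?thesis
      using kb kernel_measurable[OF kb] by (intro integrable_bounded_support[where r=e]) (auto simp: kernel_def)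
  qed
  have "(\<integral>x. b x \<partial>lborel) \<noteq> 0"
  proof
    assume "(\<integral>x. b x \<partial>lborel) = 0"
    then have "AE x in lborel. b x = 0"
      using integral_nonneg_eq_0_iff_AE[OF ib] b0 by simp
    then have "b 0 = 0"
      by (rule continuous_AE_zero[rotated]) (use kb in \<open>simp add: kernel_def\<close>)
    then show False
      by (simp add: b_def bump_def flat_def)
  qed
  moreover have "0 \<le> (\<integral>x. b x \<partial>lborel)"
    by (simp add: b0)
  ultimately have pos: "0 < (\<integral>x. b x \<partial>lborel)" by simp
  have "mollifier e (\<lambda>x. inverse (\<integral>x. b x \<partial>lborel) * b x)"
    unfolding mollifier_def
  proof (intro conjI allI)
    show "kernel e (\<lambda>x. inverse (\<integral>x. b x \<partial>lborel) * b x)"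
      using kb by (auto simp: kernel_def intro!: continuous_on_mult continuous_on_const)
    show "C_k k (\<lambda>x. inverse (\<integral>x. b x \<partial>lborel) * b x)" for k
      by (intro C_k_mult C_k_const Cb)
  qed (use pos b0 in auto)
  then show ?thesis by blast
qed

text \<open>Tonelli, translation invariance and unit mass. The form for \<open>ennreal\<close>
  serves both the L^1 estimate, with the absolute value of a function as \<open>H\<close>, and the
  L^2 estimate, with its square.\<close>

lemma nn_integral_mollify:
  fixes H :: "'a::euclidean_space \<Rightarrow> ennreal"
  assumes m: "mollifier e \<rho>" and [measurable]: "H \<in> borel_measurable borel"
  shows "(\<integral>\<^sup>+x. (\<integral>\<^sup>+y. ennreal (\<rho> (x - y)) * H y \<partial>lborel) \<partial>lborel) = (\<integral>\<^sup>+y. H y \<partial>lborel)"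
proof -
  note [measurable] = kernel_measurable[OF mollifierD(1)[OF m]]
  have 1: "(\<integral>\<^sup>+x. ennreal (\<rho> x) \<partial>lborel) = 1"
    using mollifierD(3-5)[OF m] by (simp add: nn_integral_eq_integral)
  have "(\<integral>\<^sup>+x. (\<integral>\<^sup>+y. ennreal (\<rho> (x - y)) * H y \<partial>lborel) \<partial>lborel)
      = (\<integral>\<^sup>+y. (\<integral>\<^sup>+x. ennreal (\<rho> (x - y)) * H y \<partial>lborel) \<partial>lborel)"
    by (rule lborel_pair.Fubini') simp
  also have "\<dots> = (\<integral>\<^sup>+y. H y \<partial>lborel)"
  proof (rule nn_integral_cong)
    fix y :: 'a
    have "(\<integral>\<^sup>+x. ennreal (\<rho> (x - y)) \<partial>lborel) = (\<integral>\<^sup>+x. ennreal (\<rho> x) \<partial>lborel)"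
      by (subst (2) lborel_distr_plus[of "-y", symmetric]) (simp add: nn_integral_distr)
    then show "(\<integral>\<^sup>+x. ennreal (\<rho> (x - y)) * H y \<partial>lborel) = H y"
      using 1 by (simp add: nn_integral_multc)
  qed
  finally show ?thesis .
qed

text \<open>A mean with respect to the probability density y -> \<rho>(x - y) cannot leave an
  interval that contains all the values it averages.\<close>

lemma mollify_near:
  assumes m: "mollifier e \<rho>" and g: "locally_integrable g"
    and near: "\<And>y. dist x y \<le> e \<Longrightarrow> \<bar>g y - c\<bar> \<le> d"
  shows "\<bar>conv \<rho> g x - c\<bar> \<le> d"
proof -
  note [measurable] = kernel_measurable[OF mollifierD(1)[OF m]]
  note i = mollifierD(5)[OF m]
  from i have i': "integrable lborel (\<lambda>y. \<rho> (x - y))"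
    by (simp add: lborel_integrable_reflect)
  have 1: "(\<integral>y. \<rho> (x - y) \<partial>lborel) = 1"
    using mollifierD(4)[OF m] by (simp add: lborel_integral_reflect)
  note ig = conv_integrable[OF mollifierD(1)[OF m] g, of x]
  have le: "\<bar>\<rho> (x - y) * (g y - c)\<bar> \<le> d * \<rho> (x - y)" for y
  proof (cases "dist x y \<le> e")
    case True
    then show ?thesis
      using mult_left_mono[OF near[OF True] mollifierD(3)[OF m]] mollifierD(3)[OF m]
      by (simp add: abs_mult mult.commute)
  next
    case False
    then have "\<rho> (x - y) = 0"
      using mollifierD(1)[OF m] by (simp add: kernel_def dist_norm)
    then show ?thesis by simp
  qed
  have eq: "\<rho> (x - y) * (g y - c) = \<rho> (x - y) * g y - c * \<rho> (x - y)" for y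
    by (simp add: algebra_simps)
  have "conv \<rho> g x - c = (\<integral>y. \<rho> (x - y) * (g y - c) \<partial>lborel)"
    using ig i' 1 by (simp add: eq conv_def)
  also have "\<bar>\<dots>\<bar> \<le> (\<integral>y. \<bar>\<rho> (x - y) * (g y - c)\<bar> \<partial>lborel)"
    by (rule integral_abs_bound)
  also have "\<dots> \<le> (\<integral>y. d * \<rho> (x - y) \<partial>lborel)"
    using ig i' le by (intro integral_mono) (auto simp: eq)
  also have "\<dots> = d"
    using 1 by simp
  finally show ?thesis .
qed

lemma conv_abs_nn_le:
  assumes m: "mollifier e \<rho>" and h: "locally_integrable h"
  shows "ennreal \<bar>conv \<rho> h x\<bar> \<le> (\<integral>\<^sup>+y. ennreal (\<rho> (x - y)) * ennreal \<bar>h y\<bar> \<partial>lborel)"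
proof -
  have "ennreal \<bar>conv \<rho> h x\<bar> \<le> (\<integral>\<^sup>+y. norm (\<rho> (x - y) * h y) \<partial>lborel)"
    using integral_norm_bound_ennreal[OF conv_integrable[OF mollifierD(1)[OF m] h], of x]
    by (simp add: conv_def)
  also have "\<dots> = (\<integral>\<^sup>+y. ennreal (\<rho> (x - y)) * ennreal \<bar>h y\<bar> \<partial>lborel)"
    using mollifierD(3)[OF m] by (intro nn_integral_cong) (simp add: abs_mult ennreal_mult)
  finally show ?thesis .
qed

section \<open>Convergence of mollifications\<close>

text \<open>Measurable functions are almost everywhere limits of continuous ones, which is the
  content of \<open>measurable_on\<close>. Clipping to [-N, N] gives the difference the majorant 2 N
  on the ball, so this convergence holds in L^1 there; N is chosen beforehand so that clipping f
  itself costs at most d / 2.\<close>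

lemma continuous_L1_approx:
  fixes f :: "'a::euclidean_space \<Rightarrow> real"
  assumes f: "integrable lborel f" and "0 < d"
  shows "\<exists>g. continuous_on UNIV g \<and> (\<integral>\<^sup>+x\<in>cball 0 r. ennreal \<bar>f x - g x\<bar> \<partial>lborel) < ennreal d"
proof -
  note [measurable] = borel_measurable_integrable[OF f]
  have [measurable]: "cball (0::'a) r \<in> sets borel" by simp
  define clip where "clip N s = max (- N) (min N s)" for N s :: real
  have clip_cont: "continuous_on UNIV (clip N)" for N
    unfolding clip_def[abs_def] by (intro continuous_intros)
  have [measurable]: "clip N \<in> borel_measurable borel" for N
    by (rule borel_measurable_continuous_onI[OF clip_cont])
  have clip_bd: "\<bar>clip N s\<bar> \<le> N" if "0 \<le> N" for N s
    using that by (auto simp: clip_def)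
  have "(\<lambda>n. \<integral>\<^sup>+x. ennreal \<bar>f x - clip (real n) (f x)\<bar> \<partial>lborel) \<longlonglongrightarrow> (\<integral>\<^sup>+x. 0 \<partial>(lborel::'a measure))"
  proof (rule nn_integral_dominated_convergence[where w="\<lambda>x. ennreal \<bar>f x\<bar>"])
    show "(\<integral>\<^sup>+x. ennreal \<bar>f x\<bar> \<partial>lborel) < \<infinity>"
      using f by (simp add: integrable_iff_bounded)
    show "AE x in lborel. ennreal \<bar>f x - clip (real j) (f x)\<bar> \<le> ennreal \<bar>f x\<bar>" for j
      by (auto simp: clip_def intro!: ennreal_leI)
    have "eventually (\<lambda>n. ennreal \<bar>f x - clip (real n) (f x)\<bar> = 0) sequentially" for x
    proof -
      have "eventually (\<lambda>n. \<bar>f x\<bar> \<le> real n) sequentially" by real_asymp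
      then show ?thesis by eventually_elim (auto simp: clip_def)
    qed
    then show "AE x in lborel. (\<lambda>n. ennreal \<bar>f x - clip (real n) (f x)\<bar>) \<longlonglongrightarrow> 0"
      by (intro AE_I2 tendsto_eventually)
  qed auto
  then have "eventually (\<lambda>n. (\<integral>\<^sup>+x. ennreal \<bar>f x - clip (real n) (f x)\<bar> \<partial>lborel) < ennreal (d / 2)) sequentially"
    by (rule order_tendstoD(2)) (use \<open>0 < d\<close> in simp)
  then obtain N where N: "(\<integral>\<^sup>+x. ennreal \<bar>f x - clip (real N) (f x)\<bar> \<partial>lborel) < ennreal (d / 2)"
    by (auto simp: eventually_sequentially)
  have "f \<in> borel_measurable lebesgue"
    by (simp add: measurable_completion)
  then have "f measurable_on UNIV"
    by (rule lebesgue_measurable_imp_measurable_on) simp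
  then obtain Z g where Z: "negligible Z" and gc: "\<And>n. continuous_on UNIV (g n)"
    and gl: "\<And>x. x \<notin> Z \<Longrightarrow> (\<lambda>n. g n x) \<longlonglongrightarrow> f x"
    unfolding measurable_on_def by auto
  have [measurable]: "g n \<in> borel_measurable borel" for n
    by (rule borel_measurable_continuous_onI[OF gc])
  have AEZ: "AE x in lborel. x \<notin> Z"
    using AE_not_in[OF Z[unfolded negligible_iff_null_sets]] by (simp add: AE_completion_iff)
  have "(\<lambda>n. \<integral>\<^sup>+x\<in>cball 0 r. ennreal \<bar>clip (real N) (f x) - clip (real N) (g n x)\<bar> \<partial>lborel) \<longlonglongrightarrow> (\<integral>\<^sup>+x. 0 \<partial>(lborel::'a measure))"
  proof (rule nn_integral_dominated_convergence[where w="\<lambda>x. ennreal (2 * real N) * indicator (cball 0 r) x"])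
    show "(\<integral>\<^sup>+x. ennreal (2 * real N) * indicator (cball 0 r) x \<partial>(lborel::'a measure)) < \<infinity>"
      using emeasure_lborel_cball_finite[of "0::'a" r]
      by (simp add: nn_integral_cmult_indicator ennreal_mult_less_top)
    have "\<bar>clip (real N) s - clip (real N) t\<bar> \<le> 2 * real N" for s t
      using clip_bd[of "real N" s] clip_bd[of "real N" t] by simp
    then show "AE x in lborel. ennreal \<bar>clip (real N) (f x) - clip (real N) (g j x)\<bar> * indicator (cball 0 r) x
        \<le> ennreal (2 * real N) * indicator (cball 0 r) x" for j
      by (intro AE_I2 mult_right_mono ennreal_leI) auto
    show "AE x in lborel. (\<lambda>n. ennreal \<bar>clip (real N) (f x) - clip (real N) (g n x)\<bar> * indicator (cball 0 r) x) \<longlonglongrightarrow> 0"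
      using AEZ
    proof eventually_elim
      case (elim x)
      have "isCont (clip (real N)) (f x)"
        using clip_cont[of "real N"] by (simp add: continuous_on_eq_continuous_at)
      from isCont_tendsto_compose[OF this gl[OF elim]]
      have "(\<lambda>n. \<bar>clip (real N) (f x) - clip (real N) (g n x)\<bar>) \<longlonglongrightarrow> \<bar>clip (real N) (f x) - clip (real N) (f x)\<bar>"
        by (intro tendsto_intros)
      then have "(\<lambda>n. ennreal \<bar>clip (real N) (f x) - clip (real N) (g n x)\<bar>) \<longlonglongrightarrow> ennreal 0"
        by (intro tendsto_ennrealI) simp
      then show ?case
        by (cases "x \<in> cball 0 r") auto
    qed
  qed measurable
  then have "eventually (\<lambda>n. (\<integral>\<^sup>+x\<in>cball 0 r. ennreal \<bar>clip (real N) (f x) - clip (real N) (g n x)\<bar> \<partial>lborel) < ennreal (d / 2)) sequentially"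
    by (rule order_tendstoD(2)) (use \<open>0 < d\<close> in simp)
  then obtain n where n: "(\<integral>\<^sup>+x\<in>cball 0 r. ennreal \<bar>clip (real N) (f x) - clip (real N) (g n x)\<bar> \<partial>lborel) < ennreal (d / 2)"
    by (auto simp: eventually_sequentially)
  let ?g = "\<lambda>x. clip (real N) (g n x)"
  have "(\<integral>\<^sup>+x\<in>cball 0 r. ennreal \<bar>f x - ?g x\<bar> \<partial>lborel)
      \<le> (\<integral>\<^sup>+x. ennreal \<bar>f x - clip (real N) (f x)\<bar> + ennreal \<bar>clip (real N) (f x) - ?g x\<bar> * indicator (cball 0 r) x \<partial>lborel)"
    by (intro nn_integral_mono)
      (auto simp: indicator_def ennreal_plus[symmetric] simp del: ennreal_plus intro!: ennreal_leI)
  also have "\<dots> = (\<integral>\<^sup>+x. ennreal \<bar>f x - clip (real N) (f x)\<bar> \<partial>lborel)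
      + (\<integral>\<^sup>+x\<in>cball 0 r. ennreal \<bar>clip (real N) (f x) - ?g x\<bar> \<partial>lborel)"
    by (intro nn_integral_add) auto
  also have "\<dots> < ennreal (d / 2) + ennreal (d / 2)"
    using N n by (rule add_strict_mono)
  also have "\<dots> = ennreal d"
    using \<open>0 < d\<close> by (simp add: ennreal_plus[symmetric] del: ennreal_plus)
  finally have "(\<integral>\<^sup>+x\<in>cball 0 r. ennreal \<bar>f x - ?g x\<bar> \<partial>lborel) < ennreal d" .
  moreover have "continuous_on UNIV ?g"
    by (rule continuous_on_compose2[OF clip_cont gc]) simp
  ultimately show ?thesis by blast
qed

lemma continuous_locally_integrable:
  fixes g :: "'a::euclidean_space \<Rightarrow> real"
  assumes "continuous_on UNIV g"
  shows "locally_integrable g"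
  unfolding locally_integrable_def
  using borel_integrable_compact[OF _ continuous_on_subset[OF assms]]
  by (simp add: set_integrable_def)

lemma locally_integrable_diff:
  fixes f g :: "'a::euclidean_space \<Rightarrow> 'b::euclidean_space"
  assumes "locally_integrable f" "locally_integrable g"
  shows "locally_integrable (\<lambda>x. f x - g x)"
  using assms by (auto simp: locally_integrable_def intro: set_integral_diff)

text \<open>Near the ball, f splits into a continuous g and a remainder h that is small in L^1.
  Uniform continuity handles g, and mollifying does not increase the L^1 norm of h. The larger ball
  of radius \<open>r + 1\<close> leaves room for the radius of the mollifier.\<close>

lemma mollify_L1_local:
  fixes f :: "'a::euclidean_space \<Rightarrow> real"
  assumes f: "locally_integrable f" and d: "0 < d"
  shows "\<exists>e0>0. \<forall>e \<rho>. e \<le> e0 \<longrightarrow> mollifier e \<rho> \<longrightarrow>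
    (\<integral>\<^sup>+x\<in>cball 0 r. ennreal \<bar>conv \<rho> f x - f x\<bar> \<partial>lborel) \<le> ennreal d"
proof -
  note [measurable] = locally_integrable_measurable[OF f]
  have [measurable]: "cball (0::'a) r \<in> sets borel" by simp
  define V where "V = measure lborel (cball (0::'a) r)"
  define f1 where "f1 x = indicator (cball 0 (r + 1)) x * f x" for x
  have f1: "integrable lborel f1"
    using f by (auto simp: locally_integrable_def set_integrable_def f1_def[abs_def])
  obtain g where gc: "continuous_on UNIV g"
    and g: "(\<integral>\<^sup>+x\<in>cball 0 (r + 1). ennreal \<bar>f1 x - g x\<bar> \<partial>lborel) < ennreal (d / 3)"
    using continuous_L1_approx[OF f1, of "d / 3" "r + 1"] d by auto
  note gl = continuous_locally_integrable[OF gc]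
  note [measurable] = locally_integrable_measurable[OF gl]
  define h where "h x = indicator (cball 0 (r + 1)) x * (f x - g x)" for x
  have hl: "locally_integrable h"
  proof -
    have "set_integrable lborel (cball 0 (r + 1)) (\<lambda>x. f x - g x)"
      using f gl by (auto simp: locally_integrable_def intro!: set_integral_diff)
    then have "integrable lborel h"
      by (simp add: set_integrable_def h_def[abs_def])
    then show ?thesis
      using integrable_mult_indicator[of _ lborel h]
      by (simp add: locally_integrable_def set_integrable_def borel_compact)
  qed
  have hN: "(\<integral>\<^sup>+x. ennreal \<bar>h x\<bar> \<partial>lborel) \<le> ennreal (d / 3)"
  proof -
    have "(\<integral>\<^sup>+x. ennreal \<bar>h x\<bar> \<partial>lborel) = (\<integral>\<^sup>+x\<in>cball 0 (r + 1). ennreal \<bar>f1 x - g x\<bar> \<partial>lborel)"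
      by (intro nn_integral_cong) (auto simp: h_def f1_def indicator_def)
    then show ?thesis using g by simp
  qed
  have "uniformly_continuous_on (cball 0 (r + 1)) g"
    by (intro compact_uniformly_continuous continuous_on_subset[OF gc]) auto
  \<comment> \<open>A constant error of this size integrates to at most d / 3 over a ball of volume
    V; the summand 1 keeps the denominator positive when V = 0.\<close>
  moreover have pos: "0 < d / (3 * (V + 1))"
    using d by (auto simp: V_def intro!: divide_pos_pos add_nonneg_pos)
  ultimately obtain e1 where e1: "e1 > 0"
    "\<And>x y. norm x \<le> r + 1 \<Longrightarrow> norm y \<le> r + 1 \<Longrightarrow> dist x y < e1 \<Longrightarrow> dist (g x) (g y) < d / (3 * (V + 1))"
    unfolding uniformly_continuous_on_def by (metis dist_commute mem_cball_0)
  show ?thesis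
  proof (intro exI[of _ "min 1 (e1 / 2)"] conjI allI impI)
    fix e and \<rho> :: "'a \<Rightarrow> real"
    assume e: "e \<le> min 1 (e1 / 2)" and m: "mollifier e \<rho>"
    note k = mollifierD(1)[OF m]
    note [measurable] = borel_measurable_continuous_onI[OF conv_continuous[OF k f]]
      borel_measurable_continuous_onI[OF conv_continuous[OF k gl]]
      borel_measurable_continuous_onI[OF conv_continuous[OF k hl]]
      kernel_measurable[OF k] locally_integrable_measurable[OF hl]
    have bd: "\<bar>conv \<rho> f x - f x\<bar> \<le> \<bar>conv \<rho> h x\<bar> + \<bar>h x\<bar> + d / (3 * (V + 1))" if x: "norm x \<le> r" for x
    proof -
      \<comment> \<open>Seen from the ball of radius r, a kernel of radius e \<le> 1 does not reach
        the cut-off that was built into h.\<close>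
      have "conv \<rho> h x = conv \<rho> (\<lambda>x. f x - g x) x"
        unfolding conv_def
      proof (rule Bochner_Integration.integral_cong[OF refl])
        fix y
        show "\<rho> (x - y) * h y = \<rho> (x - y) * (f y - g y)"
        proof (cases "norm y \<le> r + 1")
          case False
          then have "e < norm (x - y)"
            using norm_triangle_ineq2[of y x] e x by (auto simp: norm_minus_commute)
          then show ?thesis using k by (simp add: kernel_def)
        qed (simp add: h_def)
      qed
      also have "\<dots> = conv \<rho> f x - conv \<rho> g x"
        by (rule conv_diff[OF k f gl])
      finally have 1: "conv \<rho> f x = conv \<rho> h x + conv \<rho> g x" by simp
      have "\<bar>conv \<rho> g x - g x\<bar> \<le> d / (3 * (V + 1))"
      proof (rule mollify_near[OF m gl])
        fix y assume y: "dist x y \<le> e"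
        then have "norm y \<le> r + 1"
          using norm_triangle_ineq2[of y x] e x by (auto simp: dist_norm norm_minus_commute)
        then show "\<bar>g y - g x\<bar> \<le> d / (3 * (V + 1))"
          using e1(2)[of y x] x y e e1(1) by (auto simp: dist_commute dist_real_def)
      qed
      moreover have "h x = f x - g x"
        using x by (simp add: h_def)
      ultimately show ?thesis using 1 by linarith
    qed
    have "(\<integral>\<^sup>+x\<in>cball 0 r. ennreal \<bar>conv \<rho> f x - f x\<bar> \<partial>lborel)
        \<le> (\<integral>\<^sup>+x. ennreal \<bar>conv \<rho> h x\<bar> + ennreal \<bar>h x\<bar> + ennreal (d / (3 * (V + 1))) * indicator (cball 0 r) x \<partial>lborel)"
      using pos bd by (intro nn_integral_mono)
        (auto simp: indicator_def ennreal_plus[symmetric] simp del: ennreal_plus intro!: ennreal_leI)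
    also have "\<dots> = (\<integral>\<^sup>+x. ennreal \<bar>conv \<rho> h x\<bar> \<partial>lborel) + (\<integral>\<^sup>+x. ennreal \<bar>h x\<bar> \<partial>lborel)
        + ennreal (d / (3 * (V + 1))) * emeasure lborel (cball (0::'a) r)"
      by (subst nn_integral_add, measurable, subst nn_integral_add, measurable,
        subst nn_integral_cmult_indicator, simp, rule refl)
    also have "\<dots> \<le> ennreal (d / 3) + ennreal (d / 3) + ennreal (d / 3)"
    proof (intro add_mono hN)
      have "(\<integral>\<^sup>+x. ennreal \<bar>conv \<rho> h x\<bar> \<partial>lborel)
          \<le> (\<integral>\<^sup>+x. (\<integral>\<^sup>+y. ennreal (\<rho> (x - y)) * ennreal \<bar>h y\<bar> \<partial>lborel) \<partial>lborel)"
        by (intro nn_integral_mono conv_abs_nn_le[OF m hl])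
      also have "\<dots> \<le> ennreal (d / 3)"
        using hN by (simp add: nn_integral_mollify[OF m])
      finally show "(\<integral>\<^sup>+x. ennreal \<bar>conv \<rho> h x\<bar> \<partial>lborel) \<le> ennreal (d / 3)" .
      have eV: "emeasure lborel (cball (0::'a) r) = ennreal V"
        unfolding V_def by (rule emeasure_eq_ennreal_measure) (use emeasure_lborel_cball_finite[of "0::'a" r] in simp)
      show "ennreal (d / (3 * (V + 1))) * emeasure lborel (cball (0::'a) r) \<le> ennreal (d / 3)"
      proof -
        have V: "0 \<le> V" by (simp add: V_def)
        then have "d / (3 * (V + 1)) * V \<le> d / 3"
          using d by (simp add: field_simps)
        then show ?thesis
          using V d by (subst eV, subst ennreal_mult[symmetric]) (auto intro!: ennreal_leI)
      qed
    qed
    also have "\<dots> = ennreal d"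
      using d by (simp add: ennreal_plus[symmetric] del: ennreal_plus)
    finally show "(\<integral>\<^sup>+x\<in>cball 0 r. ennreal \<bar>conv \<rho> f x - f x\<bar> \<partial>lborel) \<le> ennreal d" .
  qed (use e1 in auto)
qed

text \<open>Local L^1 convergence only yields an almost everywhere convergent subsequence, and one
  that depends on the ball. The bound is therefore obtained on each ball first and on the whole
  space by monotone convergence. The integrals are \<open>ennreal\<close> valued, so that
  integrability of the limit against a growing weight is part of the conclusion.\<close>

lemma mollify_lower_semicontinuous:
  fixes f W :: "'a::euclidean_space \<Rightarrow> real"
  assumes f: "locally_integrable f" and [measurable]: "W \<in> borel_measurable borel"
    and "0 < e1"
    and le: "\<And>e \<rho>. e \<le> e1 \<Longrightarrow> mollifier e \<rho> \<Longrightarrow>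
      (\<integral>\<^sup>+x. ennreal (W x * (conv \<rho> f x)\<^sup>2) \<partial>lborel) \<le> B"
  shows "(\<integral>\<^sup>+x. ennreal (W x * (f x)\<^sup>2) \<partial>lborel) \<le> B"
proof -
  note [measurable] = locally_integrable_measurable[OF f]
  \<comment> \<open>The radii tend to zero and stay below e1, where the bound \<open>le\<close> is
    available.\<close>
  have "\<exists>\<rho>. mollifier (min e1 (inverse (real (Suc n)))) (\<rho> :: 'a \<Rightarrow> real)" for n
    using \<open>0 < e1\<close> by (intro mollifier_exists) simp
  then obtain \<rho> where \<rho>: "\<And>n. mollifier (min e1 (inverse (real (Suc n)))) (\<rho> n :: 'a \<Rightarrow> real)"
    by metis
  note k = mollifierD(1)[OF \<rho>]
  note [measurable] = borel_measurable_continuous_onI[OF conv_continuous[OF k f]]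
  have ball: "(\<integral>\<^sup>+x\<in>cball 0 r. ennreal (W x * (f x)\<^sup>2) \<partial>lborel) \<le> B" for r
  proof -
    have [measurable]: "cball (0::'a) r \<in> sets borel" by simp
    define u where "u n x = indicator (cball 0 r) x * (conv (\<rho> n) f x - f x)" for n x
    have [measurable]: "u n \<in> borel_measurable borel" for n
      unfolding u_def[abs_def] by measurable
    have ui: "integrable lborel (u n)" for n
    proof -
      have "locally_integrable (\<lambda>x. conv (\<rho> n) f x - f x)"
        by (intro locally_integrable_diff continuous_locally_integrable conv_continuous[OF k f] f)
      then show ?thesis
        by (auto simp: locally_integrable_def set_integrable_def u_def[abs_def])
    qed
    have "(\<lambda>n. \<integral>x. norm (u n x) \<partial>lborel) \<longlonglongrightarrow> 0"
    proof (rule LIMSEQ_I)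
      fix d :: real assume "0 < d"
      then obtain e0 where e0: "e0 > 0" "\<And>e \<rho>. e \<le> e0 \<Longrightarrow> mollifier e \<rho> \<Longrightarrow>
        (\<integral>\<^sup>+x\<in>cball 0 r. ennreal \<bar>conv \<rho> f x - f x\<bar> \<partial>lborel) \<le> ennreal (d / 2)"
        using mollify_L1_local[OF f, of "d / 2" r] by (metis half_gt_zero)
      obtain N where N: "inverse (real (Suc N)) < e0"
        using reals_Archimedean[OF e0(1)] by blast
      have "norm ((\<integral>x. norm (u n x) \<partial>lborel) - 0) < d" if "N \<le> n" for n
      proof -
        have "inverse (real (Suc n)) \<le> inverse (real (Suc N))"
          using that by (intro le_imp_inverse_le) auto
        then have "(\<integral>\<^sup>+x\<in>cball 0 r. ennreal \<bar>conv (\<rho> n) f x - f x\<bar> \<partial>lborel) \<le> ennreal (d / 2)"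
          using N by (intro e0(2)[OF _ \<rho>]) linarith
        also have "(\<integral>\<^sup>+x\<in>cball 0 r. ennreal \<bar>conv (\<rho> n) f x - f x\<bar> \<partial>lborel) = (\<integral>\<^sup>+x. ennreal (norm (u n x)) \<partial>lborel)"
          by (intro nn_integral_cong) (auto simp: u_def indicator_def)
        also have "\<dots> = ennreal (\<integral>x. norm (u n x) \<partial>lborel)"
          using ui by (intro nn_integral_eq_integral) auto
        finally show ?thesis
          using \<open>0 < d\<close> by (simp add: ennreal_le_iff)
      qed
      then show "\<exists>N. \<forall>n\<ge>N. norm ((\<integral>x. norm (u n x) \<partial>lborel) - 0) < d" by blast
    qed
    then obtain s where s: "strict_mono s" and lim: "AE x in lborel. (\<lambda>n. u (s n) x) \<longlonglongrightarrow> 0"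
      using tendsto_L1_AE_subseq[of lborel u, OF ui] by blast
    have "(\<integral>\<^sup>+x\<in>cball 0 r. ennreal (W x * (f x)\<^sup>2) \<partial>lborel)
        \<le> (\<integral>\<^sup>+x. liminf (\<lambda>n. ennreal (W x * (conv (\<rho> (s n)) f x)\<^sup>2)) \<partial>lborel)"
    proof (rule nn_integral_mono_AE, use lim in eventually_elim)
      case (elim x)
      show ?case
      proof (cases "x \<in> cball 0 r")
        case True
        then have "(\<lambda>n. conv (\<rho> (s n)) f x - f x) \<longlonglongrightarrow> 0"
          using elim by (simp add: u_def)
        then have "(\<lambda>n. conv (\<rho> (s n)) f x) \<longlonglongrightarrow> f x"
          by (rule LIM_zero_cancel)
        then have "(\<lambda>n. ennreal (W x * (conv (\<rho> (s n)) f x)\<^sup>2)) \<longlonglongrightarrow> ennreal (W x * (f x)\<^sup>2)"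
          by (intro tendsto_ennrealI tendsto_intros)
        from lim_imp_Liminf[OF _ this] True show ?thesis by simp
      qed simp
    qed
    also have "\<dots> \<le> liminf (\<lambda>n. \<integral>\<^sup>+x. ennreal (W x * (conv (\<rho> (s n)) f x)\<^sup>2) \<partial>lborel)"
      by (intro nn_integral_liminf) measurable
    also have "\<dots> \<le> limsup (\<lambda>n. \<integral>\<^sup>+x. ennreal (W x * (conv (\<rho> (s n)) f x)\<^sup>2) \<partial>lborel)"
      by (intro Liminf_le_Limsup) simp
    also have "\<dots> \<le> B"
      by (intro Limsup_bounded always_eventually allI le[OF _ \<rho>]) simp
    finally show ?thesis .
  qed
  have "(\<integral>\<^sup>+x. ennreal (W x * (f x)\<^sup>2) \<partial>lborel)
      \<le> (\<integral>\<^sup>+x. (SUP n. ennreal (W x * (f x)\<^sup>2) * indicator (cball 0 (real n)) x) \<partial>lborel)"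
  proof (rule nn_integral_mono)
    fix x :: 'a
    obtain n where "norm x \<le> real n" using real_arch_simple by blast
    then show "ennreal (W x * (f x)\<^sup>2) \<le> (SUP n. ennreal (W x * (f x)\<^sup>2) * indicator (cball 0 (real n)) x)"
      by (intro SUP_upper2[of n]) auto
  qed
  also have "\<dots> = (SUP n. \<integral>\<^sup>+x\<in>cball 0 (real n). ennreal (W x * (f x)\<^sup>2) \<partial>lborel)"
  proof (rule nn_integral_monotone_convergence_SUP)
    show "incseq (\<lambda>n x. ennreal (W x * (f x)\<^sup>2) * indicator (cball 0 (real n)) x)"
      by (auto simp: incseq_def le_fun_def indicator_def)
    have [measurable]: "cball (0::'a) r \<in> sets borel" for r by simp
    show "(\<lambda>x. ennreal (W x * (f x)\<^sup>2) * indicator (cball 0 (real n)) x) \<in> borel_measurable lborel" for n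
      by measurable
  qed
  also have "\<dots> \<le> B"
    by (intro SUP_least ball)
  finally show ?thesis .
qed

section \<open>Weak gradients and their mollification\<close>

lemma mollifier_test_function:
  assumes m: "mollifier e \<rho>"
  shows "(\<lambda>y. \<rho> (x - y)) \<in> test_functions UNIV"
proof (rule test_functionsI)
  show "C_k k (\<lambda>y. \<rho> (x - y))" for k
    using C_k_affine[OF bounded_linear_minus[OF bounded_linear_ident] mollifierD(2)[OF m], of k x] by simp
  show "\<rho> (x - y) = 0" if "y \<notin> cball x e" for y
    using that mollifierD(1)[OF m] by (auto simp: kernel_def dist_norm)
qed auto

text \<open>The fundamental lemma of the calculus of variations. Each value of a mollification is a
  test integral and hence zero, so \<open>mollify_lower_semicontinuous\<close> with W = 1 and B = 0
  bounds the integral of f^2 by zero.\<close>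

lemma AE_zero_if_test_integrals_zero:
  fixes f :: "'a::euclidean_space \<Rightarrow> real"
  assumes f: "locally_integrable f"
    and z: "\<And>\<phi>. \<phi> \<in> test_functions UNIV \<Longrightarrow> (\<integral>x. f x * \<phi> x \<partial>lborel) = 0"
  shows "AE x in lborel. f x = 0"
proof -
  note [measurable] = locally_integrable_measurable[OF f]
  have "(\<integral>\<^sup>+x. ennreal (1 * (f x)\<^sup>2) \<partial>lborel) \<le> 0"
  proof (rule mollify_lower_semicontinuous[OF f, where ?e1.0=1])
    fix e and \<rho> :: "'a \<Rightarrow> real" assume "mollifier e \<rho>"
    then have "conv \<rho> f x = 0" for x
      using z[OF mollifier_test_function] by (simp add: conv_def mult.commute)
    then show "(\<integral>\<^sup>+x. ennreal (1 * (conv \<rho> f x)\<^sup>2) \<partial>lborel) \<le> 0" by simp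
  qed auto
  then have "AE x in lborel. ennreal (1 * (f x)\<^sup>2) = 0"
    by (subst nn_integral_0_iff_AE[symmetric]) auto
  then show ?thesis
    by eventually_elim simp
qed

lemma kernel_mult_integrable:
  assumes "kernel r \<kappa>" "locally_integrable f"
  shows "integrable lborel (\<lambda>y. \<kappa> y * f y)"
proof -
  have "continuous_on UNIV (\<lambda>y. \<kappa> (- y))"
    using assms(1) by (auto simp: kernel_def intro!: continuous_on_compose2[of UNIV \<kappa>] continuous_intros)
  then have "kernel r (\<lambda>y. \<kappa> (- y))"
    using assms(1) by (auto simp: kernel_def)
  from conv_integrable[OF this assms(2), of 0] show ?thesis by simp
qed

lemma test_function_kernel:
  assumes "\<phi> \<in> test_functions UNIV"
  shows "\<exists>r. kernel r \<phi> \<and> (\<forall>v. kernel r (partial \<phi> v))"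
proof -
  have C: "C_k k \<phi>" for k
    using assms by (auto simp: test_functions_def)
  have c: "compact (closure {x. \<phi> x \<noteq> 0})"
    using assms by (auto simp: test_functions_def)
  obtain r where r: "\<And>x. x \<in> closure {x. \<phi> x \<noteq> 0} \<Longrightarrow> norm x \<le> r"
    using compact_imp_bounded[OF c] by (auto simp: bounded_iff)
  have z: "\<phi> x = 0" if "r < norm x" for x
    using r[of x] that closure_subset[of "{x. \<phi> x \<noteq> 0}"] by fastforce
  have "has_partial v \<phi> (partial \<phi> v)" for v
    by (rule has_derivative_imp_partial[OF C_k_has_derivative[OF C]])
  then have "frechet_derivative \<phi> (at x) v = 0" if "r < norm x" for x v
    using z that by (rule has_partial_zero_outside)
  then show ?thesis
    using z C_k_imp_continuous[OF C] C_k_imp_continuous[OF C_k_frechet[OF C]]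
    by (intro exI[of _ r]) (auto simp: kernel_def)
qed

lemma locally_integrable_component:
  fixes g :: "'a::euclidean_space \<Rightarrow> 'b::euclidean_space"
  assumes "locally_integrable g"
  shows "locally_integrable (\<lambda>x. g x \<bullet> b)"
  unfolding locally_integrable_def set_integrable_def
proof (intro allI impI)
  fix K :: "'a set" assume "compact K"
  then have "integrable lborel (\<lambda>x. indicator K x *\<^sub>R g x)"
    using assms by (auto simp: locally_integrable_def set_integrable_def)
  from integrable_inner_left[OF this, of b]
  show "integrable lborel (\<lambda>x. indicator K x *\<^sub>R (g x \<bullet> b))" by simp
qed

lemma has_weak_gradient_diff:
  assumes "has_weak_gradient f g" "has_weak_gradient f' g'"
  shows "has_weak_gradient (\<lambda>x. f x - f' x) (\<lambda>x. g x - g' x)"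
  unfolding has_weak_gradient_def
proof (intro conjI ballI locally_integrable_diff)
  show l: "locally_integrable f" "locally_integrable f'" "locally_integrable g" "locally_integrable g'"
    using assms by (auto simp: has_weak_gradient_def)
  fix \<phi> :: "'a \<Rightarrow> real" and b :: 'a
  assume \<phi>: "\<phi> \<in> test_functions UNIV" and b: "b \<in> Basis"
  let ?D = "\<lambda>x. frechet_derivative \<phi> (at x) b"
  obtain r where k: "kernel r \<phi>" "kernel r ?D"
    using test_function_kernel[OF \<phi>] by blast
  have i: "integrable lborel (\<lambda>x. f x * ?D x)" "integrable lborel (\<lambda>x. f' x * ?D x)"
    "integrable lborel (\<lambda>x. (g x \<bullet> b) * \<phi> x)" "integrable lborel (\<lambda>x. (g' x \<bullet> b) * \<phi> x)"
    using kernel_mult_integrable[OF k(2) l(1)] kernel_mult_integrable[OF k(2) l(2)]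
      kernel_mult_integrable[OF k(1) locally_integrable_component[OF l(3)]]
      kernel_mult_integrable[OF k(1) locally_integrable_component[OF l(4)]]
    by (simp_all add: mult.commute)
  have "(\<integral>x. (f x - f' x) * ?D x \<partial>lborel) = (\<integral>x. f x * ?D x \<partial>lborel) - (\<integral>x. f' x * ?D x \<partial>lborel)"
    using i by (simp add: left_diff_distrib)
  also have "\<dots> = - (\<integral>x. (g x \<bullet> b) * \<phi> x \<partial>lborel) - - (\<integral>x. (g' x \<bullet> b) * \<phi> x \<partial>lborel)"
    using assms \<phi> b by (simp add: has_weak_gradient_def)
  also have "\<dots> = - (\<integral>x. ((g x - g' x) \<bullet> b) * \<phi> x \<partial>lborel)"
    using i by (simp add: left_diff_distrib inner_diff_left)
  finally show "(\<integral>x. (f x - f' x) * ?D x \<partial>lborel) = - (\<integral>x. ((g x - g' x) \<bullet> b) * \<phi> x \<partial>lborel)" .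
qed

lemma has_weak_gradient_unique:
  assumes "has_weak_gradient f g" "has_weak_gradient f g'"
  shows "AE x in lborel. g x = g' x"
proof -
  have "\<forall>b\<in>Basis. AE x in lborel. (g x - g' x) \<bullet> b = 0"
  proof
    fix b :: 'a assume b: "b \<in> Basis"
    have d: "has_weak_gradient (\<lambda>x. f x - f x) (\<lambda>x. g x - g' x)"
      by (rule has_weak_gradient_diff[OF assms])
    show "AE x in lborel. (g x - g' x) \<bullet> b = 0"
    proof (rule AE_zero_if_test_integrals_zero)
      show "locally_integrable (\<lambda>x. (g x - g' x) \<bullet> b)"
        using d by (intro locally_integrable_component) (simp add: has_weak_gradient_def)
      show "(\<integral>x. ((g x - g' x) \<bullet> b) * \<phi> x \<partial>lborel) = 0" if "\<phi> \<in> test_functions UNIV" for \<phi>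
        using d that b unfolding has_weak_gradient_def by fastforce
    qed
  qed
  then have "AE x in lborel. \<forall>b\<in>Basis. (g x - g' x) \<bullet> b = 0"
    by (intro AE_ball_countable'[OF _ countable_finite]) auto
  then show ?thesis
    by eventually_elim (auto simp: inner_diff_left intro: euclidean_eqI)
qed

text \<open>Membership in \<open>H1_space\<close> promises some square integrable gradient, not that
  the chosen representative is one; almost everywhere uniqueness transfers the integrability to
  it.\<close>

lemma H1_weak_gradient:
  assumes "f \<in> H1_space"
  shows "has_weak_gradient f (weak_gradient f)" "weak_gradient f \<in> L2_space"
proof -
  obtain g where g: "g \<in> L2_space" "has_weak_gradient f g"
    using assms by (auto simp: H1_space_def)
  show w: "has_weak_gradient f (weak_gradient f)"
    unfolding weak_gradient_def by (rule someI[of "has_weak_gradient f"]) (rule g(2))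
  have [measurable]: "weak_gradient f \<in> borel_measurable borel"
    using w by (auto simp: has_weak_gradient_def intro: locally_integrable_measurable)
  have "AE x in lborel. (norm (g x))\<^sup>2 = (norm (weak_gradient f x))\<^sup>2"
    using has_weak_gradient_unique[OF g(2) w] by eventually_elim simp
  moreover have "integrable lborel (\<lambda>x. (norm (g x))\<^sup>2)"
    using g(1) by (simp add: L2_space_def)
  ultimately show "weak_gradient f \<in> L2_space"
    using g(1) by (auto simp: L2_space_def elim: integrable_cong_AE_imp)
qed

lemma weak_gradient_diff:
  assumes "f \<in> H1_space" "f' \<in> H1_space"
  shows "has_weak_gradient (\<lambda>x. f x - f' x) (weak_gradient (\<lambda>x. f x - f' x))"
    "AE x in lborel. weak_gradient (\<lambda>x. f x - f' x) x = weak_gradient f x - weak_gradient f' x"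
proof -
  have d: "has_weak_gradient (\<lambda>x. f x - f' x) (\<lambda>x. weak_gradient f x - weak_gradient f' x)"
    by (intro has_weak_gradient_diff H1_weak_gradient assms)
  then show w: "has_weak_gradient (\<lambda>x. f x - f' x) (weak_gradient (\<lambda>x. f x - f' x))"
    unfolding weak_gradient_def[of "\<lambda>x. f x - f' x"] by (rule someI[of "has_weak_gradient _"])
  show "AE x in lborel. weak_gradient (\<lambda>x. f x - f' x) x = weak_gradient f x - weak_gradient f' x"
    using w d by (rule has_weak_gradient_unique)
qed

lemma L2_norm_cong_AE:
  assumes [measurable]: "f \<in> borel_measurable borel" "g \<in> borel_measurable borel"
    and "AE x in lborel. f x = g x"
  shows "L2_norm f = L2_norm g"
proof -
  have "(\<integral>x. (norm (f x))\<^sup>2 \<partial>lborel) = (\<integral>x. (norm (g x))\<^sup>2 \<partial>lborel)"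
    using assms(3) by (intro integral_cong_AE) auto
  then show ?thesis by (simp add: L2_norm_def)
qed

text \<open>Testing the weak gradient with y -> \<rho>(x - y): the sign from the reflection cancels
  the sign from the integration by parts.\<close>

lemma conv_partial_eq_conv_weak_gradient:
  assumes m: "mollifier e \<rho>" and f: "has_weak_gradient f g" and b: "b \<in> Basis"
  shows "conv (partial \<rho> b) f x = conv \<rho> (\<lambda>y. g y \<bullet> b) x"
proof -
  have "((\<lambda>y. \<rho> (x - y)) has_derivative (\<lambda>v. frechet_derivative \<rho> (at (x - y)) (- v))) (at y)" for y
    by (rule has_derivative_compose[OF _ C_k_has_derivative[OF mollifierD(2)[OF m]]])
      (auto intro!: derivative_eq_intros)
  then have D: "frechet_derivative (\<lambda>y. \<rho> (x - y)) (at y) = (\<lambda>v. frechet_derivative \<rho> (at (x - y)) (- v))" for y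
    by (rule frechet_derivative_at[symmetric])
  have lin: "frechet_derivative \<rho> (at z) (- b) = - frechet_derivative \<rho> (at z) b" for z
    by (intro linear_neg has_derivative_linear[OF C_k_has_derivative[OF mollifierD(2)[OF m]]])
  have "(\<integral>y. f y * frechet_derivative (\<lambda>y. \<rho> (x - y)) (at y) b \<partial>lborel) = - (\<integral>y. (g y \<bullet> b) * \<rho> (x - y) \<partial>lborel)"
    using f mollifier_test_function[OF m] b by (auto simp: has_weak_gradient_def)
  then show ?thesis
    by (simp add: D lin conv_def mult.commute)
qed

text \<open>The variance of f under the probability density y -> \<rho>(x - y) is nonnegative, so
  the square of the mean is at most the mean of the square; \<open>nn_integral_mollify\<close>
  integrates this in x.\<close>

lemma conv_mollifier_L2:
  assumes m: "mollifier e \<rho>" and f: "f \<in> L2_space"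
  shows "conv \<rho> f \<in> L2_space" "L2_norm (conv \<rho> f) \<le> L2_norm f"
proof -
  note k = mollifierD(1)[OF m] and fl = L2_locally_integrable[OF f]
  note [measurable] = kernel_measurable[OF k] L2_space_measurable[OF f]
    borel_measurable_continuous_onI[OF conv_continuous[OF k fl]]
  have f2: "integrable lborel (\<lambda>x. (f x)\<^sup>2)"
    using f by (simp add: L2_real_iff)
  have f2l: "locally_integrable (\<lambda>x. (f x)\<^sup>2)"
    using integrable_mult_indicator[OF _ f2] by (simp add: locally_integrable_def set_integrable_def borel_compact)
  note i = mollifierD(5)[OF m]
  have pt: "(conv \<rho> f x)\<^sup>2 \<le> (\<integral>y. \<rho> (x - y) * (f y)\<^sup>2 \<partial>lborel)" for x
  proof -
    define c where "c = conv \<rho> f x"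
    have eq: "\<rho> (x - y) * (f y - c)\<^sup>2 = \<rho> (x - y) * (f y)\<^sup>2 - (2 * c) * (\<rho> (x - y) * f y) + c\<^sup>2 * \<rho> (x - y)" for y
      by (simp add: power2_eq_square algebra_simps)
    have "0 \<le> (\<integral>y. \<rho> (x - y) * (f y - c)\<^sup>2 \<partial>lborel)"
      using mollifierD(3)[OF m] by (intro integral_nonneg_AE) auto
    also have "\<dots> = (\<integral>y. \<rho> (x - y) * (f y)\<^sup>2 \<partial>lborel) - 2 * c * c + c\<^sup>2 * 1"
      using conv_integrable[OF k fl, of x] conv_integrable[OF k f2l, of x] i mollifierD(4)[OF m]
      by (simp add: eq lborel_integrable_reflect lborel_integral_reflect c_def[unfolded conv_def, symmetric])
    finally show ?thesis by (simp add: c_def power2_eq_square)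
  qed
  have "(\<integral>\<^sup>+x. ennreal ((conv \<rho> f x)\<^sup>2) \<partial>lborel)
      \<le> (\<integral>\<^sup>+x. (\<integral>\<^sup>+y. ennreal (\<rho> (x - y)) * ennreal ((f y)\<^sup>2) \<partial>lborel) \<partial>lborel)"
  proof (rule nn_integral_mono)
    fix x
    have "ennreal ((conv \<rho> f x)\<^sup>2) \<le> ennreal (\<integral>y. \<rho> (x - y) * (f y)\<^sup>2 \<partial>lborel)"
      by (intro ennreal_leI pt)
    also have "\<dots> = (\<integral>\<^sup>+y. ennreal (\<rho> (x - y) * (f y)\<^sup>2) \<partial>lborel)"
      using mollifierD(3)[OF m] conv_integrable[OF k f2l, of x]
      by (intro nn_integral_eq_integral[symmetric]) auto
    finally show "ennreal ((conv \<rho> f x)\<^sup>2) \<le> (\<integral>\<^sup>+y. ennreal (\<rho> (x - y)) * ennreal ((f y)\<^sup>2) \<partial>lborel)"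
      using mollifierD(3)[OF m] by (simp add: ennreal_mult)
  qed
  also have "\<dots> = (\<integral>\<^sup>+x. ennreal ((f x)\<^sup>2) \<partial>lborel)"
    by (intro nn_integral_mollify[OF m]) auto
  also have "\<dots> = ennreal ((L2_norm f)\<^sup>2)"
    using f2 by (simp add: nn_integral_eq_integral L2_norm_power2)
  finally have le: "(\<integral>\<^sup>+x. ennreal ((conv \<rho> f x)\<^sup>2) \<partial>lborel) \<le> ennreal ((L2_norm f)\<^sup>2)" .
  then have ic: "integrable lborel (\<lambda>x. (conv \<rho> f x)\<^sup>2)"
    by (intro integrableI_bounded) (auto intro: le_less_trans)
  then show "conv \<rho> f \<in> L2_space"
    by (simp add: L2_real_iff)
  have "(L2_norm (conv \<rho> f))\<^sup>2 \<le> (L2_norm f)\<^sup>2"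
    using le ic by (simp add: nn_integral_eq_integral L2_norm_power2)
  then show "L2_norm (conv \<rho> f) \<le> L2_norm f"
    by (rule power2_le_imp_le) simp
qed

section \<open>Mollified energy solutions\<close>

definition L2_continuous :: "(real \<Rightarrow> 'a::euclidean_space \<Rightarrow> real) \<Rightarrow> bool" where
  "L2_continuous f \<longleftrightarrow> (\<forall>t\<ge>0. f t \<in> L2_space \<and>
     ((\<lambda>s. L2_norm (\<lambda>x. f s x - f t x)) \<longlongrightarrow> 0) (at t within {0..}))"

lemma L2_continuous_norm_bounded:
  assumes "L2_continuous f"
  obtains B where "0 \<le> B" "\<And>t. 0 \<le> t \<Longrightarrow> t \<le> T \<Longrightarrow> L2_norm (f t) \<le> B"
proof -
  have "continuous_on {0..} (\<lambda>t. L2_norm (f t))"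
    unfolding continuous_on_def
  proof
    fix t :: real assume t: "t \<in> {0..}"
    have "((\<lambda>s. L2_norm (f s) - L2_norm (f t)) \<longlongrightarrow> 0) (at t within {0..})"
    proof (rule Lim_null_comparison)
      show "((\<lambda>s. L2_norm (\<lambda>x. f s x - f t x)) \<longlongrightarrow> 0) (at t within {0..})"
        using assms t by (simp add: L2_continuous_def)
      show "\<forall>\<^sub>F s in at t within {0..}. norm (L2_norm (f s) - L2_norm (f t)) \<le> L2_norm (\<lambda>x. f s x - f t x)"
        using assms t by (auto simp: eventually_at_filter L2_continuous_def intro!: always_eventually L2_norm_triangle_reverse)
    qed
    then show "((\<lambda>t. L2_norm (f t)) \<longlongrightarrow> L2_norm (f t)) (at t within {0..})"
      by (rule LIM_zero_cancel)
  qed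
  then have "compact ((\<lambda>t. L2_norm (f t)) ` {0..T})"
    by (intro compact_continuous_image) (auto intro: continuous_on_subset)
  then obtain B where "\<And>t. t \<in> {0..T} \<Longrightarrow> norm (L2_norm (f t)) \<le> B"
    by (fastforce simp: bounded_iff dest!: compact_imp_bounded)
  then have "L2_norm (f t) \<le> max 0 B" if "0 \<le> t" "t \<le> T" for t
    using that by (auto simp: le_max_iff_disj)
  then show ?thesis
    by (intro that[of "max 0 B"]) auto
qed

lemma L2_continuous_conv:
  assumes f: "L2_continuous f" and k: "kernel r \<kappa>"
  shows "continuous_on {0..} (\<lambda>t. conv \<kappa> (f t) x)"
  unfolding continuous_on_def
proof
  fix t :: real assume t: "t \<in> {0..}"
  have "((\<lambda>s. conv \<kappa> (f s) x - conv \<kappa> (f t) x) \<longlongrightarrow> 0) (at t within {0..})"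
  proof (rule Lim_null_comparison)
    have "((\<lambda>s. L2_norm (\<lambda>x. f s x - f t x)) \<longlongrightarrow> 0) (at t within {0..})"
      using f t by (simp add: L2_continuous_def)
    then show "((\<lambda>s. L2_norm \<kappa> * L2_norm (\<lambda>x. f s x - f t x)) \<longlongrightarrow> 0) (at t within {0..})"
      by (rule tendsto_mult_right_zero)
    have "\<bar>conv \<kappa> (f s) x - conv \<kappa> (f t) x\<bar> \<le> L2_norm \<kappa> * L2_norm (\<lambda>x. f s x - f t x)" if "0 \<le> s" for s
    proof -
      have "f s \<in> L2_space" "f t \<in> L2_space"
        using f t that by (auto simp: L2_continuous_def)
      then show ?thesis
        using abs_conv_le[OF k L2_diff, of "f s" "f t" x]
        by (simp add: conv_diff[OF k] L2_locally_integrable)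
    qed
    then show "\<forall>\<^sub>F s in at t within {0..}. norm (conv \<kappa> (f s) x - conv \<kappa> (f t) x) \<le> L2_norm \<kappa> * L2_norm (\<lambda>x. f s x - f t x)"
      by (auto simp: eventually_at_filter intro!: always_eventually)
  qed
  then show "((\<lambda>t. conv \<kappa> (f t) x) \<longlongrightarrow> conv \<kappa> (f t) x) (at t within {0..})"
    by (rule LIM_zero_cancel)
qed

lemma L2_norm_le_H1_norm: "L2_norm f \<le> H1_norm f" "L2_norm (weak_gradient f) \<le> H1_norm f"
  by (auto simp: H1_norm_def intro!: real_le_rsqrt)

text \<open>The H^1 norm of u(s) - u(t) refers to the gradient representative chosen for the
  difference. It agrees with the difference of the chosen gradients almost everywhere only, which is
  enough for the L^2 norm.\<close>

lemma energy_class_L2_continuous: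
  assumes "energy_class u v"
  shows "L2_continuous u" "L2_continuous v"
    "b \<in> Basis \<Longrightarrow> L2_continuous (\<lambda>t x. weak_gradient (u t) x \<bullet> b)"
proof -
  have H: "u t \<in> H1_space" "v t \<in> L2_space" "u t \<in> L2_space"
    and lim: "((\<lambda>s. H1_norm (\<lambda>x. u s x - u t x)) \<longlongrightarrow> 0) (at t within {0..})"
      "((\<lambda>s. L2_norm (\<lambda>x. v s x - v t x)) \<longlongrightarrow> 0) (at t within {0..})" if "0 \<le> t" for t
    using assms that by (auto simp: energy_class_def H1_space_def)
  show "L2_continuous u"
    unfolding L2_continuous_def
    by (auto simp: H L2_norm_le_H1_norm intro!: Lim_null_comparison[OF _ lim(1)] always_eventually)
  show "L2_continuous v"
    using H lim by (auto simp: L2_continuous_def)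
  assume b: "b \<in> Basis"
  show "L2_continuous (\<lambda>t x. weak_gradient (u t) x \<bullet> b)"
    unfolding L2_continuous_def
  proof (intro allI impI conjI)
    fix t :: real assume t: "0 \<le> t"
    show "(\<lambda>x. weak_gradient (u t) x \<bullet> b) \<in> L2_space"
      by (intro L2_space_component H1_weak_gradient H t b)
    have le: "L2_norm (\<lambda>x. weak_gradient (u s) x \<bullet> b - weak_gradient (u t) x \<bullet> b) \<le> H1_norm (\<lambda>x. u s x - u t x)"
      if s: "0 \<le> s" for s
    proof -
      note w = H1_weak_gradient[OF H(1)[OF s]] H1_weak_gradient[OF H(1)[OF t]]
      note dw = weak_gradient_diff[OF H(1)[OF s] H(1)[OF t]]
      have [measurable]: "weak_gradient (u s) \<in> borel_measurable borel" "weak_gradient (u t) \<in> borel_measurable borel"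
        "weak_gradient (\<lambda>x. u s x - u t x) \<in> borel_measurable borel"
        using w dw(1) by (auto simp: has_weak_gradient_def intro: locally_integrable_measurable)
      let ?G = "\<lambda>x. weak_gradient (u s) x - weak_gradient (u t) x"
      have G: "?G \<in> L2_space"
        by (rule L2_diff[OF w(2,4)])
      have "L2_norm (\<lambda>x. ?G x \<bullet> b) \<le> L2_norm ?G"
        by (rule L2_space_component(2)[OF G b])
      also have "\<dots> = L2_norm (weak_gradient (\<lambda>x. u s x - u t x))"
        using dw(2) by (intro L2_norm_cong_AE) auto
      also have "\<dots> \<le> H1_norm (\<lambda>x. u s x - u t x)"
        by (rule L2_norm_le_H1_norm)
      finally show ?thesis by (simp add: inner_diff_left)
    qed
    show "((\<lambda>s. L2_norm (\<lambda>x. weak_gradient (u s) x \<bullet> b - weak_gradient (u t) x \<bullet> b)) \<longlongrightarrow> 0) (at t within {0..})"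
      by (rule Lim_null_comparison[OF _ lim(1)[OF t]])
        (auto simp: eventually_at_filter le intro!: always_eventually)
  qed
qed

lemma energy_class_conv_derivative:
  assumes E: "energy_class u v" and k: "kernel r \<kappa>" and t: "0 \<le> t"
  shows "((\<lambda>t. conv \<kappa> (u t) x) has_real_derivative conv \<kappa> (v t) x) (at t within {0..})"
  unfolding has_field_derivative_iff
proof -
  have H: "v t \<in> L2_space" "u t \<in> L2_space" if "0 \<le> t" for t
    using E that by (auto simp: energy_class_def H1_space_def)
  have "((\<lambda>s. (conv \<kappa> (u s) x - conv \<kappa> (u t) x) / (s - t) - conv \<kappa> (v t) x) \<longlongrightarrow> 0) (at t within {0..})"
  proof (rule Lim_null_comparison)
    have "((\<lambda>s. L2_norm (\<lambda>x. (u s x - u t x) / (s - t) - v t x)) \<longlongrightarrow> 0) (at t within {0..})"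
      using E t by (simp add: energy_class_def)
    then show "((\<lambda>s. L2_norm \<kappa> * L2_norm (\<lambda>x. (u s x - u t x) / (s - t) - v t x)) \<longlongrightarrow> 0) (at t within {0..})"
      by (rule tendsto_mult_right_zero)
    have "\<bar>(conv \<kappa> (u s) x - conv \<kappa> (u t) x) / (s - t) - conv \<kappa> (v t) x\<bar>
        \<le> L2_norm \<kappa> * L2_norm (\<lambda>x. (u s x - u t x) / (s - t) - v t x)" if s: "0 \<le> s" for s
    proof -
      have q: "(\<lambda>x. (u s x - u t x) / (s - t)) \<in> L2_space"
        using L2_cmult[OF L2_diff[OF H(2)[OF s] H(2)[OF t]], of "1 / (s - t)"] by simp
      have "conv \<kappa> (\<lambda>x. (u s x - u t x) / (s - t)) x = (conv \<kappa> (u s) x - conv \<kappa> (u t) x) / (s - t)"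
        using conv_cmult[of \<kappa> "1 / (s - t)" "\<lambda>x. u s x - u t x" x]
          conv_diff[OF k H(2)[OF s, THEN L2_locally_integrable] H(2)[OF t, THEN L2_locally_integrable]] by simp
      then show ?thesis
        using abs_conv_le[OF k L2_diff[OF q H(1)[OF t]], of x]
          conv_diff[OF k L2_locally_integrable[OF q] L2_locally_integrable[OF H(1)[OF t]], of x]
        by simp
    qed
    then show "\<forall>\<^sub>F s in at t within {0..}. norm ((conv \<kappa> (u s) x - conv \<kappa> (u t) x) / (s - t) - conv \<kappa> (v t) x)
        \<le> L2_norm \<kappa> * L2_norm (\<lambda>x. (u s x - u t x) / (s - t) - v t x)"
      by (auto simp: eventually_at_filter intro!: always_eventually)
  qed
  then show "((\<lambda>s. (conv \<kappa> (u s) x - conv \<kappa> (u t) x) / (s - t)) \<longlongrightarrow> conv \<kappa> (v t) x) (at t within {0..})"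
    by (rule LIM_zero_cancel)
qed

lemma mollifier_partial:
  assumes m: "mollifier e \<rho>"
  shows "has_partial v \<rho> (partial \<rho> v)"
    "kernel e (partial \<rho> v)"
proof -
  show p: "has_partial v \<rho> (partial \<rho> v)"
    by (rule has_derivative_imp_partial[OF C_k_has_derivative[OF mollifierD(2)[OF m]]])
  have "\<rho> x = 0" if "e < norm x" for x
    using mollifierD(1)[OF m] that by (simp add: kernel_def)
  then show "kernel e (partial \<rho> v)"
    using has_partial_zero_outside[OF p, of e] C_k_imp_continuous[OF C_k_frechet[OF mollifierD(2)[OF m]]]
    by (auto simp: kernel_def)
qed

section \<open>From the weak equation to an ordinary differential equation in time\<close>

lemma has_partial_1_iff: "has_partial 1 f g \<longleftrightarrow> (\<forall>t::real. (f has_real_derivative g t) (at t))"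
proof
  assume "has_partial 1 f g"
  from has_partial_at[OF this, of 0] show "\<forall>t::real. (f has_real_derivative g t) (at t)" by simp
next
  assume *: "\<forall>t::real. (f has_real_derivative g t) (at t)"
  show "has_partial 1 f g"
    unfolding has_partial_def
  proof
    fix x :: real
    show "((\<lambda>s. f (x + s *\<^sub>R 1)) has_real_derivative g x) (at 0)"
      using *[rule_format, of x] DERIV_shift[of f "g x" 0 x] by (simp add: add.commute)
  qed
qed

text \<open>Subtracting an antiderivative Q of h leaves a continuous G with vanishing weak
  derivative. Its mollifications are constant at distance more than their radius from 0, and
  shrinking the radius makes G itself constant.\<close>

lemma du_Bois_Reymond:
  fixes g h :: "real \<Rightarrow> real"
  assumes g: "continuous_on {0..} g" and h: "continuous_on {0..} h"
    and w: "\<And>\<eta>. \<eta> \<in> test_functions {0<..} \<Longrightarrow>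
      (LINT s:{0<..}|lborel. frechet_derivative \<eta> (at s) 1 * g s + \<eta> s * h s) = 0"
    and t: "0 \<le> t"
  shows "(g has_real_derivative h t) (at t within {0..})"
proof -
  \<comment> \<open>Freezing the values at negative times gives continuous functions on the whole
    line, where mollification is available; test functions supported in (0, \<infinity>) do not see
    the extension.\<close>
  define g' h' where "g' s = g (max 0 s)" and "h' s = h (max 0 s)" for s
  have gc: "continuous_on UNIV g'" and hc: "continuous_on UNIV h'"
    unfolding g'_def[abs_def] h'_def[abs_def]
    by (intro continuous_on_compose2[OF g] continuous_on_compose2[OF h] continuous_intros; auto)+
  obtain Q where Q: "\<And>s. (Q has_real_derivative h' s) (at s)"
    using einterval_antiderivative[of "-\<infinity>" "\<infinity>" h'] hc
    by (auto simp: continuous_on_eq_continuous_at has_real_derivative_iff_has_vector_derivative)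
  have Qc: "continuous_on UNIV Q"
    by (rule DERIV_continuous_on[where D=h']) (use Q in simp)
  define G where "G s = g' s - Q s" for s
  have Gc: "continuous_on UNIV G"
    unfolding G_def[abs_def] by (intro continuous_on_diff gc Qc)
  note lg = continuous_locally_integrable[OF gc] and lh = continuous_locally_integrable[OF hc]
    and lQ = continuous_locally_integrable[OF Qc] and lG = continuous_locally_integrable[OF Gc]
  have const: "conv \<sigma> G t1 = conv \<sigma> G t2"
    if m: "mollifier e \<sigma>" and e: "e < t1" "e < t2" for e \<sigma> t1 t2
  proof -
    define \<sigma>' where "\<sigma>' z = frechet_derivative \<sigma> (at z) 1" for z
    note p = mollifier_partial[OF m, of 1, folded \<sigma>'_def]
    note k = mollifierD(1)[OF m]
    have zero: "\<sigma> z = 0" "\<sigma>' z = 0" if "e < \<bar>z\<bar>" for z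
      using k p(2) that by (auto simp: kernel_def)
    have d\<sigma>: "(\<sigma> has_real_derivative \<sigma>' z) (at z)" for z
      using p(1) by (simp add: has_partial_1_iff)
    have d\<sigma>t: "((\<lambda>s. \<sigma> (s0 - s)) has_real_derivative - \<sigma>' (s0 - s)) (at s)" for s s0
    proof -
      have "((\<lambda>s. s0 - s) has_real_derivative - 1) (at s)"
        by (auto intro!: derivative_eq_intros)
      from DERIV_chain2[OF d\<sigma> this] show ?thesis by simp
    qed
    \<comment> \<open>For e < s0 the reflected mollifier around s0 is supported in (0, \<infinity>)
      and is admissible in the weak identity.\<close>
    have "conv \<sigma>' G s0 = 0" if s0: "e < s0" for s0
    proof -
      define \<eta> where "\<eta> s = \<sigma> (s0 - s)" for s
      have D: "frechet_derivative \<eta> (at s) 1 = - \<sigma>' (s0 - s)" for s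
        using frechet_derivative_at[OF d\<sigma>t[of s0 s, unfolded has_field_derivative_def]]
        by (simp add: \<eta>_def[abs_def]) (metis mult.right_neutral)
      have "\<eta> \<in> test_functions {0<..}"
      proof (rule test_functionsI[where S="cball s0 e"])
        show "C_k k \<eta>" for k
          using mollifier_test_function[OF m, of s0] by (simp add: test_functions_def \<eta>_def[abs_def])
        show "cball s0 e \<subseteq> {0<..}"
          using s0 by (auto simp: dist_real_def)
        show "\<eta> s = 0" if "s \<notin> cball s0 e" for s
          unfolding \<eta>_def by (rule zero) (use that in \<open>auto simp: dist_real_def\<close>)
      qed simp
      then have "0 = (LINT s:{0<..}|lborel. frechet_derivative \<eta> (at s) 1 * g s + \<eta> s * h s)"
        by (rule w[symmetric])
      also have "\<dots> = (\<integral>s. \<sigma> (s0 - s) * h' s - \<sigma>' (s0 - s) * g' s \<partial>lborel)"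
        unfolding set_lebesgue_integral_def
      proof (rule Bochner_Integration.integral_cong[OF refl])
        fix s :: real
        show "indicator {0<..} s *\<^sub>R (frechet_derivative \<eta> (at s) 1 * g s + \<eta> s * h s) = \<sigma> (s0 - s) * h' s - \<sigma>' (s0 - s) * g' s"
        proof (cases "0 < s")
          case False
          then have "e < \<bar>s0 - s\<bar>" using s0 by simp
          with False show ?thesis by (simp add: zero)
        qed (simp add: D \<eta>_def g'_def h'_def)
      qed
      also have "\<dots> = conv \<sigma> h' s0 - conv \<sigma>' g' s0"
        using conv_integrable[OF k lh] conv_integrable[OF p(2) lg] by (simp add: conv_def)
      finally have 1: "conv \<sigma> h' s0 = conv \<sigma>' g' s0" by simp
      \<comment> \<open>Integration by parts with compact support: Q satisfies the same weak
        identity as g.\<close>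
      have "(\<integral>s. - \<sigma>' (s0 - s) * Q s + \<sigma> (s0 - s) * h' s \<partial>lborel) = 0"
      proof -
        let ?f = "\<lambda>s. \<sigma> (s0 - s) * Q s" and ?f' = "\<lambda>s. - \<sigma>' (s0 - s) * Q s + \<sigma> (s0 - s) * h' s"
        have hp: "has_partial 1 ?f ?f'"
          unfolding has_partial_1_iff
          using d\<sigma>t Q by (auto intro!: derivative_eq_intros)
        have c: "continuous_on UNIV \<sigma>" "continuous_on UNIV \<sigma>'"
          using k p(2) by (auto simp: kernel_def)
        have kf: "kernel (e + \<bar>s0\<bar>) ?f" "kernel (e + \<bar>s0\<bar>) ?f'"
          unfolding kernel_def
          by (auto intro!: continuous_intros continuous_on_compose2[OF c(1)] continuous_on_compose2[OF c(2)] Qc hc simp: zero)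
        obtain M1 M2 where "\<And>s. \<bar>?f s\<bar> \<le> M1" "\<And>s. \<bar>?f' s\<bar> \<le> M2"
          using kernel_bounded[OF kf(1)] kernel_bounded[OF kf(2)] by metis
        then have "\<bar>?f s\<bar> \<le> max M1 M2" "\<bar>?f' s\<bar> \<le> max M1 M2" for s
          by (meson max.cobounded1 max.cobounded2 order_trans)+
        then show ?thesis
          using kf(1) by (intro integral_has_partial_eq_0[OF hp kernel_measurable[OF kf(1)]])
            (auto simp: kernel_def)
      qed
      then have 2: "conv \<sigma> h' s0 = conv \<sigma>' Q s0"
        using conv_integrable[OF k lh] conv_integrable[OF p(2) lQ] by (simp add: conv_def)
      show ?thesis
        using 1 2 conv_diff[OF p(2) lg lQ] by (simp add: G_def[abs_def])
    qed
    moreover have "(conv \<sigma> G has_real_derivative conv \<sigma>' G s) (at s)" for s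
      using conv_has_partial[OF k p(2,1) lG] by (simp add: has_partial_1_iff)
    ultimately have "\<exists>c. \<forall>x\<in>{e<..}. conv \<sigma> G x = c"
      by (intro has_field_derivative_zero_constant convex_real_interval)
        (metis greaterThan_iff has_field_derivative_at_within)
    then show ?thesis using e by auto
  qed
  have G_eq: "G t1 = G t2" if t: "0 < t1" "0 < t2" for t1 t2
  proof -
    have "\<bar>G t1 - G t2\<bar> \<le> 0 + d" if d: "0 < d" for d
    proof -
      have "\<exists>e>0. \<forall>y. dist y s < e \<longrightarrow> dist (G y) (G s) < d / 2" for s
        using Gc d half_gt_zero[OF d] unfolding continuous_on_iff by (metis UNIV_I)
      then obtain e1 e2 where e: "e1 > 0" "e2 > 0" "\<And>y. dist y t1 < e1 \<Longrightarrow> dist (G y) (G t1) < d / 2"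
        "\<And>y. dist y t2 < e2 \<Longrightarrow> dist (G y) (G t2) < d / 2" by metis
      \<comment> \<open>Below t1 and t2, so that \<open>const\<close> applies, and below both radii
        of continuity, so that each mollified value is within d / 2 of the value of G.\<close>
      define e where "e = min (min e1 e2) (min t1 t2) / 2"
      have e': "0 < e" "e < e1" "e < e2" "e < t1" "e < t2"
        using e t by (auto simp: e_def)
      obtain \<sigma> :: "real \<Rightarrow> real" where m: "mollifier e \<sigma>"
        using mollifier_exists[OF e'(1)] by blast
      have "\<bar>conv \<sigma> G t1 - G t1\<bar> \<le> d / 2"
        using e(3) e'(2) by (intro mollify_near[OF m lG]) (metis dist_commute dist_real_def le_less_trans less_imp_le)
      moreover have "\<bar>conv \<sigma> G t2 - G t2\<bar> \<le> d / 2"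
        using e(4) e'(3) by (intro mollify_near[OF m lG]) (metis dist_commute dist_real_def le_less_trans less_imp_le)
      ultimately show ?thesis
        using const[OF m e'(4,5)] by linarith
    qed
    then have "\<bar>G t1 - G t2\<bar> \<le> 0" by (rule field_le_epsilon)
    then show ?thesis by simp
  qed
  have G1: "G s = G 1" if "0 \<le> s" for s
  proof -
    \<comment> \<open>Continuity of G carries the constancy from t > 0 to t = 0, where the one-sided
      derivative is also claimed.\<close>
    have "closure {0<..} \<subseteq> {s. G s = G 1}"
      by (intro closure_minimal closed_Collect_eq Gc continuous_on_const) (auto intro: G_eq)
    then show ?thesis using that by auto
  qed
  have "((\<lambda>s. G 1 + Q s) has_real_derivative h' t) (at t within {0..})"
    using has_field_derivative_at_within[OF Q, of t] by (auto intro!: derivative_eq_intros)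
  then have "(g has_real_derivative h' t) (at t within {0..})"
    by (rule has_field_derivative_transform_within[of _ _ _ _ 1])
      (use t G1 in \<open>auto simp: G_def g'_def algebra_simps\<close>)
  then show ?thesis
    using t by (simp add: h'_def)
qed

lemma product_test_function:
  assumes \<eta>: "\<eta> \<in> test_functions {0<..}" and m: "mollifier e \<rho>"
  shows "(\<lambda>p. \<eta> (fst p) * \<rho> (x - snd p)) \<in> test_functions ({0<..} \<times> UNIV)"
proof (rule test_functionsI[where S="closure {s. \<eta> s \<noteq> 0} \<times> cball x e"])
  have C: "C_k k \<eta>" for k using \<eta> by (simp add: test_functions_def)
  show "C_k k (\<lambda>p. \<eta> (fst p) * \<rho> (x - snd p))" for k
    using C_k_mult[OF C_k_affine[OF bounded_linear_fst C, of k 0]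
        C_k_affine[OF bounded_linear_minus[OF bounded_linear_snd] mollifierD(2)[OF m], of k x]]
    by simp
  show "compact (closure {s. \<eta> s \<noteq> 0} \<times> cball x e)"
    using \<eta> by (intro compact_Times) (auto simp: test_functions_def)
  show "closure {s. \<eta> s \<noteq> 0} \<times> cball x e \<subseteq> {0<..} \<times> UNIV"
    using \<eta> by (auto simp: test_functions_def)
  show "\<eta> (fst p) * \<rho> (x - snd p) = 0" if "p \<notin> closure {s. \<eta> s \<noteq> 0} \<times> cball x e" for p
    using that closure_subset[of "{s. \<eta> s \<noteq> 0}"] mollifierD(1)[OF m]
    by (cases p) (auto simp: kernel_def dist_norm)
qed

text \<open>For fixed x the equation is tested with \<open>\<eta> s * \<rho> (x - y)\<close>. The
  inner integral collapses to values of convolutions at x, which are continuous in time, so the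
  iterated form of the equation is enough and \<open>du_Bois_Reymond\<close> applies. The Laplacian
  survives as a sum in which one derivative falls on \<rho> and the other is the weak derivative of
  u.\<close>

lemma conv_damped_wave:
  fixes u v :: "real \<Rightarrow> 'a::euclidean_space \<Rightarrow> real"
  assumes E: "energy_class u v" and S: "solves_damped_wave \<mu> u v"
    and m: "mollifier e \<rho>" and t: "0 \<le> t"
  shows "((\<lambda>t. conv \<rho> (v t) x) has_real_derivative
     (\<Sum>b\<in>Basis. conv (partial \<rho> b) (\<lambda>y. weak_gradient (u t) y \<bullet> b) x)
       - \<mu> / (1 + t) * conv \<rho> (v t) x) (at t within {0..})"
proof -
  define D where "D b z = frechet_derivative \<rho> (at z) b" for b z
  define G where "G b t y = weak_gradient (u t) y \<bullet> b" for b t y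
  define g where "g t = conv \<rho> (v t) x" for t
  define h where "h t = (\<Sum>b\<in>Basis. conv (D b) (G b t) x) - \<mu> / (1 + t) * g t" for t
  note k = mollifierD(1)[OF m]
  have kD: "kernel e (D b)" for b
    using mollifier_partial(2)[OF m] by (simp add: D_def[abs_def])
  have cG: "L2_continuous (G b)" if "b \<in> Basis" for b
    unfolding G_def[abs_def] by (rule energy_class_L2_continuous(3)[OF E that])
  note cv = energy_class_L2_continuous(2)[OF E]
  have gc: "continuous_on {0..} g"
    unfolding g_def[abs_def] by (rule L2_continuous_conv[OF cv k])
  have hc: "continuous_on {0..} h"
    unfolding h_def[abs_def]
    by (intro continuous_intros gc L2_continuous_conv[OF cG kD]) auto
  have "(g has_real_derivative h t) (at t within {0..})"
  proof (rule du_Bois_Reymond[OF gc hc _ t])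
    fix \<eta> :: "real \<Rightarrow> real" assume \<eta>: "\<eta> \<in> test_functions {0<..}"
    let ?\<phi> = "\<lambda>p. \<eta> (fst p) * \<rho> (x - snd p)"
    have d\<phi>: "frechet_derivative ?\<phi> (at (s, y))
        = (\<lambda>p. \<eta> s * frechet_derivative \<rho> (at (x - y)) (- snd p) + frechet_derivative \<eta> (at s) (fst p) * \<rho> (x - y))" for s y
    proof (rule frechet_derivative_at[symmetric])
      have C: "C_k (Suc 0) \<eta>" using \<eta> by (simp add: test_functions_def)
      have 0: "(\<eta> has_derivative frechet_derivative \<eta> (at s)) (at (fst (s, y)))"
        using C_k_has_derivative[OF C, of s] by simp
      have 1: "((\<lambda>p. \<eta> (fst p)) has_derivative (\<lambda>p. frechet_derivative \<eta> (at s) (fst p))) (at (s, y))"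
        by (rule has_derivative_compose[OF has_derivative_fst[OF has_derivative_ident] 0])
      have 2: "((\<lambda>p. \<rho> (x - snd p)) has_derivative (\<lambda>p. frechet_derivative \<rho> (at (x - y)) (- snd p))) (at (s, y))"
        by (rule has_derivative_compose[where f="\<lambda>p. x - snd p" and g=\<rho>])
          (use C_k_has_derivative[OF mollifierD(2)[OF m]] in \<open>auto intro!: derivative_eq_intros\<close>)
      show "(?\<phi> has_derivative (\<lambda>p. \<eta> s * frechet_derivative \<rho> (at (x - y)) (- snd p) + frechet_derivative \<eta> (at s) (fst p) * \<rho> (x - y))) (at (s, y))"
        using has_derivative_mult[OF 1 2] by simp
    qed
    have lin: "linear (frechet_derivative \<rho> (at z))" for z
      by (rule has_derivative_linear[OF C_k_has_derivative[OF mollifierD(2)[OF m]]])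
    have Dsum: "frechet_derivative \<rho> (at z) (- w) = - (\<Sum>b\<in>Basis. D b z * (w \<bullet> b))" for z w
    proof -
      have "frechet_derivative \<rho> (at z) w = frechet_derivative \<rho> (at z) (\<Sum>b\<in>Basis. (w \<bullet> b) *\<^sub>R b)"
        by (simp add: euclidean_representation)
      also have "\<dots> = (\<Sum>b\<in>Basis. D b z * (w \<bullet> b))"
        using lin[of z] by (simp add: linear_sum linear_cmul D_def mult.commute)
      finally show ?thesis using linear_neg[OF lin] by simp
    qed
    have inner: "(\<integral>y. - v s y * frechet_derivative ?\<phi> (at (s, y)) (1, 0)
          + frechet_derivative ?\<phi> (at (s, y)) (0, weak_gradient (u s) y)
          + \<mu> / (1 + s) * v s y * ?\<phi> (s, y) \<partial>lborel)
        = - (frechet_derivative \<eta> (at s) 1 * g s + \<eta> s * h s)" if s: "0 < s" for s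
    proof -
      have \<eta>0: "frechet_derivative \<eta> (at s) 0 = 0"
        using \<eta> by (intro linear_0[OF has_derivative_linear[OF C_k_has_derivative[of 0 \<eta> s]]])
          (simp add: test_functions_def del: C_k.simps)
      have iv: "integrable lborel (\<lambda>y. \<rho> (x - y) * v s y)"
        using cv s by (intro conv_integrable[OF k] L2_locally_integrable) (simp add: L2_continuous_def)
      have iG: "integrable lborel (\<lambda>y. D b (x - y) * G b s y)" if "b \<in> Basis" for b
        using cG[OF that] s by (intro conv_integrable[OF kD] L2_locally_integrable) (simp add: L2_continuous_def)
      have "(\<integral>y. - v s y * frechet_derivative ?\<phi> (at (s, y)) (1, 0)
          + frechet_derivative ?\<phi> (at (s, y)) (0, weak_gradient (u s) y)
          + \<mu> / (1 + s) * v s y * ?\<phi> (s, y) \<partial>lborel)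
        = (\<integral>y. (\<mu> / (1 + s) * \<eta> s - frechet_derivative \<eta> (at s) 1) * (\<rho> (x - y) * v s y)
          - \<eta> s * (\<Sum>b\<in>Basis. D b (x - y) * G b s y) \<partial>lborel)"
        by (intro Bochner_Integration.integral_cong[OF refl])
          (simp add: d\<phi> Dsum[of _ 0, simplified] Dsum \<eta>0 G_def algebra_simps)
      also have "\<dots> = (\<mu> / (1 + s) * \<eta> s - frechet_derivative \<eta> (at s) 1) * g s
          - \<eta> s * (\<Sum>b\<in>Basis. conv (D b) (G b s) x)"
        using iv iG by (simp add: g_def conv_def)
      finally show ?thesis
        by (simp add: h_def algebra_simps)
    qed
    have "(LINT s:{0<..}|lborel. frechet_derivative \<eta> (at s) 1 * g s + \<eta> s * h s)
      = - (LINT s:{0<..}|lborel. (\<integral>y. - v s y * frechet_derivative ?\<phi> (at (s, y)) (1, 0)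
          + frechet_derivative ?\<phi> (at (s, y)) (0, weak_gradient (u s) y)
          + \<mu> / (1 + s) * v s y * ?\<phi> (s, y) \<partial>lborel))"
      unfolding set_lebesgue_integral_def Bochner_Integration.integral_minus[symmetric]
    proof (rule Bochner_Integration.integral_cong[OF refl])
      fix s :: real
      show "indicator {0<..} s *\<^sub>R (frechet_derivative \<eta> (at s) 1 * g s + \<eta> s * h s)
        = - (indicator {0<..} s *\<^sub>R (\<integral>y. - v s y * frechet_derivative ?\<phi> (at (s, y)) (1, 0)
          + frechet_derivative ?\<phi> (at (s, y)) (0, weak_gradient (u s) y)
          + \<mu> / (1 + s) * v s y * ?\<phi> (s, y) \<partial>lborel))"
        by (cases "0 < s", subst inner) simp_all
    qed
    also have "\<dots> = 0"
      using S product_test_function[OF \<eta> m, of x] unfolding solves_damped_wave_def by fastforce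
    finally show "(LINT s:{0<..}|lborel. frechet_derivative \<eta> (at s) 1 * g s + \<eta> s * h s) = 0" .
  qed
  then show ?thesis
    by (simp add: g_def[abs_def] h_def G_def[abs_def] D_def[abs_def])
qed

section \<open>Balance laws and finite speed of propagation\<close>

text \<open>Dominated convergence in time asks only for bounds on space-time cylinders. They follow
  from \<open>abs_conv_le\<close>, uniformly in x, and pass to all the products in the energy
  densities, so joint continuity in (t, x) never has to be discussed.\<close>

definition bounded_upto :: "real \<Rightarrow> real \<Rightarrow> (real \<Rightarrow> 'a::euclidean_space \<Rightarrow> real) \<Rightarrow> bool" where
  "bounded_upto T r F \<longleftrightarrow> (\<exists>B. \<forall>t x. 0 \<le> t \<and> t \<le> T \<and> norm x \<le> r \<longrightarrow> \<bar>F t x\<bar> \<le> B)"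

lemma bounded_uptoI:
  assumes "\<And>t x. 0 \<le> t \<Longrightarrow> t \<le> T \<Longrightarrow> norm x \<le> r \<Longrightarrow> \<bar>F t x\<bar> \<le> B"
  shows "bounded_upto T r F"
  using assms unfolding bounded_upto_def by blast

lemma bounded_upto_continuous:
  assumes "continuous_on UNIV (\<lambda>p. F (fst p) (snd p))"
  shows "bounded_upto T r F"
proof -
  have "compact ((\<lambda>p. F (fst p) (snd p)) ` ({0..T} \<times> cball 0 r))"
    by (intro compact_continuous_image continuous_on_subset[OF assms] compact_Times) auto
  then obtain B where "\<And>p. p \<in> {0..T} \<times> cball 0 r \<Longrightarrow> \<bar>F (fst p) (snd p)\<bar> \<le> B"
    by (fastforce simp: bounded_iff dest!: compact_imp_bounded)
  then show ?thesis
    by (intro bounded_uptoI[of _ _ _ B]) auto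
qed

lemma bounded_upto_add:
  assumes "bounded_upto T r F" "bounded_upto T r G"
  shows "bounded_upto T r (\<lambda>t x. F t x + G t x)"
proof -
  obtain A B where "\<And>t x. 0 \<le> t \<Longrightarrow> t \<le> T \<Longrightarrow> norm x \<le> r \<Longrightarrow> \<bar>F t x\<bar> \<le> A"
    "\<And>t x. 0 \<le> t \<Longrightarrow> t \<le> T \<Longrightarrow> norm x \<le> r \<Longrightarrow> \<bar>G t x\<bar> \<le> B"
    using assms unfolding bounded_upto_def by metis
  then show ?thesis
    by (intro bounded_uptoI[of _ _ _ "A + B"]) (smt (verit))
qed

lemma bounded_upto_mult:
  assumes "bounded_upto T r F" "bounded_upto T r G"
  shows "bounded_upto T r (\<lambda>t x. F t x * G t x)"
proof -
  obtain A B where "\<And>t x. 0 \<le> t \<Longrightarrow> t \<le> T \<Longrightarrow> norm x \<le> r \<Longrightarrow> \<bar>F t x\<bar> \<le> A"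
    "\<And>t x. 0 \<le> t \<Longrightarrow> t \<le> T \<Longrightarrow> norm x \<le> r \<Longrightarrow> \<bar>G t x\<bar> \<le> B"
    using assms unfolding bounded_upto_def by metis
  then show ?thesis
    by (intro bounded_uptoI[of _ _ _ "A * B"]) (simp add: abs_mult, meson abs_ge_zero mult_mono order_trans)
qed

lemma bounded_upto_const: "bounded_upto T r (\<lambda>t x. c)"
  by (rule bounded_uptoI[of _ _ _ "\<bar>c\<bar>"]) simp

lemma bounded_upto_uminus: "bounded_upto T r F \<Longrightarrow> bounded_upto T r (\<lambda>t x. - F t x)"
  by (simp add: bounded_upto_def)

lemma bounded_upto_diff:
  "bounded_upto T r F \<Longrightarrow> bounded_upto T r G \<Longrightarrow> bounded_upto T r (\<lambda>t x. F t x - G t x)"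
  using bounded_upto_add[OF _ bounded_upto_uminus, of T r F G] by simp

lemma bounded_upto_power: "bounded_upto T r F \<Longrightarrow> bounded_upto T r (\<lambda>t x. (F t x) ^ n)"
  by (induction n) (auto intro: bounded_upto_mult bounded_upto_const)

lemma bounded_upto_sum:
  "(\<And>b. b \<in> I \<Longrightarrow> bounded_upto T r (F b)) \<Longrightarrow> bounded_upto T r (\<lambda>t x. \<Sum>b\<in>I. F b t x)"
  by (induction I rule: infinite_finite_induct) (auto intro: bounded_upto_add bounded_upto_const)

lemmas bounded_upto_intros = bounded_upto_add bounded_upto_mult bounded_upto_const
  bounded_upto_uminus bounded_upto_diff bounded_upto_power bounded_upto_sum

text \<open>The flux \<open>J\<close> integrates to zero, so only the sign of \<open>\<partial>\<^sub>t F - div J\<close> matters.\<close>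

lemma integral_nonincreasing_of_balance:
  fixes F F' :: "real \<Rightarrow> 'a::euclidean_space \<Rightarrow> real" and J J' :: "'a \<Rightarrow> real \<Rightarrow> 'a \<Rightarrow> real"
  assumes "0 \<le> T"
    and dF: "\<And>t x. 0 \<le> t \<Longrightarrow> ((\<lambda>t. F t x) has_real_derivative F' t x) (at t within {0..})"
    and dJ: "\<And>t b. 0 \<le> t \<Longrightarrow> b \<in> Basis \<Longrightarrow> has_partial b (J b t) (J' b t)"
    and le: "\<And>t x. 0 \<le> t \<Longrightarrow> t \<le> T \<Longrightarrow> F' t x \<le> (\<Sum>b\<in>Basis. J' b t x)"
    and meas: "\<And>t. 0 \<le> t \<Longrightarrow> F t \<in> borel_measurable borel" "\<And>t. 0 \<le> t \<Longrightarrow> F' t \<in> borel_measurable borel"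
      "\<And>t b. 0 \<le> t \<Longrightarrow> b \<in> Basis \<Longrightarrow> J b t \<in> borel_measurable borel"
      "\<And>t b. 0 \<le> t \<Longrightarrow> b \<in> Basis \<Longrightarrow> J' b t \<in> borel_measurable borel"
    and bd: "bounded_upto T r F" "bounded_upto T r F'"
      "\<And>b. b \<in> Basis \<Longrightarrow> bounded_upto T r (J b)" "\<And>b. b \<in> Basis \<Longrightarrow> bounded_upto T r (J' b)"
    and zero: "\<And>t x. 0 \<le> t \<Longrightarrow> t \<le> T \<Longrightarrow> r < norm x \<Longrightarrow> F t x = 0 \<and> F' t x = 0"
      "\<And>t x b. 0 \<le> t \<Longrightarrow> t \<le> T \<Longrightarrow> r < norm x \<Longrightarrow> b \<in> Basis \<Longrightarrow> J b t x = 0"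
  shows "(\<integral>x. F T x \<partial>lborel) \<le> (\<integral>x. F 0 x \<partial>lborel)"
proof -
  have zJ': "J' b t x = 0" if "0 \<le> t" "t \<le> T" "r < norm x" "b \<in> Basis" for t x b
    by (rule has_partial_zero_outside[OF dJ[OF that(1,4)] zero(2)[OF that(1,2) _ that(4)] that(3)])
  have glob: "\<exists>B\<ge>0. \<forall>t x. 0 \<le> t \<and> t \<le> T \<longrightarrow> \<bar>H t x\<bar> \<le> B"
    if H: "bounded_upto T r H" and z: "\<And>t x. 0 \<le> t \<Longrightarrow> t \<le> T \<Longrightarrow> r < norm x \<Longrightarrow> H t x = 0" for H :: "real \<Rightarrow> 'a \<Rightarrow> real"
  proof -
    obtain B where B: "\<And>t x. 0 \<le> t \<Longrightarrow> t \<le> T \<Longrightarrow> norm x \<le> r \<Longrightarrow> \<bar>H t x\<bar> \<le> B"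
      using H unfolding bounded_upto_def by metis
    have "\<bar>H t x\<bar> \<le> max 0 B" if "0 \<le> t" "t \<le> T" for t x
      using B[OF that, of x] z[OF that, of x] by (cases "r < norm x") auto
    then show ?thesis by (intro exI[of _ "max 0 B"]) auto
  qed
  obtain BF where BF: "\<And>t x. 0 \<le> t \<Longrightarrow> t \<le> T \<Longrightarrow> \<bar>F t x\<bar> \<le> BF"
    using glob[OF bd(1)] zero(1) by metis
  obtain BF' where BF': "0 \<le> BF'" "\<And>t x. 0 \<le> t \<Longrightarrow> t \<le> T \<Longrightarrow> \<bar>F' t x\<bar> \<le> BF'"
    using glob[OF bd(2)] zero(1) by metis
  have iF: "integrable lborel (F t)" if "0 \<le> t" "t \<le> T" for t
    using meas(1) BF zero(1) that by (intro integrable_bounded_support[where r=r and B=BF]) auto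
  have iF': "integrable lborel (F' t)" if "0 \<le> t" "t \<le> T" for t
    using meas(2) BF'(2) zero(1) that by (intro integrable_bounded_support[where r=r and B=BF']) auto
  have J0: "integrable lborel (J' b t) \<and> (\<integral>x. J' b t x \<partial>lborel) = 0" if t: "0 \<le> t" "t \<le> T" and b: "b \<in> Basis" for t b
  proof -
    obtain B1 B2 where B: "\<And>x. \<bar>J b t x\<bar> \<le> B1" "\<And>x. \<bar>J' b t x\<bar> \<le> B2"
      using glob[OF bd(3)[OF b]] zero(2) glob[OF bd(4)[OF b]] zJ' t b by metis
    have "\<bar>J b t x\<bar> \<le> max B1 B2" "\<bar>J' b t x\<bar> \<le> max B1 B2" for x
      using B[of x] by auto
    then have "(\<integral>x. J' b t x \<partial>lborel) = 0"
      by (rule integral_has_partial_eq_0[OF dJ[OF t(1) b] meas(3)[OF t(1) b]]) (use zero(2) t b in auto)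
    moreover have "integrable lborel (J' b t)"
      using meas(4)[OF t(1) b] B(2) zJ' t b by (intro integrable_bounded_support[where r=r and B=B2]) auto
    ultimately show ?thesis by simp
  qed
  have der: "((\<lambda>t. \<integral>x. F t x \<partial>lborel) has_real_derivative (\<integral>x. F' t x \<partial>lborel)) (at t within {0..T})"
    if "t \<in> {0..T}" for t
  proof (rule has_real_derivative_integral[where g="\<lambda>x. BF' * indicator (cball 0 r) x"])
    show "((\<lambda>t. F t x) has_real_derivative F' t x) (at t within {0..T})" if "t \<in> {0..T}" for t x
      using that by (intro DERIV_subset[OF dF]) auto
    show "\<bar>F' t x\<bar> \<le> BF' * indicator (cball 0 r) x" if "t \<in> {0..T}" for t x
      using that BF' zero(1)[of t x] by (auto simp: indicator_def not_le)
    show "integrable lborel (\<lambda>x::'a. BF' * indicator (cball 0 r) x)"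
      by (auto intro!: integrable_mult_right integrable_real_indicator emeasure_lborel_cball_finite)
  qed (use that iF in auto)
  have neg: "(\<integral>x. F' t x \<partial>lborel) \<le> 0" if t: "0 \<le> t" "t \<le> T" for t
  proof -
    have "(\<integral>x. F' t x \<partial>lborel) \<le> (\<integral>x. (\<Sum>b\<in>Basis. J' b t x) \<partial>lborel)"
      using iF' J0 le t by (intro integral_mono) auto
    also have "\<dots> = 0"
      using J0 t by simp
    finally show ?thesis .
  qed
  show ?thesis
  proof (rule DERIV_nonpos_imp_decreasing_open[OF \<open>0 \<le> T\<close>])
    show "\<exists>y. ((\<lambda>t. \<integral>x. F t x \<partial>lborel) has_real_derivative y) (at t) \<and> y \<le> 0" if "0 < t" "t < T" for t
      using der[of t] neg[of t] that by (auto simp: at_within_Icc_at)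
    show "continuous_on {0..T} (\<lambda>t. \<integral>x. F t x \<partial>lborel)"
      by (rule DERIV_continuous_on[OF der])
  qed
qed

section \<open>Energy in backward light cones\<close>

lemma norm_power2_Basis: "(norm y)\<^sup>2 = (\<Sum>b\<in>Basis. (y \<bullet> b)\<^sup>2)"
  unfolding power2_norm_eq_inner euclidean_inner[of y y] by (simp add: power2_eq_square)

lemma inner_Basis_sum_power2_le:
  fixes y :: "'a::euclidean_space"
  shows "(\<Sum>b\<in>Basis. (y \<bullet> b) * p b)\<^sup>2 \<le> (norm y)\<^sup>2 * (\<Sum>b\<in>Basis. (p b)\<^sup>2)"
proof -
  define P where "P = (\<Sum>b\<in>Basis. p b *\<^sub>R b)"
  have Pb: "P \<bullet> b = p b" if "b \<in> Basis" for b
    using that by (simp add: P_def)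
  have "y \<bullet> P = (\<Sum>b\<in>Basis. (y \<bullet> b) * p b)"
    by (subst euclidean_inner) (simp add: Pb)
  moreover have "P \<bullet> P = (\<Sum>b\<in>Basis. (p b)\<^sup>2)"
    by (subst euclidean_inner) (simp add: Pb power2_eq_square)
  ultimately show ?thesis
    using Cauchy_Schwarz_ineq[of y P] by (simp add: dot_square_norm)
qed

text \<open>Squaring smooths the kink of the positive part; the cut-off to the light cone is
  differentiable for this reason.\<close>

lemma DERIV_max_0_power2: "((\<lambda>y::real. (max 0 y)\<^sup>2) has_real_derivative 2 * max 0 y) (at y)"
proof -
  consider "y > 0" | "y < 0" | "y = 0" by linarith
  then show ?thesis
  proof cases
    case 1
    have "eventually (\<lambda>y::real. (max 0 y)\<^sup>2 = y\<^sup>2) (nhds y)"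
      using eventually_nhds_in_open[of "{0<..}" y] 1 by (auto elim!: eventually_mono)
    then show ?thesis
      using 1 by (subst DERIV_cong_ev[OF refl _ refl]) (auto intro!: derivative_eq_intros)
  next
    case 2
    have *: "eventually (\<lambda>y::real. (max 0 y)\<^sup>2 = 0) (nhds y)"
      using eventually_nhds_in_open[of "{..<0}" y] 2 by (auto elim!: eventually_mono)
    show ?thesis
      using 2 by (subst DERIV_cong_ev[OF refl * refl]) auto
  next
    case 3
    have "((\<lambda>h::real. (max 0 h)\<^sup>2 / h) \<longlongrightarrow> 0) (at 0)"
    proof (rule Lim_null_comparison)
      show "((\<lambda>h::real. \<bar>h\<bar>) \<longlongrightarrow> 0) (at 0)"
        by (rule tendsto_rabs_zero) (rule tendsto_ident_at)
      show "\<forall>\<^sub>F h::real in at 0. norm ((max 0 h)\<^sup>2 / h) \<le> \<bar>h\<bar>"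
        by (intro always_eventually allI) (auto simp: max_def power2_eq_square)
    qed
    then show ?thesis
      using 3 by (simp add: DERIV_def)
  qed
qed

lemma has_partial_norm_power2:
  fixes x0 :: "'a::euclidean_space"
  shows "has_partial b (\<lambda>x. (norm (x - x0))\<^sup>2) (\<lambda>x. 2 * ((x - x0) \<bullet> b))"
proof -
  have "((\<lambda>x. (x - x0) \<bullet> (x - x0)) has_derivative (\<lambda>v. 2 * ((x - x0) \<bullet> v))) (at x)" for x
    by (auto intro!: derivative_eq_intros simp: inner_commute)
  from has_derivative_imp_partial[OF this, of b] show ?thesis
    by (simp add: dot_square_norm)
qed

text \<open>The regularity that mollification in x produces: \<open>z\<close>, \<open>p b\<close>,
  \<open>q b\<close> and \<open>r b\<close> are the derivatives w_t, \<partial>_b w, \<partial>_b^2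
  w and \<partial>_b w_t. That \<open>r b\<close> is both the time derivative of \<open>p b\<close>
  and the space derivative of \<open>z\<close> encodes the exchange of mixed derivatives. Continuity
  is in x at fixed t, and uniformity in t enters through \<open>bounded_upto\<close>.\<close>

locale classical_damped_wave =
  fixes \<mu> :: real and w z :: "real \<Rightarrow> 'a::euclidean_space \<Rightarrow> real" and p q r :: "'a \<Rightarrow> real \<Rightarrow> 'a \<Rightarrow> real"
  assumes mu: "0 \<le> \<mu>"
    and w_t: "\<And>t x. 0 \<le> t \<Longrightarrow> ((\<lambda>t. w t x) has_real_derivative z t x) (at t within {0..})"
    and z_t: "\<And>t x. 0 \<le> t \<Longrightarrow>
      ((\<lambda>t. z t x) has_real_derivative (\<Sum>b\<in>Basis. q b t x) - \<mu> / (1 + t) * z t x) (at t within {0..})"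
    and p_t: "\<And>t x b. 0 \<le> t \<Longrightarrow> b \<in> Basis \<Longrightarrow> ((\<lambda>t. p b t x) has_real_derivative r b t x) (at t within {0..})"
    and w_x: "\<And>t b. 0 \<le> t \<Longrightarrow> b \<in> Basis \<Longrightarrow> has_partial b (w t) (p b t)"
    and z_x: "\<And>t b. 0 \<le> t \<Longrightarrow> b \<in> Basis \<Longrightarrow> has_partial b (z t) (r b t)"
    and p_x: "\<And>t b. 0 \<le> t \<Longrightarrow> b \<in> Basis \<Longrightarrow> has_partial b (p b t) (q b t)"
    and cont_w: "\<And>t. 0 \<le> t \<Longrightarrow> continuous_on UNIV (w t)"
    and cont_z: "\<And>t. 0 \<le> t \<Longrightarrow> continuous_on UNIV (z t)"
    and cont_p: "\<And>t b. 0 \<le> t \<Longrightarrow> b \<in> Basis \<Longrightarrow> continuous_on UNIV (p b t)"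
    and cont_q: "\<And>t b. 0 \<le> t \<Longrightarrow> b \<in> Basis \<Longrightarrow> continuous_on UNIV (q b t)"
    and cont_r: "\<And>t b. 0 \<le> t \<Longrightarrow> b \<in> Basis \<Longrightarrow> continuous_on UNIV (r b t)"
    and bdd_w: "\<And>T R. bounded_upto T R w"
    and bdd_z: "\<And>T R. bounded_upto T R z"
    and bdd_p: "\<And>T R b. b \<in> Basis \<Longrightarrow> bounded_upto T R (p b)"
    and bdd_q: "\<And>T R b. b \<in> Basis \<Longrightarrow> bounded_upto T R (q b)"
    and bdd_r: "\<And>T R b. b \<in> Basis \<Longrightarrow> bounded_upto T R (r b)"
begin

lemmas continuous_solution = cont_w cont_z cont_p cont_q cont_r
lemmas bounded_solution = bdd_w bdd_z bdd_p bdd_q bdd_r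

text \<open>The energy is weighted with a \<open>C\<^sup>1\<close> function supported in the backward light cone with apex
  \<open>(T, x0)\<close>; the quadratic argument avoids the singularity of \<open>norm\<close> on the axis.\<close>

lemma cone_energy:
  assumes t: "0 \<le> t" "t < T" and init: "\<And>x. norm (x - x0) < T \<Longrightarrow> z 0 x = 0 \<and> (\<forall>b\<in>Basis. p b 0 x = 0)"
  shows "z t x0 = 0"
proof -
  define N where "N s x = (T - s)\<^sup>2 - (norm (x - x0))\<^sup>2" for s and x :: 'a
  define e where "e s x = ((z s x)\<^sup>2 + (\<Sum>b\<in>Basis. (p b s x)\<^sup>2)) / 2" for s x
  define F where "F s x = (max 0 (N s x))\<^sup>2 * e s x" for s x
  define F' where "F' s x = (2 * max 0 (N s x) * (- 2 * (T - s))) * e s x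
    + (max 0 (N s x))\<^sup>2 * (z s x * ((\<Sum>b\<in>Basis. q b s x) - \<mu> / (1 + s) * z s x) + (\<Sum>b\<in>Basis. p b s x * r b s x))" for s x
  define J where "J b s x = (max 0 (N s x))\<^sup>2 * (z s x * p b s x)" for b s x
  define J' where "J' b s x = (2 * max 0 (N s x) * (- 2 * ((x - x0) \<bullet> b))) * (z s x * p b s x)
    + (max 0 (N s x))\<^sup>2 * (r b s x * p b s x + z s x * q b s x)" for b s x
  have N_out: "max 0 (N s x) = 0" if "0 \<le> s" "s \<le> t" "T \<le> norm (x - x0)" for s x
    using power_mono[of "T - s" "norm (x - x0)" 2] that t by (auto simp: N_def max_def)
  have far: "T \<le> norm (x - x0)" if "norm x0 + T < norm x" for x
    using norm_triangle_ineq2[of x x0] that by linarith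
  have cN: "continuous_on UNIV (\<lambda>p. max 0 (N (fst p) (snd p)))"
    unfolding N_def by (intro continuous_intros)
  have cNs: "continuous_on UNIV (\<lambda>x. max 0 (N s x))" for s
    unfolding N_def by (intro continuous_intros)
  note [measurable] = continuous_solution[THEN borel_measurable_continuous_onI]
    borel_measurable_continuous_onI[OF cNs]
  have "(\<integral>x. F t x \<partial>lborel) \<le> (\<integral>x. F 0 x \<partial>lborel)"
  proof (rule integral_nonincreasing_of_balance[where r="norm x0 + T" and F=F and F'=F' and J=J and J'=J'])
    fix s :: real and x :: 'a
    assume s: "0 \<le> s"
    have "((\<lambda>s. N s x) has_real_derivative - 2 * (T - s)) (at s within {0..})"
      unfolding N_def by (auto intro!: derivative_eq_intros)
    then have 1: "((\<lambda>s. (max 0 (N s x))\<^sup>2) has_real_derivative 2 * max 0 (N s x) * (- 2 * (T - s))) (at s within {0..})"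
      by (rule DERIV_chain2[OF DERIV_max_0_power2])
    have 2: "((\<lambda>s. e s x) has_real_derivative z s x * ((\<Sum>b\<in>Basis. q b s x) - \<mu> / (1 + s) * z s x) + (\<Sum>b\<in>Basis. p b s x * r b s x)) (at s within {0..})"
      unfolding e_def using s
      by (auto intro!: derivative_eq_intros z_t p_t DERIV_sum simp: sum_distrib_left sum_divide_distrib field_simps)
    show "((\<lambda>s. F s x) has_real_derivative F' s x) (at s within {0..})"
      unfolding F_def F'_def using DERIV_mult[OF 1 2] by (simp add: algebra_simps)
  next
    fix s :: real and b :: 'a
    assume s: "0 \<le> s" and b: "b \<in> Basis"
    have 0: "has_partial b (\<lambda>x. (T - s)\<^sup>2 + (- 1) * (norm (x - x0))\<^sup>2) (\<lambda>x. 0 + (- 1) * (2 * ((x - x0) \<bullet> b)))"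
      by (intro has_partial_add has_partial_const has_partial_cmult has_partial_norm_power2)
    have 1: "has_partial b (\<lambda>x. (max 0 (N s x))\<^sup>2) (\<lambda>x. 2 * max 0 (N s x) * (- 2 * ((x - x0) \<bullet> b)))"
      using has_partial_chain[OF DERIV_max_0_power2 0] by (simp add: N_def)
    show "has_partial b (J b s) (J' b s)"
      using has_partial_mult[OF 1 has_partial_mult[OF z_x[OF s b] p_x[OF s b]]] by (simp add: J_def[abs_def] J'_def[abs_def])
  next
    fix s x
    assume s: "0 \<le> s" "s \<le> t"
    define m where "m = max 0 (N s x)"
    define P2 where "P2 = (\<Sum>b\<in>Basis. (p b s x)\<^sup>2)"
    define S where "S = (\<Sum>b\<in>Basis. ((x - x0) \<bullet> b) * p b s x)"
    have "(\<Sum>b\<in>Basis. J' b s x) = - 4 * m * z s x * S + m\<^sup>2 * ((\<Sum>b\<in>Basis. p b s x * r b s x) + z s x * (\<Sum>b\<in>Basis. q b s x))"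
      unfolding J'_def sum.distrib S_def m_def[symmetric] by (simp add: sum_distrib_left sum_negf sum.distrib algebra_simps)
    moreover have "F' s x = - 2 * m * (T - s) * ((z s x)\<^sup>2 + P2)
       + m\<^sup>2 * ((\<Sum>b\<in>Basis. p b s x * r b s x) + z s x * (\<Sum>b\<in>Basis. q b s x)) - m\<^sup>2 * (\<mu> / (1 + s)) * (z s x)\<^sup>2"
      unfolding F'_def e_def P2_def[symmetric] m_def[symmetric]
      by (simp add: power2_eq_square algebra_simps add_divide_distrib diff_divide_distrib)
    moreover have "0 \<le> m\<^sup>2 * (\<mu> / (1 + s)) * (z s x)\<^sup>2"
      using mu s by simp
    \<comment> \<open>Where the cut-off is positive, \<bar>x - x0\<bar> < T - s: the flux caused by
      the slope of the cut-off is dominated by the loss from its shrinking in time. The square is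
      completed after multiplying by T - s > 0.\<close>
    moreover have "2 * m * (2 * z s x * S) \<le> 2 * m * ((T - s) * ((z s x)\<^sup>2 + P2))"
    proof (cases "m = 0")
      case False
      then have "N s x > 0" by (auto simp: m_def max_def split: if_splits)
      have \<tau>: "T - s > 0" using s t by simp
      have "S\<^sup>2 \<le> (norm (x - x0))\<^sup>2 * P2"
        unfolding S_def P2_def by (rule inner_Basis_sum_power2_le)
      also have "\<dots> \<le> (T - s)\<^sup>2 * P2"
        using \<open>N s x > 0\<close> by (intro mult_right_mono) (auto simp: N_def P2_def sum_nonneg)
      finally have S2: "S\<^sup>2 \<le> (T - s)\<^sup>2 * P2" .
      have "(T - s) * (2 * z s x * S) \<le> (T - s)\<^sup>2 * (z s x)\<^sup>2 + S\<^sup>2"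
        using sum_squares_bound[of "(T - s) * z s x" S] by (simp add: power_mult_distrib mult_ac)
      also have "\<dots> \<le> (T - s) * ((T - s) * ((z s x)\<^sup>2 + P2))"
        using S2 by (simp add: power2_eq_square algebra_simps)
      finally have "2 * z s x * S \<le> (T - s) * ((z s x)\<^sup>2 + P2)"
        using \<tau> by simp
      then show ?thesis
        by (intro mult_left_mono) (auto simp: m_def)
    qed simp
    ultimately show "F' s x \<le> (\<Sum>b\<in>Basis. J' b s x)"
      by (simp add: algebra_simps)
  next
    have bN: "bounded_upto t (norm x0 + T) (\<lambda>s x. max 0 (N s x))"
      by (rule bounded_upto_continuous[OF cN])
    have bm: "bounded_upto t (norm x0 + T) (\<lambda>s x. - 2 * (T - s))"
      by (intro bounded_upto_continuous continuous_intros)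
    have bx: "bounded_upto t (norm x0 + T) (\<lambda>s x. - 2 * ((x - x0) \<bullet> b))" for b
      by (intro bounded_upto_continuous continuous_intros)
    have b\<mu>: "bounded_upto t (norm x0 + T) (\<lambda>s x. \<mu> / (1 + s))"
      using mu by (intro bounded_uptoI[of _ _ _ \<mu>]) (auto simp: field_simps)
    show "bounded_upto t (norm x0 + T) F"
      unfolding F_def e_def divide_inverse by (intro bounded_upto_intros bN bounded_solution)
    show "bounded_upto t (norm x0 + T) F'"
      unfolding F'_def e_def divide_inverse[of _ 2] by (intro bounded_upto_intros bN bounded_solution bm b\<mu>)
    show "bounded_upto t (norm x0 + T) (J b)" "bounded_upto t (norm x0 + T) (J' b)" if "b \<in> Basis" for b
      unfolding J_def J'_def using that by (intro bounded_upto_intros bN bounded_solution bx; simp)+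
  next
    fix s :: real assume s: "0 \<le> s"
    show "F s \<in> borel_measurable borel" "F' s \<in> borel_measurable borel"
      unfolding F_def[abs_def] F'_def[abs_def] e_def[abs_def] using s by measurable
    fix b :: 'a assume b: "b \<in> Basis"
    show "J b s \<in> borel_measurable borel" "J' b s \<in> borel_measurable borel"
      unfolding J_def[abs_def] J'_def[abs_def] using s b by measurable
  qed (use t N_out far in \<open>auto simp: F_def F'_def J_def\<close>)
  also have "F 0 = (\<lambda>x. 0)"
  proof
    fix x show "F 0 x = 0"
      using N_out[of 0 x] init[of x] t by (cases "norm (x - x0) < T") (auto simp: F_def e_def)
  qed
  finally have le: "(\<integral>x. F t x \<partial>lborel) \<le> 0" by simp
  have Fc: "continuous_on UNIV (F t)"
    unfolding F_def[abs_def] e_def[abs_def] using t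
    by (intro continuous_intros cNs continuous_solution) auto
  have F0: "0 \<le> F t x" for x
    by (auto simp: F_def e_def intro!: mult_nonneg_nonneg add_nonneg_nonneg sum_nonneg)
  have "kernel (norm x0 + T) (F t)"
    using Fc N_out[of t] far t by (auto simp: kernel_def F_def)
  then have "integrable lborel (F t)"
    using kernel_mult_integrable[OF _ continuous_locally_integrable[OF continuous_on_const[of _ 1]]] by fastforce
  then have "AE x in lborel. F t x = 0"
    using le F0 integral_nonneg_eq_0_iff_AE[of lborel "F t"]
    by (metis (no_types, lifting) AE_I2 Bochner_Integration.integral_nonneg order_antisym)
  then have "F t x0 = 0"
    by (rule continuous_AE_zero[OF Fc])
  moreover have "0 < N t x0"
    using t by (simp add: N_def)
  ultimately have "e t x0 = 0"
    by (simp add: F_def)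
  moreover have "(z t x0)\<^sup>2 \<le> 2 * e t x0"
    by (simp add: e_def sum_nonneg)
  ultimately show ?thesis by simp
qed

text \<open>The backward cone over x with base radius \<open>norm x - R\<close> has a base that
  misses the initial support, and its apex lies later than t. This gives the vanishing of z; w
  follows by integrating in time, and its partial derivatives because the exterior region is
  open.\<close>

lemma finite_speed:
  assumes init: "\<And>x. R < norm x \<Longrightarrow> w 0 x = 0 \<and> z 0 x = 0"
    and t: "0 \<le> t" and x: "R + t < norm x"
  shows "w t x = 0" "z t x = 0" "b \<in> Basis \<Longrightarrow> p b t x = 0"
proof -
  have p0: "p b 0 x = 0" if "b \<in> Basis" "R < norm x" for b x
    by (rule has_partial_zero_outside[OF w_x[OF order_refl that(1)] _ that(2)]) (use init in auto)
  have z0: "z s x = 0" if s: "0 \<le> s" and x: "R + s < norm x" for s x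
  proof (rule cone_energy[of s "norm x - R"])
    fix y assume "norm (y - x) < norm x - R"
    then have "R < norm y"
      using norm_triangle_ineq2[of x y] by (simp add: norm_minus_commute)
    then show "z 0 y = 0 \<and> (\<forall>b\<in>Basis. p b 0 y = 0)"
      using init p0 by auto
  qed (use s x in auto)
  show "z t x = 0" by (rule z0[OF t x])
  have w0: "w t x = 0" if x: "R + t < norm x" for x
  proof -
    have "((\<lambda>s. w s x) has_real_derivative 0) (at s within {0..t})" if "s \<in> {0..t}" for s
      using DERIV_subset[OF w_t[of s x], of "{0..t}"] z0[of s x] that x by auto
    then have "\<exists>c. \<forall>s\<in>{0..t}. w s x = c"
      by (intro has_field_derivative_zero_constant) auto
    then have "w t x = w 0 x" using t by auto
    then show ?thesis using init[of x] x t by simp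
  qed
  show "w t x = 0" by (rule w0[OF x])
  show "p b t x = 0" if "b \<in> Basis"
    by (rule has_partial_zero_outside[OF w_x[OF t that] w0 x])
qed

end

section \<open>Weighted energy decay\<close>

lemma two_mult_le_weighted_squares:
  fixes x y c :: real
  assumes "0 < c"
  shows "2 * (x * y) \<le> c * x\<^sup>2 + y\<^sup>2 / c"
proof -
  have "0 \<le> (c * x - y)\<^sup>2 / c" using assms by simp
  also have "\<dots> = c * x\<^sup>2 + y\<^sup>2 / c - 2 * (x * y)"
    using assms by (simp add: power2_eq_square field_simps)
  finally show ?thesis by simp
qed

text \<open>The quadratic form left over after differentiating the weighted energy; here \<open>Z\<close> and \<open>P2\<close> stand
  for \<open>(1 + t) u\<^sub>t\<close> and \<open>(1 + t)\<^sup>2 \<bar>\<nabla>u\<bar>\<^sup>2\<close>.\<close>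

lemma dissipation_nonpos:
  fixes Z y P2 S \<psi> a \<delta> \<mu> n k \<nu> \<delta>' c :: real
  assumes \<delta>: "0 < \<delta>" and mu: "\<mu> = 2 * a * (2 + \<delta>)" and c: "c = n / (2 + \<delta>) + 1 / 2 - k / 2" "0 < c"
    and \<delta>': "\<delta>' = \<delta> / (5 + \<delta>)" and \<nu>: "\<nu> * \<delta>' = (k + 1) / 2" "0 < \<nu>"
    and large: "1 \<le> \<mu>" "\<nu> * (2 + \<delta>) \<le> \<delta>' * \<mu>" "k + 1 + 2 * \<nu> + \<nu> * k\<^sup>2 / (2 * c) \<le> \<mu>"
    and \<psi>: "0 \<le> \<psi>" and P2: "0 \<le> P2" and S: "S\<^sup>2 \<le> 4 * a * \<psi> * P2"
  shows "- 2 * \<psi> * (Z\<^sup>2 + P2) - 4 * \<nu> * \<psi> * y * Z - 2 * \<nu> * \<mu> * \<psi> * y\<^sup>2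
    + (k + 1) / 2 * (Z\<^sup>2 + P2) - \<mu> * Z\<^sup>2 - 2 * Z * S + \<nu> * k * y * Z + \<nu> * Z\<^sup>2
    + \<nu> * \<mu> * (k - 1) / 2 * y\<^sup>2 - \<nu> * (4 * y * S + P2 + 8 * a * \<psi> * y\<^sup>2 + 2 * a * n * y\<^sup>2) \<le> 0"
proof -
  define \<Gamma> where "\<Gamma> = 4 * a * \<psi>"
  have a_eq: "a = \<mu> / (2 * (2 + \<delta>))"
    using mu \<delta> by (simp add: field_simps)
  have a: "0 < a"
    unfolding a_eq using large(1) \<delta> by (intro divide_pos_pos) auto
  have \<Gamma>: "0 \<le> \<Gamma>" "S\<^sup>2 \<le> \<Gamma> * P2"
    using a \<psi> S by (simp_all add: \<Gamma>_def)
  \<comment> \<open>The flux term is paid by the available - 2 \<psi> P2 and by 2 a Z^2, where 2 a =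
    \<mu> / (2 + \<delta>) is at most \<mu> / 2.\<close>
  have A: "- (2 * (Z * S)) \<le> 2 * a * Z\<^sup>2 + 2 * \<psi> * P2"
  proof -
    have "2 * (Z * (- S)) \<le> 2 * a * Z\<^sup>2 + S\<^sup>2 / (2 * a)"
      using two_mult_le_weighted_squares[of "2 * a" Z "- S"] a by simp
    moreover have "S\<^sup>2 / (2 * a) \<le> 2 * \<psi> * P2"
      using S a by (simp add: field_simps)
    ultimately show ?thesis by simp
  qed
  \<comment> \<open>Coercivity from \<delta> > 0: with 4 in place of 4 + \<delta> the form on the
    right would only be nonnegative, by completing the square. The value \<delta>' = \<delta> / (5 +
    \<delta>) makes (1 - \<delta>') (4 + \<delta> - \<delta>') equal to 4 + \<delta>'^2, so the
    discriminant keeps its sign after \<delta>' is subtracted from both coefficients.\<close>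
  have B: "\<delta>' * (P2 + \<Gamma> * y\<^sup>2) \<le> 4 * (y * S) + P2 + (4 + \<delta>) * (\<Gamma> * y\<^sup>2)"
  proof -
    define X Y where "X = (1 - \<delta>') * P2" and "Y = (4 + \<delta> - \<delta>') * (\<Gamma> * y\<^sup>2)"
    have \<delta>'01: "0 < \<delta>'" "\<delta>' < 1"
      using \<delta> by (auto simp: \<delta>')
    have XY: "0 \<le> X" "0 \<le> Y"
      using \<delta>'01 P2 \<Gamma> \<delta> by (auto simp: X_def Y_def)
    have "\<delta>' * (5 + \<delta>) = \<delta>" using \<delta> by (simp add: \<delta>')
    then have "(1 - \<delta>') * (4 + \<delta> - \<delta>') = 4 + \<delta>'\<^sup>2"
      by (simp add: power2_eq_square algebra_simps)
    then have "4 \<le> (1 - \<delta>') * (4 + \<delta> - \<delta>')" by simp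
    then have "4 * (\<Gamma> * P2 * y\<^sup>2) \<le> (1 - \<delta>') * (4 + \<delta> - \<delta>') * (\<Gamma> * P2 * y\<^sup>2)"
      using \<Gamma> P2 by (intro mult_right_mono) auto
    also have "\<dots> = X * Y" by (simp add: X_def Y_def)
    finally have "4 * (S\<^sup>2 * y\<^sup>2) \<le> X * Y"
      using mult_right_mono[OF \<Gamma>(2), of "y\<^sup>2"] by simp
    moreover have "4 * (X * Y) \<le> (X + Y)\<^sup>2"
      using sum_squares_bound[of X Y] by (simp add: power2_sum)
    moreover have "(4 * (y * S))\<^sup>2 = 4 * (4 * (S\<^sup>2 * y\<^sup>2))"
      by (simp add: power_mult_distrib mult_ac)
    ultimately have "(4 * (y * S))\<^sup>2 \<le> (X + Y)\<^sup>2"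
      by linarith
    then have "\<bar>4 * (y * S)\<bar> \<le> X + Y"
      using XY abs_le_square_iff[of "4 * (y * S)" "X + Y"] by simp
    then show ?thesis
      by (simp add: X_def Y_def algebra_simps abs_le_iff)
  qed
  \<comment> \<open>Consumes the term - 2 \<psi> Z^2 and the coercivity of B in y; the second
    comparison is \<nu> \<le> 2 a \<delta>', a lower bound on \<mu>.\<close>
  have C: "- (4 * \<nu> * \<psi> * (y * Z)) \<le> 2 * \<psi> * Z\<^sup>2 + \<nu> * \<delta>' * (\<Gamma> * y\<^sup>2)"
  proof -
    have "2 * (Z * (- (\<nu> * y))) \<le> Z\<^sup>2 + (\<nu> * y)\<^sup>2"
      using two_mult_le_weighted_squares[of 1 Z "- (\<nu> * y)"] by simp
    then have "2 * \<psi> * (2 * (Z * (- (\<nu> * y)))) \<le> 2 * \<psi> * (Z\<^sup>2 + (\<nu> * y)\<^sup>2)"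
      using \<psi> by (intro mult_left_mono) auto
    moreover have "2 * \<psi> * (\<nu> * y)\<^sup>2 \<le> \<nu> * \<delta>' * (\<Gamma> * y\<^sup>2)"
    proof -
      have "\<nu> \<le> \<delta>' * (2 * a)"
        using large(2) \<delta> unfolding mu by (simp add: mult.assoc[symmetric])
      then have "\<nu> * (2 * \<psi> * \<nu> * y\<^sup>2) \<le> (\<delta>' * (2 * a)) * (2 * \<psi> * \<nu> * y\<^sup>2)"
        using \<nu>(2) \<psi> by (intro mult_right_mono) auto
      then show ?thesis
        by (simp add: \<Gamma>_def power2_eq_square mult_ac)
    qed
    ultimately show ?thesis by (simp add: algebra_simps)
  qed
  \<comment> \<open>The y part matches the surplus \<nu> \<mu> c y^2 computed in F; as \<mu> \<ge>
    1, the Z part has a coefficient independent of \<mu>, so a large \<mu> can absorb it in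
    E.\<close>
  have D: "\<nu> * k * (y * Z) \<le> \<nu> * \<mu> * c * y\<^sup>2 + \<nu> * k\<^sup>2 / (4 * c) * Z\<^sup>2"
  proof -
    have "2 * (y * (k * Z / 2)) \<le> (\<mu> * c) * y\<^sup>2 + (k * Z / 2)\<^sup>2 / (\<mu> * c)"
      using large(1) c(2) by (intro two_mult_le_weighted_squares) auto
    also have "(k * Z / 2)\<^sup>2 / (\<mu> * c) \<le> (k * Z / 2)\<^sup>2 / c"
      using large(1) c(2) by (intro divide_left_mono) auto
    finally have "k * (y * Z) \<le> (\<mu> * c) * y\<^sup>2 + k\<^sup>2 / (4 * c) * Z\<^sup>2"
      by (simp add: power_mult_distrib power_divide mult_ac)
    from mult_left_mono[OF this, of \<nu>] \<nu>(2) show ?thesis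
      by (simp add: algebra_simps)
  qed
  have E: "((k + 1) / 2 - \<mu> + 2 * a + \<nu> + \<nu> * k\<^sup>2 / (4 * c)) * Z\<^sup>2 \<le> 0"
  proof -
    have "2 * a \<le> \<mu> / 2"
      unfolding a_eq using large(1) \<delta> by (simp add: field_simps)
    moreover define g where "g = \<nu> * k\<^sup>2 / (4 * c)"
    moreover have "k + 1 + 2 * \<nu> + 2 * g \<le> \<mu>"
      using large(3) by (simp add: g_def)
    ultimately have "(k + 1) / 2 - \<mu> + 2 * a + \<nu> + g \<le> 0"
      by (simp add: field_simps)
    then show ?thesis
      unfolding g_def by (intro mult_nonpos_nonneg) auto
  qed
  \<comment> \<open>The origin of c: the gain n / (2 + \<delta>) from \<Delta>\<psi> minus the loss
    (k - 1) / 2 from the power of time.\<close>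
  have F: "\<nu> * \<mu> * (k - 1) / 2 * y\<^sup>2 - \<nu> * (2 * a * n * y\<^sup>2) = - (\<nu> * \<mu> * c * y\<^sup>2)"
  proof -
    have "2 * a * n = \<mu> * (n / (2 + \<delta>))"
      unfolding a_eq using \<delta> by (simp add: field_simps)
    then show ?thesis
      unfolding c by (simp add: algebra_simps diff_divide_distrib)
  qed
  have G: "2 * \<nu> * \<mu> * \<psi> * y\<^sup>2 + \<nu> * (8 * a * \<psi> * y\<^sup>2) = \<nu> * ((4 + \<delta>) * (\<Gamma> * y\<^sup>2))"
    unfolding mu \<Gamma>_def by (simp add: algebra_simps)
  have "\<nu> * \<delta>' * P2 + \<nu> * \<delta>' * (\<Gamma> * y\<^sup>2) \<le> \<nu> * (4 * (y * S)) + \<nu> * P2 + \<nu> * ((4 + \<delta>) * (\<Gamma> * y\<^sup>2))"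
    using mult_left_mono[OF B, of \<nu>] \<nu>(2) by (simp add: algebra_simps)
  \<comment> \<open>The condition that fixes \<nu>: the coercivity of B in P2 cancels the growth
    coming from the power of time exactly.\<close>
  moreover have "\<nu> * \<delta>' * P2 = (k + 1) / 2 * P2"
    using \<nu>(1) by simp
  ultimately show ?thesis
    using A C D E F G by (simp add: algebra_simps add_divide_distrib diff_divide_distrib)
qed

text \<open>With the common weight removed, the left side is \<tau> times the time derivative of the
  density minus the divergence of the flux. The terms Q and R, which carry the derivatives of second
  order, cancel. The right side is the form in \<open>dissipation_nonpos\<close> with \<tau> z, w,
  \<tau>^2 P and 2 a S in the roles of Z, y, P2 and S.\<close>

lemma weighted_balance_identity:
  fixes \<tau> :: real
  assumes "\<tau> \<noteq> 0"
  shows "\<tau> * (((k - 1 - 4 * \<psi>) / \<tau>) * (\<tau>\<^sup>2 * (z\<^sup>2 + P) / 2 + \<nu> * (\<tau> * w * z + \<mu> / 2 * w\<^sup>2))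
      + (\<tau> * (z\<^sup>2 + P) + \<tau>\<^sup>2 * (z * (Q - \<mu> / \<tau> * z) + R)
        + \<nu> * (w * z + \<tau> * z\<^sup>2 + \<tau> * w * (Q - \<mu> / \<tau> * z) + \<mu> * w * z))
      - (4 * a * z * S + 4 * a * \<nu> * w * S / \<tau> + 8 * \<nu> * a * \<psi> * w\<^sup>2 / \<tau> + \<tau>\<^sup>2 * (R + z * Q)
        + \<nu> * \<tau> * (P + w * Q) + \<nu> * (2 * a * n * w\<^sup>2 / \<tau> + 4 * a * w * S / \<tau>)))
    = - 2 * \<psi> * ((\<tau> * z)\<^sup>2 + \<tau>\<^sup>2 * P) - 4 * \<nu> * \<psi> * w * (\<tau> * z) - 2 * \<nu> * \<mu> * \<psi> * w\<^sup>2
      + (k + 1) / 2 * ((\<tau> * z)\<^sup>2 + \<tau>\<^sup>2 * P) - \<mu> * (\<tau> * z)\<^sup>2 - 2 * (\<tau> * z) * (2 * a * S)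
      + \<nu> * k * w * (\<tau> * z) + \<nu> * (\<tau> * z)\<^sup>2 + \<nu> * \<mu> * (k - 1) / 2 * w\<^sup>2
      - \<nu> * (4 * w * (2 * a * S) + \<tau>\<^sup>2 * P + 8 * a * \<psi> * w\<^sup>2 + 2 * a * n * w\<^sup>2)"
  using assms by (simp add: field_simps power2_eq_square)

lemma energy_density_DERIV:
  fixes w z P :: "real \<Rightarrow> real"
  assumes "(w has_real_derivative w') (at t within S)" "(z has_real_derivative z') (at t within S)"
    "(P has_real_derivative P') (at t within S)"
  shows "((\<lambda>t. (1 + t)\<^sup>2 * ((z t)\<^sup>2 + P t) / 2 + \<nu> * ((1 + t) * w t * z t + \<mu> / 2 * (w t)\<^sup>2))
    has_real_derivative (1 + t) * ((z t)\<^sup>2 + P t) + (1 + t)\<^sup>2 * (z t * z' + P' / 2)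
      + \<nu> * (w t * z t + (1 + t) * w' * z t + (1 + t) * w t * z' + \<mu> * w t * w')) (at t within S)"
  using assms by (auto intro!: derivative_eq_intros simp: field_simps power2_eq_square)

lemma (in classical_damped_wave) weighted_energy_nonincreasing:
  fixes \<delta> k \<nu> c \<delta>' :: real
  defines "a \<equiv> \<mu> / (2 * (2 + \<delta>))"
  defines "E \<equiv> \<lambda>t x. (1 + t)\<^sup>2 * ((z t x)\<^sup>2 + (\<Sum>b\<in>Basis. (p b t x)\<^sup>2)) / 2
    + \<nu> * ((1 + t) * w t x * z t x + \<mu> / 2 * (w t x)\<^sup>2)"
  defines "F \<equiv> \<lambda>t x. exp (2 * weight a t x) * (1 + t) powr (k - 1) * E t x"
  assumes init: "\<And>x. R < norm x \<Longrightarrow> w 0 x = 0 \<and> z 0 x = 0"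
    and \<delta>: "0 < \<delta>" and c: "c = real DIM('a) / (2 + \<delta>) + 1 / 2 - k / 2" "0 < c"
    and \<delta>': "\<delta>' = \<delta> / (5 + \<delta>)" and \<nu>: "\<nu> * \<delta>' = (k + 1) / 2" "0 < \<nu>"
    and large: "1 \<le> \<mu>" "\<nu> * (2 + \<delta>) \<le> \<delta>' * \<mu>" "k + 1 + 2 * \<nu> + \<nu> * k\<^sup>2 / (2 * c) \<le> \<mu>"
    and T: "0 \<le> T"
  shows "(\<integral>x. F T x \<partial>lborel) \<le> (\<integral>x. F 0 x \<partial>lborel)" "0 \<le> t \<Longrightarrow> integrable lborel (F t)"
proof -
  have mu_a: "\<mu> = 2 * a * (2 + \<delta>)"
    using \<delta> by (simp add: a_def field_simps)
  have a: "0 < a"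
    using \<delta> large(1) by (simp add: a_def)
  define \<psi> where "\<psi> t x = weight a t x" for t and x :: 'a
  have \<psi>_eq: "\<psi> t x = a * (norm x)\<^sup>2 / (1 + t)\<^sup>2" for t x
    by (simp add: \<psi>_def weight_def)
  have \<psi>0: "0 \<le> \<psi> t x" for t x
    using a by (simp add: \<psi>_eq)
  define W where "W t x = exp (2 * \<psi> t x) * (1 + t) powr (k - 1)" for t x
  have F_eq: "F t x = W t x * E t x" for t x
    by (simp add: F_def W_def \<psi>_def)
  define zt where "zt t x = (\<Sum>b\<in>Basis. q b t x) - \<mu> / (1 + t) * z t x" for t x
  define E' where "E' t x = (1 + t) * ((z t x)\<^sup>2 + (\<Sum>b\<in>Basis. (p b t x)\<^sup>2))
      + (1 + t)\<^sup>2 * (z t x * zt t x + (\<Sum>b\<in>Basis. p b t x * r b t x))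
      + \<nu> * (w t x * z t x + (1 + t) * (z t x)\<^sup>2 + (1 + t) * w t x * zt t x + \<mu> * w t x * z t x)" for t x
  define F' where "F' t x = W t x * (((k - 1 - 4 * \<psi> t x) / (1 + t)) * E t x + E' t x)" for t x
  define \<psi>b where "\<psi>b b t x = 2 * a * (x \<bullet> b) / (1 + t)\<^sup>2" for b t and x :: 'a
  \<comment> \<open>The first two terms are the natural fluxes of the energy and of \<nu> (1 + t) w
    w_t. The third is added freely, since a divergence integrates to zero: it brings in
    \<Delta>\<psi> w^2 and 2 \<bar>\<nabla>\<psi>\<bar>^2 w^2, the sources of decay for w^2, at the
    price of a further cross term.\<close>
  define K where "K b t x = (1 + t)\<^sup>2 * (z t x * p b t x) + \<nu> * (1 + t) * (w t x * p b t x)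
      + \<nu> * (1 + t) * (\<psi>b b t x * (w t x)\<^sup>2)" for b t x
  define J where "J b t x = W t x * K b t x" for b t x
  define J' where "J' b t x = (W t x * (2 * \<psi>b b t x)) * K b t x
      + W t x * ((1 + t)\<^sup>2 * (r b t x * p b t x + z t x * q b t x)
        + \<nu> * (1 + t) * (p b t x * p b t x + w t x * q b t x)
        + \<nu> * (1 + t) * (2 * a / (1 + t)\<^sup>2 * (w t x)\<^sup>2 + \<psi>b b t x * (2 * w t x * p b t x)))" for b t x
  have Wc: "continuous_on UNIV (W t)" if "0 \<le> t" for t
    unfolding W_def[abs_def] \<psi>_eq using that by (intro continuous_intros) auto
  have \<psi>c: "continuous_on UNIV (\<psi> t)" "continuous_on UNIV (\<psi>b b t)" if "0 \<le> t" for t b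
    unfolding \<psi>_eq[abs_def] \<psi>b_def[abs_def] using that by (intro continuous_intros; auto)+
  note [measurable] = continuous_solution[THEN borel_measurable_continuous_onI]
    borel_measurable_continuous_onI[OF Wc] \<psi>c[THEN borel_measurable_continuous_onI]
  have meas: "F t \<in> borel_measurable borel" "F' t \<in> borel_measurable borel" if "0 \<le> t" for t
    unfolding F_eq[abs_def] F'_def[abs_def] E_def E'_def zt_def using that by measurable
  have vanish: "w t x = 0" "z t x = 0" "b \<in> Basis \<Longrightarrow> p b t x = 0" if "0 \<le> t" "R + t < norm x" for t x b
    using finite_speed[OF init that] by auto
  have zero: "F t x = 0 \<and> F' t x = 0" if "0 \<le> t" "R + t < norm x" for t x
    using vanish[OF that] by (simp add: F_eq F'_def E_def E'_def)
  have bd: "bounded_upto T r F" "bounded_upto T r F'"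
    "b \<in> Basis \<Longrightarrow> bounded_upto T r (J b)" "b \<in> Basis \<Longrightarrow> bounded_upto T r (J' b)" for r b T
  proof -
    have bt: "bounded_upto T r (\<lambda>t x. 1 + t)"
      by (intro bounded_upto_continuous continuous_intros)
    have bi: "bounded_upto T r (\<lambda>t x. inverse (1 + t))"
      by (rule bounded_uptoI[of _ _ _ 1]) (auto simp: inverse_le_1_iff)
    have bx: "bounded_upto T r (\<lambda>t x. x \<bullet> b)" "bounded_upto T r (\<lambda>t x. norm x)" for b
      by (intro bounded_upto_continuous continuous_intros)+
    have b\<psi>: "bounded_upto T r \<psi>" "bounded_upto T r (\<psi>b b)" for b
      unfolding \<psi>_eq[abs_def] \<psi>b_def[abs_def] divide_inverse power_inverse[symmetric]
      by (intro bounded_upto_intros bx bi)+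
    obtain M where M: "\<And>t x. 0 \<le> t \<Longrightarrow> t \<le> T \<Longrightarrow> norm x \<le> r \<Longrightarrow> \<bar>\<psi> t x\<bar> \<le> M"
      using b\<psi>(1) unfolding bounded_upto_def by metis
    have bW: "bounded_upto T r W"
    proof (rule bounded_uptoI[of _ _ _ "exp (2 * M) * (1 + T) powr \<bar>k - 1\<bar>"])
      fix t and x :: 'a assume t: "0 \<le> t" "t \<le> T" and x: "norm x \<le> r"
      have "(1 + t) powr (k - 1) \<le> (1 + t) powr \<bar>k - 1\<bar>"
        using t by (intro powr_mono) auto
      also have "\<dots> \<le> (1 + T) powr \<bar>k - 1\<bar>"
        using t by (intro powr_mono2) auto
      finally show "\<bar>W t x\<bar> \<le> exp (2 * M) * (1 + T) powr \<bar>k - 1\<bar>"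
        using M[OF t x] \<psi>0[of t x] by (auto simp: W_def abs_mult intro!: mult_mono)
    qed
    show "bounded_upto T r F"
      unfolding F_eq[abs_def] E_def divide_inverse
      by (intro bounded_upto_intros bounded_solution bW bt)
    show "bounded_upto T r F'"
      unfolding F'_def[abs_def] E_def E'_def zt_def divide_inverse
      by (intro bounded_upto_intros bounded_solution bW bt bi b\<psi>)
    assume b: "b \<in> Basis"
    show "bounded_upto T r (J b)" "bounded_upto T r (J' b)"
      unfolding J_def[abs_def] J'_def[abs_def] K_def divide_inverse power_inverse[symmetric]
      by (intro bounded_upto_intros bounded_solution bW bt bi b\<psi> b)+
  qed
  show "(\<integral>x. F T x \<partial>lborel) \<le> (\<integral>x. F 0 x \<partial>lborel)"
  proof (rule integral_nonincreasing_of_balance[where r="R + T" and F=F and F'=F' and J=J and J'=J'])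
    fix t :: real and x :: 'a
    assume t: "0 \<le> t"
    have 1: "((\<lambda>t. W t x) has_real_derivative W t x * ((k - 1 - 4 * \<psi> t x) / (1 + t))) (at t within {0..})"
    proof -
      have "((\<lambda>t. \<psi> t x) has_real_derivative - 2 * \<psi> t x / (1 + t)) (at t within {0..})"
      proof -
        have "((\<lambda>t. (1 + t)\<^sup>2) has_real_derivative 2 * (1 + t)) (at t within {0..})"
          by (auto intro!: derivative_eq_intros)
        from DERIV_divide[OF DERIV_const this, of "a * (norm x)\<^sup>2"]
        have d: "((\<lambda>t. a * (norm x)\<^sup>2 / (1 + t)\<^sup>2) has_real_derivative
            (0 * (1 + t)\<^sup>2 - a * (norm x)\<^sup>2 * (2 * (1 + t))) / ((1 + t)\<^sup>2 * (1 + t)\<^sup>2)) (at t within {0..})"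
          using t by simp
        have eq: "(0 * \<tau>\<^sup>2 - A * (2 * \<tau>)) / (\<tau>\<^sup>2 * \<tau>\<^sup>2) = - 2 * (A / \<tau>\<^sup>2) / \<tau>" if "\<tau> \<noteq> 0" for A \<tau> :: real
          using that by (simp add: field_simps power2_eq_square)
        show ?thesis
          unfolding \<psi>_eq by (rule DERIV_cong[OF d eq]) (use t in simp)
      qed
      then have "((\<lambda>t. exp (2 * \<psi> t x)) has_real_derivative exp (2 * \<psi> t x) * (2 * (- 2 * \<psi> t x / (1 + t)))) (at t within {0..})"
        by (auto intro!: derivative_eq_intros)
      moreover have "((\<lambda>t. (1 + t) powr (k - 1)) has_real_derivative (1 + t) powr (k - 1) * ((k - 1) / (1 + t))) (at t within {0..})"
      proof -
        have "((\<lambda>t. 1 + t) has_real_derivative 1) (at t within {0..})"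
          by (auto intro!: derivative_eq_intros)
        from DERIV_chain2[OF has_real_derivative_powr[of "1 + t" "k - 1"] this] show ?thesis
          by (rule DERIV_cong) (use t in \<open>auto simp: powr_diff power2_eq_square\<close>)
      qed
      ultimately show ?thesis
        unfolding W_def by (rule DERIV_cong[OF DERIV_mult])
            (simp add: algebra_simps add_divide_distrib diff_divide_distrib)
    qed
    have 2: "((\<lambda>t. E t x) has_real_derivative E' t x) (at t within {0..})"
    proof -
      note d = w_t[OF t, of x] z_t[OF t, of x, folded zt_def]
      have "((\<lambda>t. \<Sum>b\<in>Basis. (p b t x)\<^sup>2) has_real_derivative (\<Sum>b\<in>Basis. 2 * (p b t x * r b t x))) (at t within {0..})"
        by (intro DERIV_sum) (use p_t[OF t, of _ x] in \<open>auto intro!: derivative_eq_intros\<close>)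
      from energy_density_DERIV[OF d this, of \<nu> \<mu>] show ?thesis
        unfolding E_def E'_def by (rule DERIV_cong) (simp add: sum_distrib_left[symmetric] power2_eq_square mult.assoc)
    qed
    show "((\<lambda>t. F t x) has_real_derivative F' t x) (at t within {0..})"
      unfolding F_eq F'_def using DERIV_mult[OF 1 2] by (simp add: algebra_simps)
  next
    fix t :: real and b :: 'a
    assume t: "0 \<le> t" and b: "b \<in> Basis"
    have p\<psi>: "has_partial b (\<psi> t) (\<psi>b b t)"
      using has_partial_cmult[OF has_partial_norm_power2[of b 0], of "a / (1 + t)\<^sup>2"]
      by (simp add: \<psi>_eq[abs_def] \<psi>b_def[abs_def] mult_ac)
    have 1: "has_partial b (W t) (\<lambda>x. W t x * (2 * \<psi>b b t x))"
    proof -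
      have "has_partial b (\<lambda>x. (1 + t) powr (k - 1) * exp (2 * \<psi> t x))
          (\<lambda>x. (1 + t) powr (k - 1) * (exp (2 * \<psi> t x) * (2 * \<psi>b b t x)))"
        by (intro has_partial_cmult has_partial_chain[of exp exp] has_partial_cmult p\<psi> DERIV_exp)
      then show ?thesis by (simp add: W_def[abs_def] mult_ac)
    qed
    have 2: "has_partial b (\<psi>b b t) (\<lambda>x. 2 * a / (1 + t)\<^sup>2)"
    proof -
      have "((\<lambda>x. (2 * a / (1 + t)\<^sup>2) * (x \<bullet> b)) has_derivative (\<lambda>v. (2 * a / (1 + t)\<^sup>2) * (v \<bullet> b))) (at x)" for x :: 'a
        by (intro bounded_linear_imp_has_derivative bounded_linear_const_mult bounded_linear_inner_left)
      from has_derivative_imp_partial[OF this, of b] b show ?thesis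
        by (simp add: \<psi>b_def[abs_def])
    qed
    have 3: "has_partial b (\<lambda>x. (w t x)\<^sup>2) (\<lambda>x. 2 * w t x * p b t x)"
      using has_partial_mult[OF w_x[OF t b] w_x[OF t b]] by (simp add: power2_eq_square mult_ac)
    have 4: "has_partial b (K b t) (\<lambda>x. (1 + t)\<^sup>2 * (r b t x * p b t x + z t x * q b t x)
        + \<nu> * (1 + t) * (p b t x * p b t x + w t x * q b t x)
        + \<nu> * (1 + t) * (2 * a / (1 + t)\<^sup>2 * (w t x)\<^sup>2 + \<psi>b b t x * (2 * w t x * p b t x)))"
      unfolding K_def[abs_def]
      by (intro has_partial_add has_partial_cmult has_partial_mult z_x p_x w_x 2 3 t b)
    show "has_partial b (J b t) (J' b t)"
      unfolding J_def[abs_def] J'_def[abs_def] by (rule has_partial_mult[OF 1 4])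
    show "J b t \<in> borel_measurable borel" "J' b t \<in> borel_measurable borel"
      unfolding J_def[abs_def] J'_def[abs_def] K_def using t b by measurable
  next
    fix t x
    assume t: "0 \<le> t" "t \<le> T"
    define \<tau> where "\<tau> = 1 + t"
    have \<tau>: "0 < \<tau>" using t by (simp add: \<tau>_def)
    define P Q R' S where "P = (\<Sum>b\<in>Basis. (p b t x)\<^sup>2)" and "Q = (\<Sum>b\<in>Basis. q b t x)"
      and "R' = (\<Sum>b\<in>Basis. p b t x * r b t x)" and "S = (\<Sum>b\<in>Basis. (x \<bullet> b) * p b t x)"
    define y where "y = w t x"
    define A where "A = ((k - 1 - 4 * \<psi> t x) / \<tau>) * (\<tau>\<^sup>2 * ((z t x)\<^sup>2 + P) / 2 + \<nu> * (\<tau> * y * z t x + \<mu> / 2 * y\<^sup>2))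
      + (\<tau> * ((z t x)\<^sup>2 + P) + \<tau>\<^sup>2 * (z t x * (Q - \<mu> / \<tau> * z t x) + R')
        + \<nu> * (y * z t x + \<tau> * (z t x)\<^sup>2 + \<tau> * y * (Q - \<mu> / \<tau> * z t x) + \<mu> * y * z t x))"
    define B where "B = 4 * a * z t x * S + 4 * a * \<nu> * y * S / \<tau> + 8 * \<nu> * a * \<psi> t x * y\<^sup>2 / \<tau> + \<tau>\<^sup>2 * (R' + z t x * Q)
        + \<nu> * \<tau> * (P + y * Q) + \<nu> * (2 * a * real DIM('a) * y\<^sup>2 / \<tau> + 4 * a * y * S / \<tau>)"
    have FA: "F' t x = W t x * A"
      by (simp add: F'_def E_def E'_def zt_def A_def \<tau>_def P_def Q_def R'_def y_def)
    have "(\<Sum>b\<in>Basis. J' b t x) = W t x * (\<Sum>b\<in>Basis.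
        4 * a * z t x * ((x \<bullet> b) * p b t x) + 4 * a * \<nu> * y / \<tau> * ((x \<bullet> b) * p b t x)
        + 8 * \<nu> * a * (a / \<tau>\<^sup>2) * y\<^sup>2 / \<tau> * (x \<bullet> b)\<^sup>2 + \<tau>\<^sup>2 * (p b t x * r b t x + z t x * q b t x)
        + \<nu> * \<tau> * ((p b t x)\<^sup>2 + y * q b t x) + (\<nu> * (2 * a * y\<^sup>2 / \<tau>) + \<nu> * 4 * a * y / \<tau> * ((x \<bullet> b) * p b t x)))"
      unfolding sum_distrib_left
      by (intro sum.cong refl) (use \<tau> in \<open>simp add: J'_def K_def \<psi>b_def \<tau>_def[symmetric] y_def[symmetric] field_simps power2_eq_square\<close>)
    also have "\<dots> = W t x * B"
      by (simp only: sum.distrib sum_distrib_left[symmetric] sum_constant P_def[symmetric] Q_def[symmetric]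
          R'_def[symmetric] S_def[symmetric]
          norm_power2_Basis[symmetric]) (simp add: B_def \<psi>_eq \<tau>_def[symmetric] algebra_simps)
    finally have JB: "(\<Sum>b\<in>Basis. J' b t x) = W t x * B" .
    have "\<tau> * (A - B) \<le> 0"
    proof -
      \<comment> \<open>\<open>2 * a * S\<close> is \<tau>^2 \<nabla>\<psi> \<bullet> \<nabla>w, and
        \<bar>\<nabla>\<psi>\<bar>^2 = 4 a \<psi> / \<tau>^2; Cauchy-Schwarz then has the form that
        \<open>dissipation_nonpos\<close> expects.\<close>
      have "S\<^sup>2 \<le> (norm x)\<^sup>2 * P"
        unfolding S_def P_def by (rule inner_Basis_sum_power2_le)
      then have "(2 * a)\<^sup>2 * S\<^sup>2 \<le> (2 * a)\<^sup>2 * ((norm x)\<^sup>2 * P)"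
        by (rule mult_left_mono) simp
      also have "\<dots> = 4 * a * \<psi> t x * (\<tau>\<^sup>2 * P)"
        using \<tau> by (simp add: \<psi>_eq \<tau>_def[symmetric] power2_eq_square)
      finally have S: "(2 * a * S)\<^sup>2 \<le> 4 * a * \<psi> t x * (\<tau>\<^sup>2 * P)"
        by (simp add: power_mult_distrib)
      have P: "0 \<le> \<tau>\<^sup>2 * P"
        by (simp add: P_def sum_nonneg)
      show ?thesis
        unfolding A_def B_def weighted_balance_identity[OF \<tau>[THEN less_imp_neq, symmetric]]
        by (rule dissipation_nonpos[OF \<delta> mu_a c \<delta>' \<nu> large \<psi>0 P S])
    qed
    then have "A \<le> B"
      using \<tau> by (simp add: mult_le_0_iff)
    then show "F' t x \<le> (\<Sum>b\<in>Basis. J' b t x)"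
      unfolding FA JB by (intro mult_left_mono) (auto simp: W_def)
  next
    fix t and x b :: 'a assume "0 \<le> t" "t \<le> T" "R + T < norm x"
    then have "0 \<le> t" "R + t < norm x" by auto
    then show "F t x = 0 \<and> F' t x = 0" "b \<in> Basis \<Longrightarrow> J b t x = 0"
      using zero vanish by (auto simp: J_def K_def)
  qed (use T meas bd in auto)
  assume t: "0 \<le> t"
  obtain M where M: "\<And>x. norm x \<le> R + t \<Longrightarrow> \<bar>F t x\<bar> \<le> M"
    using bd(1)[of t "R + t"] t unfolding bounded_upto_def by (metis order_refl)
  have "\<bar>F t x\<bar> \<le> max 0 M" for x
    using M[of x] zero[OF t, of x] by (cases "R + t < norm x") auto
  then show "integrable lborel (F t)"
    using meas(1)[OF t] zero[OF t] by (intro integrable_bounded_support[where B="max 0 M" and r="R + t"]) auto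
qed

text \<open>For 4 \<nu> \<le> \<mu> the cross term \<nu> (1 + t) w w_t costs at most half of the two
  squares, so the monotone functional bounds w^2, z^2 and each \<open>p b\<close> separately.
  Dividing by the powers of 1 + t gives the rates. \<open>M\<close> contains the data only through
  their norms, so it does not deteriorate with the mollification.\<close>

lemma (in classical_damped_wave) weighted_decay:
  fixes \<delta> k \<nu> c \<delta>' :: real
  defines "a \<equiv> \<mu> / (2 * (2 + \<delta>))"
  assumes init: "\<And>x. R < norm x \<Longrightarrow> w 0 x = 0 \<and> z 0 x = 0" and R: "0 \<le> R"
    and \<delta>: "0 < \<delta>" and c: "c = real DIM('a) / (2 + \<delta>) + 1 / 2 - k / 2" "0 < c"
    and \<delta>': "\<delta>' = \<delta> / (5 + \<delta>)" and \<nu>: "\<nu> * \<delta>' = (k + 1) / 2" "0 < \<nu>"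
    and large: "1 \<le> \<mu>" "\<nu> * (2 + \<delta>) \<le> \<delta>' * \<mu>" "k + 1 + 2 * \<nu> + \<nu> * k\<^sup>2 / (2 * c) \<le> \<mu>" "4 * \<nu> \<le> \<mu>"
    and t: "0 \<le> t"
    and D: "(L2_norm (w 0))\<^sup>2 + (L2_norm (z 0))\<^sup>2 + (\<Sum>b\<in>Basis. (L2_norm (p b 0))\<^sup>2) \<le> D"
  defines "M \<equiv> exp (2 * a * R\<^sup>2) * (1 + \<nu> + \<nu> * \<mu>) * D"
  shows "(\<integral>\<^sup>+x. ennreal (exp (2 * weight a t x) * (w t x)\<^sup>2) \<partial>lborel)
      \<le> ennreal (4 / (\<nu> * \<mu>) * (1 + t) powr (1 - k) * M)"
    "(\<integral>\<^sup>+x. ennreal (exp (2 * weight a t x) * (z t x)\<^sup>2) \<partial>lborel) \<le> ennreal (4 * (1 + t) powr (- 1 - k) * M)"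
    "b \<in> Basis \<Longrightarrow> (\<integral>\<^sup>+x. ennreal (exp (2 * weight a t x) * (p b t x)\<^sup>2) \<partial>lborel)
      \<le> ennreal (4 * (1 + t) powr (- 1 - k) * M)"
proof -
  define P where "P t x = (\<Sum>b\<in>Basis. (p b t x)\<^sup>2)" for t x
  define E where "E t x = (1 + t)\<^sup>2 * ((z t x)\<^sup>2 + P t x) / 2
    + \<nu> * ((1 + t) * w t x * z t x + \<mu> / 2 * (w t x)\<^sup>2)" for t x
  define F where "F t x = exp (2 * weight a t x) * (1 + t) powr (k - 1) * E t x" for t x
  have a: "0 < a"
    using \<delta> large(1) by (simp add: a_def)
  have P0: "0 \<le> P t x" for t x
    by (simp add: P_def sum_nonneg)
  have FT: "(\<integral>x. F t x \<partial>lborel) \<le> (\<integral>x. F 0 x \<partial>lborel)"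
    unfolding F_def E_def P_def a_def
    by (rule weighted_energy_nonincreasing(1)[where R=R and c=c and \<delta>'=\<delta>']) (fact init \<delta> c \<delta>' \<nu> large t)+
  have Fi: "integrable lborel (F s)" if "0 \<le> s" for s
    unfolding F_def[abs_def] E_def P_def a_def
    by (rule weighted_energy_nonincreasing(2)[where R=R and c=c and \<delta>'=\<delta>' and T=t])
      (fact init \<delta> c \<delta>' \<nu> large t that)+
  have E_lower: "(1 + t)\<^sup>2 * (z t x)\<^sup>2 / 4 + (1 + t)\<^sup>2 * P t x / 4 + \<nu> * \<mu> / 4 * (w t x)\<^sup>2 \<le> E t x" for t x
  proof -
    have "- (2 * (((1 + t) * z t x / 2) * (\<nu> * w t x))) \<le> ((1 + t) * z t x / 2)\<^sup>2 + (\<nu> * w t x)\<^sup>2"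
      using two_mult_le_weighted_squares[of 1 "(1 + t) * z t x / 2" "- (\<nu> * w t x)"] by simp
    moreover have "\<nu> * (4 * \<nu>) * (w t x)\<^sup>2 \<le> \<nu> * \<mu> * (w t x)\<^sup>2"
      using large(4) \<nu>(2) by (intro mult_right_mono mult_left_mono) auto
    moreover have "0 \<le> (1 + t)\<^sup>2 * P t x"
      using P0 by simp
    ultimately show ?thesis
      by (simp add: E_def power_mult_distrib power_divide algebra_simps add_divide_distrib power2_eq_square)
  qed
  have p_le: "(p b t x)\<^sup>2 \<le> P t x" if "b \<in> Basis" for b t x
    unfolding P_def using that by (intro member_le_sum) auto
  have F0_le: "(\<integral>x. F 0 x \<partial>lborel) \<le> M"
  proof -
    have p0: "p b 0 x = 0" if "b \<in> Basis" "R < norm x" for b x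
      by (rule has_partial_zero_outside[OF w_x[OF order_refl that(1)] _ that(2)]) (use init in auto)
    have K: "kernel R (w 0)" "kernel R (z 0)" "b \<in> Basis \<Longrightarrow> kernel R (p b 0)" for b
      using init p0 continuous_solution[OF order_refl] by (auto simp: kernel_def)
    note L = K[THEN kernel_L2(1), unfolded L2_real_iff, THEN conjunct2]
    let ?S = "\<lambda>x. (w 0 x)\<^sup>2 + (z 0 x)\<^sup>2 + P 0 x"
    have Si: "integrable lborel ?S"
      unfolding P_def using L by auto
    have "(\<integral>x. ?S x \<partial>lborel) = (L2_norm (w 0))\<^sup>2 + (L2_norm (z 0))\<^sup>2 + (\<Sum>b\<in>Basis. (L2_norm (p b 0))\<^sup>2)"
      unfolding P_def using L by (simp add: L2_norm_power2)
    then have SD: "(\<integral>x. ?S x \<partial>lborel) \<le> D" using D by simp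
    have "F 0 x \<le> (exp (2 * a * R\<^sup>2) * (1 + \<nu> + \<nu> * \<mu>)) * ?S x" for x
    proof (cases "R < norm x")
      case True
      then have "F 0 x = 0" "?S x = 0"
        using init[OF True] p0 by (auto simp: F_def E_def P_def)
      then show ?thesis by simp
    next
      case False
      have "E 0 x \<le> (1 + \<nu> + \<nu> * \<mu>) * ?S x"
      proof -
        have "\<nu> * (2 * (w 0 x * z 0 x)) \<le> \<nu> * ((w 0 x)\<^sup>2 + (z 0 x)\<^sup>2)"
          using two_mult_le_weighted_squares[of 1 "w 0 x" "z 0 x"] \<nu>(2) by (intro mult_left_mono) auto
        moreover have "0 \<le> \<nu> * \<mu> * (w 0 x)\<^sup>2" "0 \<le> \<nu> * \<mu> * (z 0 x)\<^sup>2" "0 \<le> \<nu> * \<mu> * P 0 x" "0 \<le> \<nu> * P 0 x"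
          "0 \<le> \<nu> * (w 0 x)\<^sup>2" "0 \<le> \<nu> * (z 0 x)\<^sup>2"
          using \<nu>(2) large(1) P0 by (auto intro!: mult_nonneg_nonneg)
        moreover have "0 \<le> (w 0 x)\<^sup>2" "0 \<le> (z 0 x)\<^sup>2" "0 \<le> P 0 x"
          using P0 by auto
        ultimately show ?thesis
          by (simp add: E_def algebra_simps add_divide_distrib)
            (use zero_le_power2[of "w 0 x"] zero_le_power2[of "z 0 x"] in linarith)
      qed
      moreover have "exp (2 * weight a 0 x) \<le> exp (2 * a * R\<^sup>2)"
        using False a by (auto simp: weight_def intro!: power_mono)
      moreover have "0 \<le> E 0 x"
        using E_lower[of 0 x] P0[of 0 x] \<nu>(2) large(1)
        by (intro order_trans[OF _ E_lower]) (auto intro!: add_nonneg_nonneg mult_nonneg_nonneg)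
      ultimately have "exp (2 * weight a 0 x) * E 0 x \<le> exp (2 * a * R\<^sup>2) * ((1 + \<nu> + \<nu> * \<mu>) * ?S x)"
        by (intro mult_mono) auto
      then show ?thesis by (simp add: F_def mult.assoc)
    qed
    then have "(\<integral>x. F 0 x \<partial>lborel) \<le> (\<integral>x. (exp (2 * a * R\<^sup>2) * (1 + \<nu> + \<nu> * \<mu>)) * ?S x \<partial>lborel)"
      using Fi[of 0] Si by (intro integral_mono) auto
    also have "\<dots> = (exp (2 * a * R\<^sup>2) * (1 + \<nu> + \<nu> * \<mu>)) * (\<integral>x. ?S x \<partial>lborel)"
      by simp
    also have "\<dots> \<le> M"
      unfolding M_def using SD \<nu>(2) large(1) by (intro mult_left_mono) auto
    finally show ?thesis .
  qed
  \<comment> \<open>The exponent m makes m + k - 1 equal to 0 for w^2 and to -2 for the energy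
    terms, against the powers of 1 + t inside E.\<close>
  have decay: "(\<integral>\<^sup>+x. ennreal (exp (2 * weight a t x) * f x) \<partial>lborel) \<le> ennreal (\<kappa> * (1 + t) powr m * M)"
    if \<kappa>: "0 \<le> \<kappa>" and f: "\<And>x. f x \<le> \<kappa> * ((1 + t) powr m * (1 + t) powr (k - 1)) * E t x" for \<kappa> m f
  proof -
    have F0: "0 \<le> F t x" for x
    proof -
      have "0 \<le> E t x"
        using P0[of t x] \<nu>(2) large(1)
        by (intro order_trans[OF _ E_lower]) (auto intro!: add_nonneg_nonneg mult_nonneg_nonneg)
      then show ?thesis by (simp add: F_def)
    qed
    have "exp (2 * weight a t x) * f x \<le> \<kappa> * (1 + t) powr m * F t x" for x
      using mult_left_mono[OF f, of "exp (2 * weight a t x)" x] by (simp add: F_def mult_ac)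
    then have "(\<integral>\<^sup>+x. ennreal (exp (2 * weight a t x) * f x) \<partial>lborel) \<le> (\<integral>\<^sup>+x. ennreal (\<kappa> * (1 + t) powr m * F t x) \<partial>lborel)"
      by (intro nn_integral_mono ennreal_leI)
    also have "\<dots> = ennreal (\<integral>x. \<kappa> * (1 + t) powr m * F t x \<partial>lborel)"
      using Fi[OF t] F0 \<kappa> by (intro nn_integral_eq_integral) auto
    also have "\<dots> \<le> ennreal (\<kappa> * (1 + t) powr m * M)"
      using FT F0_le \<kappa> by (intro ennreal_leI) (auto intro!: mult_left_mono)
    finally show ?thesis .
  qed
  have \<tau>: "(1 + t) powr (1 - k) * (1 + t) powr (k - 1) = 1"
    "(1 + t) powr (- 1 - k) * (1 + t) powr (k - 1) = inverse ((1 + t)\<^sup>2)"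
    using t by (auto simp: powr_add[symmetric] powr_minus powr_numeral)
  have E_parts: "\<nu> * \<mu> / 4 * (w t x)\<^sup>2 \<le> E t x" (is "?a \<le> _") "(1 + t)\<^sup>2 * (z t x)\<^sup>2 / 4 \<le> E t x" (is "?b \<le> _")
    "(1 + t)\<^sup>2 * P t x / 4 \<le> E t x" (is "?c \<le> _") for x
  proof -
    have "0 \<le> ?a" "0 \<le> ?b" "0 \<le> ?c"
      using P0 \<nu>(2) large(1) by (auto intro!: mult_nonneg_nonneg)
    then show "?a \<le> E t x" "?b \<le> E t x" "?c \<le> E t x"
      using E_lower[of t x] by linarith+
  qed
  show "(\<integral>\<^sup>+x. ennreal (exp (2 * weight a t x) * (w t x)\<^sup>2) \<partial>lborel)
      \<le> ennreal (4 / (\<nu> * \<mu>) * (1 + t) powr (1 - k) * M)"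
    using E_parts(1) \<nu>(2) large(1) by (intro decay) (auto simp: \<tau> field_simps)
  have \<tau>2: "0 < (1 + t)\<^sup>2" using t by simp
  show "(\<integral>\<^sup>+x. ennreal (exp (2 * weight a t x) * (z t x)\<^sup>2) \<partial>lborel) \<le> ennreal (4 * (1 + t) powr (- 1 - k) * M)"
  proof (rule decay)
    show "(z t x)\<^sup>2 \<le> 4 * ((1 + t) powr (- 1 - k) * (1 + t) powr (k - 1)) * E t x" for x
      unfolding \<tau>(2) using E_parts(2)[of x] \<tau>2 by (simp add: inverse_eq_divide pos_le_divide_eq mult.commute)
  qed simp
  assume b: "b \<in> Basis"
  show "(\<integral>\<^sup>+x. ennreal (exp (2 * weight a t x) * (p b t x)\<^sup>2) \<partial>lborel) \<le> ennreal (4 * (1 + t) powr (- 1 - k) * M)"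
  proof (rule decay)
    fix x
    have "(1 + t)\<^sup>2 * (p b t x)\<^sup>2 / 4 \<le> (1 + t)\<^sup>2 * P t x / 4"
      using p_le[OF b] by (intro divide_right_mono mult_left_mono) auto
    then have "(1 + t)\<^sup>2 * (p b t x)\<^sup>2 / 4 \<le> E t x"
      using E_parts(3) order_trans by blast
    then show "(p b t x)\<^sup>2 \<le> 4 * ((1 + t) powr (- 1 - k) * (1 + t) powr (k - 1)) * E t x"
      unfolding \<tau>(2) using \<tau>2 by (simp add: inverse_eq_divide pos_le_divide_eq mult.commute)
  qed simp
qed

section \<open>Return to energy solutions\<close>

text \<open>The weak gradient of u has no time derivative in L^2. The one required for
  \<open>p b\<close> is obtained by moving the space derivative to the mollifier, where only u
  itself is differentiated in time.\<close>

lemma mollified_classical_damped_wave: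
  fixes u v :: "real \<Rightarrow> 'a::euclidean_space \<Rightarrow> real"
  assumes E: "energy_class u v" and S: "solves_damped_wave \<mu> u v" and m: "mollifier e \<rho>" and mu: "0 \<le> \<mu>"
  shows "classical_damped_wave \<mu> (\<lambda>t. conv \<rho> (u t)) (\<lambda>t. conv \<rho> (v t))
    (\<lambda>b t. conv \<rho> (\<lambda>y. weak_gradient (u t) y \<bullet> b))
    (\<lambda>b t. conv (partial \<rho> b) (\<lambda>y. weak_gradient (u t) y \<bullet> b))
    (\<lambda>b t. conv (partial \<rho> b) (v t))"
proof
  note k = mollifierD(1)[OF m] and kD = mollifier_partial(2)[OF m] and pD = mollifier_partial(1)[OF m]
  note c = energy_class_L2_continuous[OF E]
  have L: "u t \<in> L2_space" "v t \<in> L2_space" "b \<in> Basis \<Longrightarrow> (\<lambda>y. weak_gradient (u t) y \<bullet> b) \<in> L2_space"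
    if "0 \<le> t" for t b
    using c that by (auto simp: L2_continuous_def)
  note l = L[THEN L2_locally_integrable]
  have eq: "conv (partial \<rho> b) (u t) x = conv \<rho> (\<lambda>y. weak_gradient (u t) y \<bullet> b) x"
    if "0 \<le> t" "b \<in> Basis" for t b x
    using E that by (intro conv_partial_eq_conv_weak_gradient[OF m] H1_weak_gradient) (auto simp: energy_class_def)
  have bdd: "bounded_upto T R (\<lambda>t. conv \<kappa> (f t))" if f: "L2_continuous f" and \<kappa>: "kernel e \<kappa>" for f and \<kappa> :: "'a \<Rightarrow> real" and T R
  proof -
    obtain B where B: "0 \<le> B" "\<And>t. 0 \<le> t \<Longrightarrow> t \<le> T \<Longrightarrow> L2_norm (f t) \<le> B"
      using L2_continuous_norm_bounded[OF f] by blast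
    show ?thesis
    proof (rule bounded_uptoI)
      fix t and x :: 'a assume t: "0 \<le> t" "t \<le> T"
      have "\<bar>conv \<kappa> (f t) x\<bar> \<le> L2_norm \<kappa> * L2_norm (f t)"
        using f \<kappa> t by (intro abs_conv_le) (auto simp: L2_continuous_def)
      also have "\<dots> \<le> L2_norm \<kappa> * B"
        using B t by (intro mult_left_mono) auto
      finally show "\<bar>conv \<kappa> (f t) x\<bar> \<le> L2_norm \<kappa> * B" .
    qed
  qed
  show "0 \<le> \<mu>" by fact
  fix t :: real and x b :: 'a
  show "0 \<le> t \<Longrightarrow> ((\<lambda>t. conv \<rho> (u t) x) has_real_derivative conv \<rho> (v t) x) (at t within {0..})"
    by (rule energy_class_conv_derivative[OF E k])
  show "0 \<le> t \<Longrightarrow> ((\<lambda>t. conv \<rho> (v t) x) has_real_derivative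
      (\<Sum>b\<in>Basis. conv (partial \<rho> b) (\<lambda>y. weak_gradient (u t) y \<bullet> b) x)
      - \<mu> / (1 + t) * conv \<rho> (v t) x) (at t within {0..})"
    by (rule conv_damped_wave[OF E S m])
  show "((\<lambda>t. conv \<rho> (\<lambda>y. weak_gradient (u t) y \<bullet> b) x) has_real_derivative
      conv (partial \<rho> b) (v t) x) (at t within {0..})" if t: "0 \<le> t" and b: "b \<in> Basis"
    by (rule has_field_derivative_transform_within[OF energy_class_conv_derivative[OF E kD t], of 1])
      (use t b eq in auto)
  show "has_partial b (conv \<rho> (u t)) (conv \<rho> (\<lambda>y. weak_gradient (u t) y \<bullet> b))" if "0 \<le> t" "b \<in> Basis"
  proof -
    have "conv (partial \<rho> b) (u t) = conv \<rho> (\<lambda>y. weak_gradient (u t) y \<bullet> b)"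
      by (intro ext eq that)
    then show ?thesis
      using conv_has_partial[OF k kD[of b] pD[of b] l(1)[OF that(1)]] by simp
  qed
  show "has_partial b (conv \<rho> (v t)) (conv (partial \<rho> b) (v t))"
    "has_partial b (conv \<rho> (\<lambda>y. weak_gradient (u t) y \<bullet> b))
      (conv (partial \<rho> b) (\<lambda>y. weak_gradient (u t) y \<bullet> b))"
    if "0 \<le> t" "b \<in> Basis"
    by (intro conv_has_partial[OF k kD pD] l that)+
  show "0 \<le> t \<Longrightarrow> continuous_on UNIV (conv \<rho> (u t))" "0 \<le> t \<Longrightarrow> continuous_on UNIV (conv \<rho> (v t))"
    by (intro conv_continuous[OF k] l; assumption)+
  show "continuous_on UNIV (conv \<rho> (\<lambda>y. weak_gradient (u t) y \<bullet> b))"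
    "continuous_on UNIV (conv (partial \<rho> b) (\<lambda>y. weak_gradient (u t) y \<bullet> b))"
    "continuous_on UNIV (conv (partial \<rho> b) (v t))" if "0 \<le> t" "b \<in> Basis"
    by (intro conv_continuous[OF k] conv_continuous[OF kD] l that)+
  fix T R :: real
  show "bounded_upto T R (\<lambda>t. conv \<rho> (u t))" "bounded_upto T R (\<lambda>t. conv \<rho> (v t))"
    by (intro bdd c k)+
  show "bounded_upto T R (\<lambda>t. conv \<rho> (\<lambda>y. weak_gradient (u t) y \<bullet> b))"
    "bounded_upto T R (\<lambda>t. conv (partial \<rho> b) (\<lambda>y. weak_gradient (u t) y \<bullet> b))"
    "bounded_upto T R (\<lambda>t. conv (partial \<rho> b) (v t))" if "b \<in> Basis"
    by (rule bdd; intro c k kD that)+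
qed

text \<open>Almost equal functions have the same set of weak gradients, so the choice operator
  returns literally the same representative.\<close>

lemma weak_gradient_cong_AE:
  fixes f f' :: "'a::euclidean_space \<Rightarrow> real"
  assumes f: "f \<in> L2_space" "f' \<in> L2_space" and eq: "AE x in lborel. f x = f' x"
  shows "weak_gradient f = weak_gradient f'"
proof -
  note [measurable] = L2_space_measurable[OF f(1)] L2_space_measurable[OF f(2)]
  have "has_weak_gradient f g \<longleftrightarrow> has_weak_gradient f' g" for g
  proof -
    have "(\<integral>x. f x * frechet_derivative \<phi> (at x) b \<partial>lborel) = (\<integral>x. f' x * frechet_derivative \<phi> (at x) b \<partial>lborel)"
      if \<phi>: "\<phi> \<in> test_functions UNIV" for \<phi> and b :: 'a
    proof -
      obtain r where "kernel r (partial \<phi> b)"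
        using test_function_kernel[OF \<phi>] by blast
      note [measurable] = kernel_measurable[OF this]
      show ?thesis
        using eq by (intro integral_cong_AE) auto
    qed
    then show ?thesis
      using f[THEN L2_locally_integrable] by (auto simp: has_weak_gradient_def)
  qed
  then have "has_weak_gradient f = has_weak_gradient f'" by (intro ext)
  then show ?thesis by (simp add: weak_gradient_def)
qed

lemma L2_norm_power2_components:
  fixes G :: "'a::euclidean_space \<Rightarrow> 'a"
  assumes "G \<in> L2_space"
  shows "(\<Sum>b\<in>Basis. (L2_norm (\<lambda>x. G x \<bullet> b))\<^sup>2) = (L2_norm G)\<^sup>2"
proof -
  have "integrable lborel (\<lambda>x. (G x \<bullet> b)\<^sup>2)" if "b \<in> Basis" for b
    using L2_space_component(1)[OF assms that] by (simp add: L2_real_iff)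
  then have "(\<Sum>b\<in>Basis. (L2_norm (\<lambda>x. G x \<bullet> b))\<^sup>2) = (\<integral>x. (\<Sum>b\<in>Basis. (G x \<bullet> b)\<^sup>2) \<partial>lborel)"
    by (simp add: L2_norm_power2)
  then show ?thesis by (simp add: L2_norm_power2 norm_power2_Basis[symmetric])
qed

text \<open>The right side depends neither on \<rho> nor on its radius; this is why the decay
  constants survive the limit.\<close>

lemma mollified_data_bound:
  fixes u v :: "real \<Rightarrow> 'a::euclidean_space \<Rightarrow> real"
  assumes sol: "energy_solution \<mu> u0 u1 u v" and u0: "u0 \<in> H1_space" and u1: "u1 \<in> L2_space"
    and m: "mollifier e \<rho>"
  shows "(L2_norm (conv \<rho> (u 0)))\<^sup>2 + (L2_norm (conv \<rho> (v 0)))\<^sup>2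
    + (\<Sum>b\<in>Basis. (L2_norm (conv \<rho> (\<lambda>y. weak_gradient (u 0) y \<bullet> b)))\<^sup>2) \<le> (data_norm u0 u1)\<^sup>2"
proof -
  have H: "u 0 \<in> H1_space" "u 0 \<in> L2_space" "v 0 \<in> L2_space" "u0 \<in> L2_space"
    and AE: "AE x in lborel. u 0 x = u0 x" "AE x in lborel. v 0 x = u1 x"
    using sol u0 by (auto simp: energy_solution_def energy_class_def H1_space_def)
  note meas = H(2-4)[THEN L2_space_measurable] L2_space_measurable[OF u1]
  have wg: "weak_gradient (u 0) = weak_gradient u0"
    by (rule weak_gradient_cong_AE[OF H(2,4) AE(1)])
  have G: "weak_gradient (u 0) \<in> L2_space"
    by (rule H1_weak_gradient[OF H(1)])
  have "(L2_norm (conv \<rho> (u 0)))\<^sup>2 \<le> (L2_norm u0)\<^sup>2"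
    using conv_mollifier_L2(2)[OF m H(2)] L2_norm_cong_AE[OF _ _ AE(1)] meas
    by (intro power_mono) auto
  moreover have "(L2_norm (conv \<rho> (v 0)))\<^sup>2 \<le> (L2_norm u1)\<^sup>2"
    using conv_mollifier_L2(2)[OF m H(3)] L2_norm_cong_AE[OF _ _ AE(2)] meas
    by (intro power_mono) auto
  moreover have "(\<Sum>b\<in>Basis. (L2_norm (conv \<rho> (\<lambda>y. weak_gradient (u 0) y \<bullet> b)))\<^sup>2)
      \<le> (\<Sum>b\<in>Basis. (L2_norm (\<lambda>y. weak_gradient (u 0) y \<bullet> b))\<^sup>2)"
    by (intro sum_mono power_mono conv_mollifier_L2(2)[OF m] L2_space_component(1)[OF G]) auto
  moreover have "(\<Sum>b\<in>Basis. (L2_norm (\<lambda>y. weak_gradient (u 0) y \<bullet> b))\<^sup>2) = (L2_norm (weak_gradient u0))\<^sup>2"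
    using L2_norm_power2_components[OF G] wg by simp
  moreover have "(data_norm u0 u1)\<^sup>2 = (L2_norm u0)\<^sup>2 + (L2_norm (weak_gradient u0))\<^sup>2 + (L2_norm u1)\<^sup>2"
    by (simp add: data_norm_def H1_norm_def)
  ultimately show ?thesis by linarith
qed

lemma energy_solution_weighted_decay:
  fixes u v :: "real \<Rightarrow> 'a::euclidean_space \<Rightarrow> real" and \<mu> \<delta> k \<nu> c \<delta>' R :: real
    and u0 u1 :: "'a \<Rightarrow> real"
  defines "a \<equiv> \<mu> / (2 * (2 + \<delta>))"
  assumes sol: "energy_solution \<mu> u0 u1 u v" and u0: "u0 \<in> H1_space" and u1: "u1 \<in> L2_space"
    and supp: "supported_in K u0" "supported_in K u1" "K \<subseteq> cball 0 R" "0 \<le> R"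
    and \<delta>: "0 < \<delta>" and c: "c = real DIM('a) / (2 + \<delta>) + 1 / 2 - k / 2" "0 < c"
    and \<delta>': "\<delta>' = \<delta> / (5 + \<delta>)" and \<nu>: "\<nu> * \<delta>' = (k + 1) / 2" "0 < \<nu>"
    and large: "1 \<le> \<mu>" "\<nu> * (2 + \<delta>) \<le> \<delta>' * \<mu>" "k + 1 + 2 * \<nu> + \<nu> * k\<^sup>2 / (2 * c) \<le> \<mu>" "4 * \<nu> \<le> \<mu>"
    and t: "0 \<le> t"
  defines "M \<equiv> exp (2 * a * (R + 1)\<^sup>2) * (1 + \<nu> + \<nu> * \<mu>) * (data_norm u0 u1)\<^sup>2"
  shows "(\<integral>\<^sup>+x. ennreal (exp (2 * weight a t x) * (u t x)\<^sup>2) \<partial>lborel)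
      \<le> ennreal (4 / (\<nu> * \<mu>) * (1 + t) powr (1 - k) * M)" (is ?U)
    "(\<integral>\<^sup>+x. ennreal (exp (2 * weight a t x) * ((v t x)\<^sup>2 + (norm (weak_gradient (u t) x))\<^sup>2)) \<partial>lborel)
      \<le> ennreal ((1 + real DIM('a)) * (4 * (1 + t) powr (- 1 - k) * M))" (is ?V)
proof -
  have E: "energy_class u v" and S: "solves_damped_wave \<mu> u v"
    and AE0: "AE x in lborel. u 0 x = u0 x" "AE x in lborel. v 0 x = u1 x"
    using sol by (auto simp: energy_solution_def)
  let ?G = "\<lambda>b t y. weak_gradient (u t) y \<bullet> b"
  have L: "u t \<in> L2_space" "v t \<in> L2_space" "b \<in> Basis \<Longrightarrow> ?G b t \<in> L2_space" for b
    using energy_class_L2_continuous[OF E] t by (auto simp: L2_continuous_def)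
  have Wm [measurable]: "(\<lambda>x::'a. exp (2 * weight a t x)) \<in> borel_measurable borel"
    unfolding weight_def using t by (intro borel_measurable_continuous_onI continuous_intros) auto
  have AE: "AE x in lborel. R < norm x \<longrightarrow> u 0 x = 0" (is ?u) "AE x in lborel. R < norm x \<longrightarrow> v 0 x = 0" (is ?v)
  proof -
    have "x \<notin> K" if "R < norm x" for x
      using supp(3) that by auto
    then show ?u ?v
      using AE0 supp(1,2) unfolding supported_in_def by (eventually_elim; auto)+
  qed
  let ?I = "\<lambda>f :: 'a \<Rightarrow> real. \<integral>\<^sup>+x. ennreal (exp (2 * weight a t x) * (f x)\<^sup>2) \<partial>lborel"
  let ?M = "ennreal (4 * (1 + t) powr (- 1 - k) * M)"
  have bounds: "?I (conv \<rho> (u t)) \<le> ennreal (4 / (\<nu> * \<mu>) * (1 + t) powr (1 - k) * M)"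
    "?I (conv \<rho> (v t)) \<le> ?M"
    "b \<in> Basis \<Longrightarrow> ?I (conv \<rho> (?G b t)) \<le> ?M"
    if e: "e \<le> 1" and m: "mollifier e \<rho>" for e \<rho> b
  proof -
    interpret classical_damped_wave \<mu> "\<lambda>t. conv \<rho> (u t)" "\<lambda>t. conv \<rho> (v t)" "\<lambda>b t. conv \<rho> (?G b t)"
      "\<lambda>b t. conv (partial \<rho> b) (?G b t)"
      "\<lambda>b t. conv (partial \<rho> b) (v t)"
      by (rule mollified_classical_damped_wave[OF E S m]) (use large(1) in simp)
    have init: "conv \<rho> (u 0) x = 0 \<and> conv \<rho> (v 0) x = 0" if "R + 1 < norm x" for x
      using conv_zero_outside[OF mollifierD(1)[OF m] AE(1), of x]
        conv_zero_outside[OF mollifierD(1)[OF m] AE(2), of x] that e by auto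
    \<comment> \<open>Mollifying with radius at most 1 enlarges the initial support by at most 1,
      hence \<open>R + 1\<close> in the constant.\<close>
    have "0 \<le> R + 1" using supp(4) by simp
    note decay = weighted_decay[where R="R + 1", OF _ this \<delta> c \<delta>' \<nu> large t mollified_data_bound[OF sol u0 u1 m], folded a_def, folded M_def]
    show "?I (conv \<rho> (u t)) \<le> ennreal (4 / (\<nu> * \<mu>) * (1 + t) powr (1 - k) * M)"
      by (rule decay(1)) (rule init)
    show "?I (conv \<rho> (v t)) \<le> ?M"
      by (rule decay(2)) (rule init)
    show "?I (conv \<rho> (?G b t)) \<le> ?M" if "b \<in> Basis"
      by (rule decay(3)[OF _ that]) (rule init)
  qed
  note lsc = mollify_lower_semicontinuous[OF L2_locally_integrable Wm zero_less_one]
  show ?U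
    by (rule lsc[OF L(1)]) (rule bounds(1))
  have v: "?I (v t) \<le> ?M"
    by (rule lsc[OF L(2)]) (rule bounds(2))
  have g: "?I (?G b t) \<le> ?M" if "b \<in> Basis" for b
    by (rule lsc[OF L(3)[OF that]]) (rule bounds(3)[OF _ _ that])
  note [measurable] = L(1)[THEN L2_space_measurable] L(2)[THEN L2_space_measurable]
    L(3)[THEN L2_space_measurable]
  have M0: "0 \<le> M"
    unfolding M_def using \<nu>(2) large(1) by auto
  have "(\<integral>\<^sup>+x. ennreal (exp (2 * weight a t x) * ((v t x)\<^sup>2 + (norm (weak_gradient (u t) x))\<^sup>2)) \<partial>lborel)
      = (\<integral>\<^sup>+x. ennreal (exp (2 * weight a t x) * (v t x)\<^sup>2)
        + (\<Sum>b\<in>Basis. ennreal (exp (2 * weight a t x) * (?G b t x)\<^sup>2)) \<partial>lborel)"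
    by (intro nn_integral_cong) (simp add: norm_power2_Basis distrib_left sum_distrib_left sum_nonneg sum_ennreal ennreal_plus)
  also have "\<dots> = ?I (v t) + (\<Sum>b\<in>Basis. ?I (?G b t))"
    by (subst nn_integral_add; (subst nn_integral_sum)?; measurable)
  \<comment> \<open>Each component of the gradient gets the full bound ?M, hence the factor 1 +
    DIM.\<close>
  also have "\<dots> \<le> ?M + (\<Sum>b\<in>(Basis :: 'a set). ?M)"
    by (intro add_mono sum_mono v g)
  also have "\<dots> = ennreal ((1 + real DIM('a)) * (4 * (1 + t) powr (- 1 - k) * M))"
    using M0 by (simp add: distrib_right ennreal_plus ennreal_of_nat_eq_real_of_nat ennreal_mult)
  finally show ?V .
qed

text \<open>The constant is chosen after \<open>K\<close>, because the weight at time 0 is bounded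
  over a ball containing the supports, and it is a function of the data norm alone. With nonnegative
  integrals the estimates also assert that the weighted integrals are finite.\<close>

theorem theorem1p1:
  fixes \<epsilon> :: real
  assumes "\<epsilon> > 0"
  shows "\<exists>\<delta>>0. \<exists>\<mu>\<^sub>0>1. \<forall>\<mu>\<ge>\<mu>\<^sub>0. \<forall>K :: 'a::euclidean_space set. compact K \<longrightarrow>
    (\<exists>C :: real \<Rightarrow> real. (\<forall>m. C m > 0) \<and>
      (\<forall>u0 u1 u v. u0 \<in> H1_space \<longrightarrow> u1 \<in> L2_space \<longrightarrow>
         supported_in K u0 \<longrightarrow> supported_in K u1 \<longrightarrow> energy_solution \<mu> u0 u1 u v \<longrightarrow>
         (\<forall>t\<ge>0. let \<psi> = weight (\<mu> / (2 * (2 + \<delta>))) in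
           (\<integral>\<^sup>+x. ennreal (exp (2 * \<psi> t x) * (u t x)\<^sup>2) \<partial>lborel)
             \<le> ennreal (C (data_norm u0 u1) * (1 + t) powr (- real DIM('a) + \<epsilon>)) \<and>
           (\<integral>\<^sup>+x. ennreal (exp (2 * \<psi> t x) * ((v t x)\<^sup>2 + (norm (weak_gradient (u t) x))\<^sup>2)) \<partial>lborel)
             \<le> ennreal (C (data_norm u0 u1) * (1 + t) powr (- real DIM('a) - 2 + \<epsilon>)))))"
    (is "\<exists>\<delta>>0. \<exists>\<mu>\<^sub>0>1. \<forall>\<mu>\<ge>\<mu>\<^sub>0. \<forall>K. compact K \<longrightarrow> (\<exists>C. ?P \<delta> \<mu> K C)")
proof -
  define n where "n = real DIM('a)"
  have n: "1 \<le> n" using DIM_positive[where 'a='a] by (simp add: n_def Suc_leI)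
  \<comment> \<open>A smaller loss gives a stronger estimate, so \<epsilon> may be capped; the cap
    keeps k \<ge> n positive.\<close>
  define \<epsilon>' where "\<epsilon>' = min \<epsilon> 1"
  have \<epsilon>': "0 < \<epsilon>'" "\<epsilon>' \<le> \<epsilon>" "\<epsilon>' \<le> 1" using assms by (auto simp: \<epsilon>'_def)
  \<comment> \<open>Small enough for n / (2 + \<delta>) \<ge> n / 2 - \<epsilon>' / 4, which leaves
    c \<ge> \<epsilon>' / 4.\<close>
  define \<delta> where "\<delta> = \<epsilon>' / n"
  \<comment> \<open>The rates 1 - k and - 1 - k become - n + \<epsilon>' and - n - 2 +
    \<epsilon>'.\<close>
  define k where "k = n + 1 - \<epsilon>'"
  define c where "c = n / (2 + \<delta>) + 1 / 2 - k / 2"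
  define \<delta>' where "\<delta>' = \<delta> / (5 + \<delta>)"
  define \<nu> where "\<nu> = (k + 1) / (2 * \<delta>')"
  have \<delta>: "0 < \<delta>" using \<epsilon>' n by (simp add: \<delta>_def)
  have k: "0 < k" using n \<epsilon>' by (simp add: k_def)
  have c: "0 < c"
  proof -
    have n\<delta>: "n * \<delta> = \<epsilon>'" using n by (simp add: \<delta>_def)
    have "(n / 2 - \<epsilon>' / 4) * (2 + \<delta>) = n + n * \<delta> / 2 - \<epsilon>' / 2 - \<epsilon>' * \<delta> / 4"
      by (simp add: algebra_simps add_divide_distrib)
    also have "\<dots> \<le> n" using \<delta> \<epsilon>' by (simp add: n\<delta>)
    finally have "n / 2 - \<epsilon>' / 4 \<le> n / (2 + \<delta>)"
      using \<delta> by (simp add: pos_le_divide_eq)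
    then show ?thesis
      using \<epsilon>' by (simp add: c_def k_def field_simps)
  qed
  have \<delta>': "0 < \<delta>'" using \<delta> by (simp add: \<delta>'_def)
  have \<nu>: "\<nu> * \<delta>' = (k + 1) / 2" "0 < \<nu>"
    using \<delta>' k by (simp_all add: \<nu>_def)
  \<comment> \<open>The sum of all thresholds; its summands are nonnegative, so it exceeds each of
    them, and the 2 puts it above 1.\<close>
  define \<mu>0 where "\<mu>0 = 2 + \<nu> * (2 + \<delta>) / \<delta>' + (k + 1 + 2 * \<nu> + \<nu> * k\<^sup>2 / (2 * c)) + 4 * \<nu>"
  have parts: "0 \<le> \<nu> * (2 + \<delta>) / \<delta>'" "0 \<le> k + 1 + 2 * \<nu> + \<nu> * k\<^sup>2 / (2 * c)"
    using \<nu>(2) \<delta> \<delta>' k c by (auto intro!: add_nonneg_nonneg)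
  show ?thesis
  proof (rule exI[of _ \<delta>], intro conjI \<delta>, rule exI[of _ \<mu>0], intro conjI allI impI)
    show "1 < \<mu>0" using parts \<nu>(2) by (simp add: \<mu>0_def)
    fix \<mu> and K :: "'a set" assume \<mu>: "\<mu>0 \<le> \<mu>" and K: "compact K"
    have large: "1 \<le> \<mu>" "\<nu> * (2 + \<delta>) \<le> \<delta>' * \<mu>" "k + 1 + 2 * \<nu> + \<nu> * k\<^sup>2 / (2 * c) \<le> \<mu>" "4 * \<nu> \<le> \<mu>"
    proof -
      have "\<nu> * (2 + \<delta>) / \<delta>' \<le> \<mu>"
        using \<mu> parts \<nu>(2) unfolding \<mu>0_def by linarith
      then show "\<nu> * (2 + \<delta>) \<le> \<delta>' * \<mu>"
        using \<delta>' by (simp add: pos_divide_le_eq mult.commute)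
      show "1 \<le> \<mu>" "k + 1 + 2 * \<nu> + \<nu> * k\<^sup>2 / (2 * c) \<le> \<mu>" "4 * \<nu> \<le> \<mu>"
        using \<mu> parts \<nu>(2) unfolding \<mu>0_def by linarith+
    qed
    obtain R where R: "K \<subseteq> cball 0 R" "0 \<le> R"
    proof -
      obtain r where "\<And>x. x \<in> K \<Longrightarrow> norm x \<le> r"
        using compact_imp_bounded[OF K] by (auto simp: bounded_iff)
      then show ?thesis by (intro that[of "max 0 r"]) (auto simp: le_max_iff_disj)
    qed
    define A where "A = exp (2 * (\<mu> / (2 * (2 + \<delta>))) * (R + 1)\<^sup>2) * (1 + \<nu> + \<nu> * \<mu>)"
    have A: "0 < A" using \<nu>(2) large(1) by (auto simp: A_def intro!: mult_pos_pos add_pos_pos)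
    define B where "B = 4 / (\<nu> * \<mu>) + (1 + n) * 4"
    have B: "4 / (\<nu> * \<mu>) \<le> B" "(1 + n) * 4 \<le> B" "0 < B"
      using \<nu>(2) large(1) n by (auto simp: B_def intro!: add_pos_pos)
    \<comment> \<open>B covers the numerical factors of both estimates, and the summand 1 keeps C
      positive when the data vanish.\<close>
    define C where "C m = B * (A * (m\<^sup>2 + 1))" for m :: real
    have C: "0 < C m" for m
      using A B by (auto simp: C_def intro!: mult_pos_pos add_nonneg_pos)
    show "\<exists>C. ?P \<delta> \<mu> K C"
      unfolding Let_def
    proof (rule exI[of _ C], intro conjI allI impI C)
      fix u0 u1 :: "'a \<Rightarrow> real" and u v :: "real \<Rightarrow> 'a \<Rightarrow> real" and t :: real
      assume u0: "u0 \<in> H1_space" and u1: "u1 \<in> L2_space" and supp: "supported_in K u0" "supported_in K u1"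
        and sol: "energy_solution \<mu> u0 u1 u v" and t: "0 \<le> t"
      note * = energy_solution_weighted_decay[OF sol u0 u1 supp R \<delta> c_def[unfolded n_def] c \<delta>'_def \<nu> large t, folded A_def n_def]
      have le: "\<kappa> * (1 + t) powr s * (A * (data_norm u0 u1)\<^sup>2) \<le> C (data_norm u0 u1) * (1 + t) powr s'"
        if "0 \<le> \<kappa>" "\<kappa> \<le> B" "s \<le> s'" for \<kappa> s s'
      proof -
        have "\<kappa> * (1 + t) powr s * (A * (data_norm u0 u1)\<^sup>2) = \<kappa> * (A * (data_norm u0 u1)\<^sup>2) * (1 + t) powr s"
          by simp
        also have "\<dots> \<le> C (data_norm u0 u1) * (1 + t) powr s'"
          unfolding C_def using that A B t by (intro mult_mono powr_mono) auto
        finally show ?thesis .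
      qed
      show "(\<integral>\<^sup>+x. ennreal (exp (2 * weight (\<mu> / (2 * (2 + \<delta>))) t x) * (u t x)\<^sup>2) \<partial>lborel)
          \<le> ennreal (C (data_norm u0 u1) * (1 + t) powr (- real DIM('a) + \<epsilon>))"
        using le[of "4 / (\<nu> * \<mu>)" "1 - k" "- real DIM('a) + \<epsilon>"] B \<nu>(2) large(1) \<epsilon>'(2)
        by (intro order_trans[OF *(1)] ennreal_leI) (auto simp: k_def n_def)
      show "(\<integral>\<^sup>+x. ennreal (exp (2 * weight (\<mu> / (2 * (2 + \<delta>))) t x) * ((v t x)\<^sup>2 + (norm (weak_gradient (u t) x))\<^sup>2)) \<partial>lborel)
          \<le> ennreal (C (data_norm u0 u1) * (1 + t) powr (- real DIM('a) - 2 + \<epsilon>))"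
        using B n \<epsilon>'(2) by (intro order_trans[OF *(2)] ennreal_leI, unfold mult.assoc[symmetric] distrib_right[symmetric])
          (intro order_trans[OF _ le[of "(1 + n) * 4" "- 1 - k"]], auto simp: k_def n_def mult.assoc)
    qed
  qed
qed

end
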